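(* Let $\mathbb{M}$ be $\mathbb{R}^2$, $\mathbb{H}^2$ or $\mathbb{S}^2$. Let $\Omega\subset\mathbb{C}$ be a simply connected open set and let $X=(h,f),\ X^*=(h^*,f^* ):\Omega\to\mathbb{M}\times\mathbb{R}$ be two isometric conformal minimal immersions, with horizontal components $h,h^*:\Omega\to\mathbb{M}$. Assume that $h$ and $h^*$ share the same Hopf quadratic differential, i.e. $Q(h)=Q(h^* )$ on $\Omega$. Then $X$ and $X^*$ are equal up to an isometry of $\mathbb{M}\times\mathbb{R}$, i.e. there is an isometry $\Phi$ of $\mathbb{M}\times\mathbb{R}$ with $X^*=\Phi\circ X$.
   Context: The conformal metric on $\mathbb{M}$ is written $\sigma^2(z)|dz|^2$: $\sigma\equiv1$ for $\mathbb{M}=\mathbb{R}^2$; $\sigma(z)=2/(1-|z|^2)$ on the unit disc for $\mathbb{M}=\mathbb{H}^2$; $\sigma(z)=2/(1+|z|^2)$ in the stereographic charts for $\mathbb{M}=\mathbb{S}^2$. $\mathbb{M}\times\mathbb{R}$ carries the product metric $\sigma^2|dz|^2+dt^2$. Let $w=u+iv$ be the coordinate on $\Omega$. If $X=(h,f)$ is a conformal minimal immersion, then $h$ is a harmonic map and $f$ is a harmonic function. The Hopf (holomorphic) quadratic differential of $h$ is $Q(h)=(\sigma\circ h)^2\,h_w\,\overline{h}_w\,(dw)^2$, where $\overline{h}_w=\partial_w(\overline h)=\overline{h_{\bar w}}$. Two immersions of $\Omega$ are isometric if they induce the same metric on $\Omega$; the induced metric of a conformal immersion $X=(h,f)$ of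 this kind is $(\sigma\circ h)^2(|h_w|+|h_{\bar w}|)^2|dw|^2$. *)

theory Defs
  imports "HOL-Analysis.Analysis"
begin

text \<open>
  The surfaces \<open>\<real>\<^sup>2\<close>, \<open>\<H>\<^sup>2\<close> and \<open>\<S>\<^sup>2\<close> are given as sets of points of \<open>\<complex> \<times> \<real> \<cong> \<real>\<^sup>3\<close>: the equatorial
  plane, the unit disc in it, and the unit sphere. The metric does not come from this ambient
  space; it is \<open>\<sigma>(z)\<^sup>2 |dz|\<^sup>2\<close> in the charts below.
\<close>

datatype surface = Euclidean | Hyperbolic | Spherical

type_synonym point = "complex \<times> real"

fun points :: "surface \<Rightarrow> point set" where
  "points Euclidean = {p. snd p = 0}"
| "points Hyperbolic = {p. snd p = 0 \<and> cmod (fst p) < 1}"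
| "points Spherical = sphere 0 1"

fun conf :: "surface \<Rightarrow> complex \<Rightarrow> real" where
  "conf Euclidean z = 1"
| "conf Hyperbolic z = 2 / (1 - (cmod z)\<^sup>2)"
| "conf Spherical z = 2 / (1 + (cmod z)\<^sup>2)"

text \<open>
  Every point \<open>p\<close> has a preferred chart, \<open>chart M p\<close>, with domain \<open>chart_domain M p\<close>. On the sphere this is
  the stereographic projection from the north pole \<open>(0, 1)\<close>, except that the north pole itself
  uses the projection from the south pole. The transition map between the two is \<open>z \<mapsto> 1 / cnj z\<close>,
  which preserves both \<open>\<sigma>(z)\<^sup>2 |dz|\<^sup>2\<close> and the Hopf differential (\<open>h\<^sub>w\<close> and \<open>(cnj h)\<^sub>w\<close> are
  interchanged), so nothing below depends on the choice of chart.
\<close>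

fun chart_domain :: "surface \<Rightarrow> point \<Rightarrow> point set" where
  "chart_domain Spherical p = points Spherical - {if p = (0, 1) then (0, - 1) else (0, 1)}"
| "chart_domain M p = points M"

fun chart :: "surface \<Rightarrow> point \<Rightarrow> point \<Rightarrow> complex" where
  "chart Spherical p q =
     (if p = (0, 1) then fst q /\<^sub>R (1 + snd q) else fst q /\<^sub>R (1 - snd q))"
| "chart M p q = fst q"

definition prod_points :: "surface \<Rightarrow> (point \<times> real) set" where
  "prod_points M = points M \<times> UNIV"

definition prod_chart_domain :: "surface \<Rightarrow> point \<times> real \<Rightarrow> (point \<times> real) set" where
  "prod_chart_domain M P = chart_domain M (fst P) \<times> UNIV"

definition prod_chart :: "surface \<Rightarrow> point \<times> real \<Rightarrow> point \<times> real \<Rightarrow> complex \<times> real" where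
  "prod_chart M P Q = (chart M (fst P) (fst Q), snd Q)"

definition prod_chart_inv :: "surface \<Rightarrow> point \<times> real \<Rightarrow> complex \<times> real \<Rightarrow> point \<times> real" where
  "prod_chart_inv M P = inv_into (prod_chart_domain M P) (prod_chart M P)"

definition prod_metric ::
    "surface \<Rightarrow> complex \<times> real \<Rightarrow> complex \<times> real \<Rightarrow> complex \<times> real \<Rightarrow> real" where
  "prod_metric M x \<xi> \<eta> = (conf M (fst x))\<^sup>2 * (fst \<xi> \<bullet> fst \<eta>) + snd \<xi> * snd \<eta>"

text \<open>
  For open \<open>S\<close>, continuity of all iterated directional derivatives up to order \<open>k\<close> is the usual
  notion of class \<open>C\<^sup>k\<close>, since the domain has finite dimension.
\<close>

fun Ck_on :: "nat \<Rightarrow> ('a::euclidean_space \<Rightarrow> 'b::euclidean_space) \<Rightarrow> 'a set \<Rightarrow> bool" where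
  "Ck_on 0 F S \<longleftrightarrow> continuous_on S F"
| "Ck_on (Suc k) F S \<longleftrightarrow>
     (\<forall>x\<in>S. F differentiable at x) \<and> (\<forall>v. Ck_on k (\<lambda>x. frechet_derivative F (at x) v) S)"

definition smooth_on :: "('a::euclidean_space \<Rightarrow> 'b::euclidean_space) \<Rightarrow> 'a set \<Rightarrow> bool" where
  "smooth_on F S \<longleftrightarrow> (\<forall>k. Ck_on k F S)"

definition local_rep ::
    "surface \<Rightarrow> ('a \<Rightarrow> point \<times> real) \<Rightarrow> 'a \<Rightarrow> 'a \<Rightarrow> complex \<times> real" where
  "local_rep M X x = (\<lambda>y. prod_chart M (X x) (X y))"

definition smooth_into ::
    "surface \<Rightarrow> ('a::euclidean_space \<Rightarrow> point \<times> real) \<Rightarrow> 'a set \<Rightarrow> bool" where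
  "smooth_into M X S \<longleftrightarrow> X ` S \<subseteq> prod_points M \<and>
     (\<forall>x\<in>S. \<exists>U. open U \<and> x \<in> U \<and> U \<subseteq> S \<and> X ` U \<subseteq> prod_chart_domain M (X x) \<and>
        smooth_on (local_rep M X x) U)"

definition tangent ::
    "surface \<Rightarrow> ('a::euclidean_space \<Rightarrow> point \<times> real) \<Rightarrow> 'a \<Rightarrow> 'a \<Rightarrow> complex \<times> real" where
  "tangent M X x v = frechet_derivative (local_rep M X x) (at x) v"

definition induced_metric ::
    "surface \<Rightarrow> ('a::euclidean_space \<Rightarrow> point \<times> real) \<Rightarrow> 'a \<Rightarrow> 'a \<Rightarrow> 'a \<Rightarrow> real" where
  "induced_metric M X x v w =
     prod_metric M (local_rep M X x x) (tangent M X x v) (tangent M X x w)"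

definition immersion_on :: "surface \<Rightarrow> complex set \<Rightarrow> (complex \<Rightarrow> point \<times> real) \<Rightarrow> bool" where
  "immersion_on M \<Omega> X \<longleftrightarrow> smooth_into M X \<Omega> \<and> (\<forall>w\<in>\<Omega>. inj (tangent M X w))"

definition conformal_on :: "surface \<Rightarrow> complex set \<Rightarrow> (complex \<Rightarrow> point \<times> real) \<Rightarrow> bool" where
  "conformal_on M \<Omega> X \<longleftrightarrow>
     (\<forall>w\<in>\<Omega>. \<exists>c>0. \<forall>a b. induced_metric M X w a b = c * (a \<bullet> b))"

text \<open>
  The Koszul formula for fields with constant coefficients in a chart: \<open>koszul M x \<xi> \<eta> \<zeta>\<close> is
  \<open>\<langle>\<nabla>\<^sub>\<xi> \<eta>, \<zeta>\<rangle>\<close> at \<open>x\<close> (a Christoffel symbol of the first kind). Hence, along an immersion \<open>X\<close>,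
  \<open>\<langle>\<nabla>\<^sub>a (X\<^sub>b), \<nu>\<rangle> = \<langle>X\<^sub>a\<^sub>b, \<nu>\<rangle> + koszul M x X\<^sub>a X\<^sub>b \<nu>\<close>, which is the second fundamental form in the
  direction \<open>\<nu>\<close> if \<open>\<nu>\<close> is normal.
\<close>

definition koszul ::
    "surface \<Rightarrow> complex \<times> real \<Rightarrow> complex \<times> real \<Rightarrow> complex \<times> real \<Rightarrow> complex \<times> real \<Rightarrow> real" where
  "koszul M x \<xi> \<eta> \<zeta> =
     (frechet_derivative (\<lambda>y. prod_metric M y \<eta> \<zeta>) (at x) \<xi>
      + frechet_derivative (\<lambda>y. prod_metric M y \<xi> \<zeta>) (at x) \<eta>
      - frechet_derivative (\<lambda>y. prod_metric M y \<xi> \<eta>) (at x) \<zeta>) / 2"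

definition second_form ::
    "surface \<Rightarrow> (complex \<Rightarrow> point \<times> real) \<Rightarrow> complex \<Rightarrow> complex \<times> real \<Rightarrow> complex \<Rightarrow> complex \<Rightarrow> real"
  where
  "second_form M X w \<nu> a b =
     prod_metric M (local_rep M X w w)
       (frechet_derivative (\<lambda>y. frechet_derivative (local_rep M X w) (at y) b) (at w) a) \<nu>
     + koszul M (local_rep M X w w) (tangent M X w a) (tangent M X w b) \<nu>"

definition unit_normal ::
    "surface \<Rightarrow> (complex \<Rightarrow> point \<times> real) \<Rightarrow> complex \<Rightarrow> complex \<times> real \<Rightarrow> bool" where
  "unit_normal M X w \<nu> \<longleftrightarrow>
     prod_metric M (local_rep M X w w) \<nu> \<nu> = 1 \<and>
     (\<forall>a. prod_metric M (local_rep M X w w) (tangent M X w a) \<nu> = 0)"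

definition mean_curvature ::
    "surface \<Rightarrow> (complex \<Rightarrow> point \<times> real) \<Rightarrow> complex \<Rightarrow> complex \<times> real \<Rightarrow> real" where
  "mean_curvature M X w \<nu> =
     (let I = induced_metric M X w; II = second_form M X w \<nu> in
      (I 1 1 * II \<i> \<i> - 2 * I 1 \<i> * II 1 \<i> + I \<i> \<i> * II 1 1)
      / (2 * (I 1 1 * I \<i> \<i> - (I 1 \<i>)\<^sup>2)))"

definition minimal_on :: "surface \<Rightarrow> complex set \<Rightarrow> (complex \<Rightarrow> point \<times> real) \<Rightarrow> bool" where
  "minimal_on M \<Omega> X \<longleftrightarrow> (\<forall>w\<in>\<Omega>. \<forall>\<nu>. unit_normal M X w \<nu> \<longrightarrow> mean_curvature M X w \<nu> = 0)"

definition conformal_minimal_immersion ::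
    "surface \<Rightarrow> complex set \<Rightarrow> (complex \<Rightarrow> point \<times> real) \<Rightarrow> bool" where
  "conformal_minimal_immersion M \<Omega> X \<longleftrightarrow>
     immersion_on M \<Omega> X \<and> conformal_on M \<Omega> X \<and> minimal_on M \<Omega> X"

definition isometric_on ::
    "surface \<Rightarrow> complex set \<Rightarrow> (complex \<Rightarrow> point \<times> real) \<Rightarrow> (complex \<Rightarrow> point \<times> real) \<Rightarrow> bool" where
  "isometric_on M \<Omega> X Y \<longleftrightarrow>
     (\<forall>w\<in>\<Omega>. \<forall>a b. induced_metric M X w a b = induced_metric M Y w a b)"

text \<open>\<open>\<partial>\<^sub>w = (\<partial>\<^sub>u - \<i> \<partial>\<^sub>v) / 2\<close>, and the coefficient of \<open>(dw)\<^sup>2\<close> in the Hopf differential.\<close>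

definition d_w :: "(complex \<Rightarrow> complex) \<Rightarrow> complex \<Rightarrow> complex" where
  "d_w F w = (frechet_derivative F (at w) 1 - \<i> * frechet_derivative F (at w) \<i>) / 2"

definition hopf :: "surface \<Rightarrow> (complex \<Rightarrow> point) \<Rightarrow> complex \<Rightarrow> complex" where
  "hopf M h w =
     (let H = (\<lambda>y. chart M (h w) (h y)) in
      complex_of_real ((conf M (H w))\<^sup>2) * d_w H w * d_w (\<lambda>y. cnj (H y)) w)"

text \<open>Riemannian isometries of \<open>M \<times> \<real>\<close>: diffeomorphisms that preserve the metric tensor.\<close>

definition smooth_self_map :: "surface \<Rightarrow> (point \<times> real \<Rightarrow> point \<times> real) \<Rightarrow> bool" where
  "smooth_self_map M \<Phi> \<longleftrightarrow>
     (\<forall>P\<in>prod_points M.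
        smooth_into M (\<Phi> \<circ> prod_chart_inv M P) (prod_chart M P ` prod_chart_domain M P))"

definition prod_isometry :: "surface \<Rightarrow> (point \<times> real \<Rightarrow> point \<times> real) \<Rightarrow> bool" where
  "prod_isometry M \<Phi> \<longleftrightarrow>
     bij_betw \<Phi> (prod_points M) (prod_points M) \<and>
     smooth_self_map M \<Phi> \<and> smooth_self_map M (inv_into (prod_points M) \<Phi>) \<and>
     (\<forall>P\<in>prod_points M. \<forall>\<xi> \<eta>.
        induced_metric M (\<Phi> \<circ> prod_chart_inv M P) (prod_chart M P P) \<xi> \<eta>
        = prod_metric M (prod_chart M P P) \<xi> \<eta>)"

end

theory Submission
  imports Defs
begin

text \<open>
Both surfaces have the form \<open>X = (h, f)\<close>, and conformality reads \<open>Q(h) = - f\<^sub>w\<^sup>2\<close>. Hence equal Hopf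
differentials give \<open>f'\<^sub>w\<^sup>2 = f\<^sub>w\<^sup>2\<close>. The two heights are harmonic, so \<open>f' = \<plusminus> f + d\<close> with one sign on all of
\<open>\<Omega>\<close> (\<open>harmonic_equal_squares\<close>). Then \<open>df\<^sup>2 = df'\<^sup>2\<close>, and subtracting it from the common induced metric
shows that \<open>h\<close> and \<open>h'\<close> pull the metric of the surface back to the same, possibly degenerate, symmetric
form \<open>G\<close>. What remains is a rigidity statement: two harmonic maps with the same pulled-back metric
differ by an isometry of the target (\<open>harmonic_congruence\<close>).

To treat the three geometries at once, the surface of curvature \<open>\<kappa>\<close> is embedded in \<open>\<real>\<^sup>3\<close>, as the plane at
height 1, the upper sheet of the hyperboloid or the sphere, where \<open>\<real>\<^sup>3\<close> carries the form
\<open>x \<bullet> y + \<kappa> s t\<close>. Its isometries are then linear, and for the embedded map \<open>H\<close> the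
minimal surface equations become \<open>\<Delta>f = 0\<close> and \<open>\<Delta>H = - \<kappa> (tr G) H\<close> (\<open>conformal_minimal_equations\<close>).
The coefficient in the second equation depends on \<open>G\<close> only. So if \<open>A\<close> is a linear isometry, every
component of \<open>A H - H'\<close> solves the same linear equation \<open>\<Delta>u = q u\<close>, and by unique continuation
it is enough to find \<open>A\<close> with \<open>A H = H'\<close> on one small disc.

There are two cases. If \<open>G\<close> is nondegenerate at some point \<open>p\<close>, choose \<open>A\<close> to match \<open>H\<close> and its first
derivatives at \<open>p\<close>. The second derivatives of \<open>H\<close> are determined by \<open>G\<close> and the frame formed by \<open>H\<close> and
its first derivatives, so a Gronwall argument gives equality near \<open>p\<close>. If \<open>G\<close> is degenerate
everywhere, the surface is a vertical cylinder over a geodesic: \<open>H\<^sub>u = - f\<^sub>v \<xi>\<close>, \<open>H\<^sub>v = f\<^sub>u \<xi>\<close> with a unit tangent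
field \<open>\<xi>\<close>, and \<open>(H, \<xi>)\<close> solves a linear first order system whose coefficients involve only \<open>f\<close>; the same
Gronwall argument applies.

Unique continuation for \<open>\<Delta>u = q u\<close> with \<open>q\<close> merely continuous is obtained from the monotonicity of a
frequency function on circles (\<open>strip_unique_continuation\<close>). It is what excludes a change of the isometry
along the curves on which the tangent plane of \<open>X\<close> is vertical: there \<open>G\<close> degenerates, and these curves
may separate \<open>\<Omega>\<close>.
\<close>

section \<open>Directional derivatives and maps of class \<open>C\<^sup>k\<close>\<close>

text \<open>
The direction comes before the map, so that \<open>dd a (dd b F)\<close> is the second derivative \<open>F\<^sub>a\<^sub>b\<close> and
\<open>dd 1\<close>, \<open>dd \<i>\<close> are \<open>\<partial>\<^sub>u\<close>, \<open>\<partial>\<^sub>v\<close> on \<open>\<complex>\<close>.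
\<close>

definition dd :: "'a \<Rightarrow> ('a::euclidean_space \<Rightarrow> 'b::euclidean_space) \<Rightarrow> 'a \<Rightarrow> 'b" where
  "dd v F x = frechet_derivative F (at x) v"

lemma dd_eqI: "(F has_derivative F') (at x) \<Longrightarrow> dd v F x = F' v"
  unfolding dd_def using frechet_derivative_at by metis

lemma Ck_on_Suc_dd:
  "Ck_on (Suc k) F S \<longleftrightarrow> (\<forall>x\<in>S. F differentiable at x) \<and> (\<forall>v. Ck_on k (dd v F) S)"
  by (simp add: dd_def[abs_def])

declare Ck_on.simps(2) [simp del]

lemma Ck_on_cong:
  assumes "open S" "Ck_on k F S" "\<And>x. x \<in> S \<Longrightarrow> F x = G x"
  shows "Ck_on k G S"
  using assms(2,3)
proof (induction k arbitrary: F G)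
  case 0
  then show ?case using continuous_on_cong[of S S F G] by auto
next
  case (Suc k)
  have d: "(G has_derivative frechet_derivative F (at x)) (at x)" if "x \<in> S" for x
  proof -
    have "(F has_derivative frechet_derivative F (at x)) (at x)"
      using Suc.prems(1) that by (simp add: Ck_on_Suc_dd frechet_derivative_works)
    then show ?thesis
      using has_derivative_transform_within_open[OF _ assms(1) that] Suc.prems(2) by blast
  qed
  have "Ck_on k (dd v G) S" for v
  proof (rule Suc.IH)
    show "Ck_on k (dd v F) S" using Suc.prems by (simp add: Ck_on_Suc_dd)
    show "dd v F x = dd v G x" if "x \<in> S" for x
      using dd_eqI[OF d[OF that]] by (simp add: dd_def)
  qed
  then show ?case
    using d by (auto simp: Ck_on_Suc_dd differentiable_def)
qed

lemma Ck_on_SucI: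
  assumes "open S" "\<And>x. x \<in> S \<Longrightarrow> (F has_derivative F' x) (at x)"
    and "\<And>v. Ck_on k (\<lambda>x. F' x v) S"
  shows "Ck_on (Suc k) F S"
proof -
  have "Ck_on k (dd v F) S" for v
    by (rule Ck_on_cong[OF assms(1) assms(3)[of v]]) (rule dd_eqI[OF assms(2), symmetric])
  then show ?thesis
    using assms(2) by (auto simp: Ck_on_Suc_dd differentiable_def)
qed

lemma Ck_on_has_derivative:
  assumes "Ck_on (Suc k) F S" "x \<in> S"
  shows "(F has_derivative (\<lambda>v. dd v F x)) (at x)"
  using assms unfolding Ck_on_Suc_dd dd_def by (simp add: frechet_derivative_works)

lemma Ck_on_Suc_imp: "Ck_on (Suc k) F S \<Longrightarrow> Ck_on k F S"
proof (induction k arbitrary: F)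
  case 0
  then show ?case
    by (simp add: Ck_on_Suc_dd continuous_at_imp_continuous_on differentiable_imp_continuous_within)
next
  case (Suc k)
  then show ?case by (simp add: Ck_on_Suc_dd)
qed

lemma Ck_on_subset: "Ck_on k F S \<Longrightarrow> T \<subseteq> S \<Longrightarrow> Ck_on k F T"
proof (induction k arbitrary: F)
  case 0
  then show ?case using continuous_on_subset by auto
next
  case (Suc k)
  then show ?case by (simp add: Ck_on_Suc_dd subset_iff)
qed

lemma Ck_on_local:
  assumes "\<And>x. x \<in> S \<Longrightarrow> \<exists>U. open U \<and> x \<in> U \<and> Ck_on k F U"
  shows "Ck_on k F S"
  using assms
proof (induction k arbitrary: F)
  case 0
  have "continuous (at x) F" if "x \<in> S" for x
    using 0[OF that] continuous_on_eq_continuous_at by auto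
  then show ?case by (simp add: continuous_at_imp_continuous_on)
next
  case (Suc k)
  have d: "F differentiable at x" if x: "x \<in> S" for x
  proof -
    obtain U where "x \<in> U" "Ck_on (Suc k) F U" using Suc.prems[OF x] by blast
    then show ?thesis by (simp add: Ck_on_Suc_dd)
  qed
  have "Ck_on k (dd v F) S" for v
  proof (rule Suc.IH)
    fix x assume x: "x \<in> S"
    obtain U where "open U" "x \<in> U" "Ck_on (Suc k) F U" using Suc.prems[OF x] by blast
    then show "\<exists>U. open U \<and> x \<in> U \<and> Ck_on k (dd v F) U"
      unfolding Ck_on_Suc_dd by blast
  qed
  then show ?case using d by (simp add: Ck_on_Suc_dd)
qed

lemma Ck_on_const: "Ck_on k (\<lambda>x. c) S"
proof (induction k arbitrary: c)
  case (Suc k)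
  then show ?case by (simp add: Ck_on.simps(2))
qed simp

lemma Ck_on_linear:
  assumes "open S" "bounded_linear L"
  shows "Ck_on k L S"
proof (cases k)
  case 0
  then show ?thesis using assms by (simp add: linear_continuous_on)
next
  case (Suc j)
  have "Ck_on (Suc j) L S"
    by (rule Ck_on_SucI[where F' = "\<lambda>_. L"])
      (use assms in \<open>simp_all add: Ck_on_const bounded_linear_imp_has_derivative\<close>)
  then show ?thesis using Suc by simp
qed

lemma Ck_on_id: "open S \<Longrightarrow> Ck_on k (\<lambda>x. x) S"
  by (rule Ck_on_linear[OF _ bounded_linear_ident])

lemma Ck_on_linear_compose:
  assumes "open S" "bounded_linear L" "Ck_on k F S"
  shows "Ck_on k (\<lambda>x. L (F x)) S"
  using assms(3)
proof (induction k arbitrary: F)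
  case 0
  then show ?case using bounded_linear.continuous_on[OF assms(2), of S F] by simp
next
  case (Suc k)
  have "Ck_on k (dd v F) S" for v using Suc.prems by (simp add: Ck_on_Suc_dd)
  then have *: "Ck_on k (\<lambda>x. L (dd v F x)) S" for v by (rule Suc.IH)
  show ?case
    by (rule Ck_on_SucI[OF assms(1) bounded_linear.has_derivative[OF assms(2)
            Ck_on_has_derivative[OF Suc.prems]] *])
qed

lemma Ck_on_add:
  assumes "open S" "Ck_on k F S" "Ck_on k G S"
  shows "Ck_on k (\<lambda>x. F x + G x) S"
  using assms(2,3)
proof (induction k arbitrary: F G)
  case 0
  then show ?case using continuous_on_add[of S F G] by simp
next
  case (Suc k)
  have *: "Ck_on k (\<lambda>x. dd v F x + dd v G x) S" for v
    using Suc by (simp add: Ck_on_Suc_dd)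
  show ?case
    by (rule Ck_on_SucI[OF assms(1) has_derivative_add[OF Ck_on_has_derivative[OF Suc.prems(1)]
          Ck_on_has_derivative[OF Suc.prems(2)]] *])
qed

lemma Ck_on_sum:
  assumes "open S" "\<And>i. i \<in> I \<Longrightarrow> Ck_on k (F i) S"
  shows "Ck_on k (\<lambda>x. \<Sum>i\<in>I. F i x) S"
  using assms(2)
proof (induction I rule: infinite_finite_induct)
  case (insert i I)
  have "Ck_on k (\<lambda>x. F i x + (\<Sum>i\<in>I. F i x)) S"
    by (rule Ck_on_add[OF assms(1)]) (use insert in simp_all)
  then show ?case using insert.hyps by simp
qed (simp_all add: Ck_on_const)

lemma Ck_on_bilinear:
  assumes "open S" "bounded_bilinear B" "Ck_on k F S" "Ck_on k G S"
  shows "Ck_on k (\<lambda>x. B (F x) (G x)) S"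
  using assms(3,4)
proof (induction k arbitrary: F G)
  case 0
  then show ?case using bounded_bilinear.continuous_on[OF assms(2), of S F G] by simp
next
  case (Suc k)
  have *: "Ck_on k (\<lambda>x. B (F x) (dd v G x) + B (dd v F x) (G x)) S" for v
  proof (rule Ck_on_add[OF assms(1)]; rule Suc.IH)
    show "Ck_on k F S" "Ck_on k G S" using Suc.prems Ck_on_Suc_imp by blast+
    show "Ck_on k (dd v F) S" "Ck_on k (dd v G) S" using Suc.prems by (simp_all add: Ck_on_Suc_dd)
  qed
  show ?case
    by (rule Ck_on_SucI[OF assms(1) bounded_bilinear.FDERIV[OF assms(2) Ck_on_has_derivative[OF Suc.prems(1)]
          Ck_on_has_derivative[OF Suc.prems(2)]] *])
qed

text \<open>
By the chain rule a derivative of \<open>F \<circ> G\<close> is \<open>\<Sum>\<^sub>b (G\<^sub>v \<bullet> b) F\<^sub>b \<circ> G\<close>, a sum over the standard basis of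
products of maps to which the induction hypothesis applies.
\<close>

lemma Ck_on_compose:
  assumes "open S" "open T" "G ` S \<subseteq> T" "Ck_on k F T" "Ck_on k G S"
  shows "Ck_on k (\<lambda>x. F (G x)) S"
  using assms(4,5)
proof (induction k arbitrary: F)
  case 0
  then show ?case using assms(3) continuous_on_compose2 by fastforce
next
  case (Suc k)
  have d: "((\<lambda>x. F (G x)) has_derivative (\<lambda>v. dd (dd v G x) F (G x))) (at x)" if "x \<in> S" for x
    using has_derivative_compose[OF Ck_on_has_derivative[OF Suc.prems(2) that]
        Ck_on_has_derivative[OF Suc.prems(1)]] that assms(3) by auto
  have eq: "dd u F y = (\<Sum>b\<in>Basis. (u \<bullet> b) *\<^sub>R dd b F y)" if "y \<in> T" for u y
  proof -
    have "linear (\<lambda>v. dd v F y)"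
      using Ck_on_has_derivative[OF Suc.prems(1) that] has_derivative_linear by blast
    from linear_sum[OF this, of "\<lambda>b. (u \<bullet> b) *\<^sub>R b" Basis] linear_scale[OF this]
    have "dd (\<Sum>b\<in>Basis. (u \<bullet> b) *\<^sub>R b) F y = (\<Sum>b\<in>Basis. (u \<bullet> b) *\<^sub>R dd b F y)"
      by simp
    then show ?thesis by (simp add: euclidean_representation)
  qed
  have "Ck_on k (\<lambda>x. \<Sum>b\<in>Basis. (dd v G x \<bullet> b) *\<^sub>R dd b F (G x)) S" for v
  proof (intro Ck_on_sum assms(1) Ck_on_bilinear[OF assms(1) bounded_bilinear_scaleR])
    fix b :: 'b assume "b \<in> Basis"
    show "Ck_on k (\<lambda>x. dd v G x \<bullet> b) S"
      by (rule Ck_on_linear_compose[OF assms(1) bounded_linear_inner_left])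
        (use Suc.prems in \<open>simp add: Ck_on_Suc_dd\<close>)
    show "Ck_on k (\<lambda>x. dd b F (G x)) S"
      by (rule Suc.IH) (use Suc.prems Ck_on_Suc_imp in \<open>simp_all add: Ck_on_Suc_dd\<close>)
  qed
  then have *: "Ck_on k (\<lambda>x. dd (dd v G x) F (G x)) S" for v
    by (rule Ck_on_cong[OF assms(1)]) (use assms(3) eq in force)
  show ?case
    by (rule Ck_on_SucI[OF assms(1) d *])
qed

lemma Ck_on_inverse:
  fixes F :: "'a::euclidean_space \<Rightarrow> real"
  assumes "open S" "Ck_on k F S" "\<And>x. x \<in> S \<Longrightarrow> F x \<noteq> 0"
  shows "Ck_on k (\<lambda>x. inverse (F x)) S"
  using assms(2)
proof (induction k)
  case 0
  then show ?case using assms(3) by (auto intro!: continuous_intros)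
next
  case (Suc k)
  have i: "Ck_on k (\<lambda>x. inverse (F x)) S" using Suc Ck_on_Suc_imp by blast
  have d: "((\<lambda>x. inverse (F x)) has_derivative (\<lambda>v. inverse (F x) * inverse (F x) * (- dd v F x))) (at x)"
    if "x \<in> S" for x
    using Ck_on_has_derivative[OF Suc.prems that] assms(3)[OF that]
    by (auto intro!: derivative_eq_intros)
  have "Ck_on k (\<lambda>x. - dd v F x) S" for v
    using Suc.prems Ck_on_linear_compose[OF assms(1) bounded_linear_minus[OF bounded_linear_ident], of k "dd v F"]
    by (simp add: Ck_on_Suc_dd)
  then have *: "Ck_on k (\<lambda>x. inverse (F x) * inverse (F x) * (- dd v F x)) S" for v
    by (rule Ck_on_bilinear[OF assms(1) bounded_bilinear_mult
          Ck_on_bilinear[OF assms(1) bounded_bilinear_mult i i]])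
  show ?case by (rule Ck_on_SucI[OF assms(1) d *])
qed

lemma smooth_on_imp_Ck: "smooth_on F S \<Longrightarrow> Ck_on k F S"
  by (simp add: smooth_on_def)

lemma smooth_on_dd: "smooth_on F S \<Longrightarrow> smooth_on (dd v F) S"
  unfolding smooth_on_def by (metis Ck_on_Suc_dd)

lemma smooth_on_has_derivative:
  "smooth_on F S \<Longrightarrow> x \<in> S \<Longrightarrow> (F has_derivative (\<lambda>v. dd v F x)) (at x)"
  unfolding smooth_on_def using Ck_on_has_derivative by blast

lemma smooth_on_continuous: "smooth_on F S \<Longrightarrow> continuous_on S F"
  unfolding smooth_on_def by (metis Ck_on.simps(1))

lemma dd_lin:
  assumes "smooth_on F S" "x \<in> S"
  shows "linear (\<lambda>v. dd v F x)"
  using smooth_on_has_derivative[OF assms] has_derivative_linear by blast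

text \<open>
Two applications of the mean value theorem, first along \<open>a\<close>, then along \<open>b\<close>. The left-hand side is
symmetric in \<open>a\<close> and \<open>b\<close>; letting \<open>t \<rightarrow> 0\<close> therefore proves that second derivatives commute.
\<close>

lemma second_difference_mvt:
  fixes F :: "'a::euclidean_space \<Rightarrow> real"
  assumes "Ck_on 2 F (ball x r)" "0 < t" "t * (norm a + norm b) < r"
  shows "\<exists>\<sigma> \<tau>. 0 < \<sigma> \<and> \<sigma> < t \<and> 0 < \<tau> \<and> \<tau> < t \<and>
    F (x + t *\<^sub>R a + t *\<^sub>R b) - F (x + t *\<^sub>R a) - F (x + t *\<^sub>R b) + F x
      = t * t * dd b (dd a F) (x + \<sigma> *\<^sub>R a + \<tau> *\<^sub>R b)"
proof -
  have C: "Ck_on (Suc (Suc 0)) F (ball x r)" using assms(1) by (simp add: numeral_2_eq_2)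
  then have C': "Ck_on (Suc 0) (dd a F) (ball x r)" by (simp add: Ck_on_Suc_dd[of "Suc 0"])
  have inb: "x + \<sigma> *\<^sub>R a + \<tau> *\<^sub>R b \<in> ball x r" if "0 \<le> \<sigma>" "\<sigma> \<le> t" "0 \<le> \<tau>" "\<tau> \<le> t" for \<sigma> \<tau>
  proof -
    have "norm (\<sigma> *\<^sub>R a + \<tau> *\<^sub>R b) \<le> \<sigma> * norm a + \<tau> * norm b"
      using norm_triangle_ineq[of "\<sigma> *\<^sub>R a" "\<tau> *\<^sub>R b"] that by simp
    also have "\<dots> \<le> t * norm a + t * norm b"
      using that by (intro add_mono mult_right_mono) auto
    also have "\<dots> < r" using assms(3) by (simp add: algebra_simps)
    finally show ?thesis by (simp add: dist_norm norm_minus_commute add.assoc add.commute)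
  qed
  have d1: "((\<lambda>s. F (x + s *\<^sub>R a + \<tau> *\<^sub>R b)) has_real_derivative dd a F (x + \<sigma> *\<^sub>R a + \<tau> *\<^sub>R b)) (at \<sigma>)"
    if "0 \<le> \<sigma>" "\<sigma> \<le> t" "0 \<le> \<tau>" "\<tau> \<le> t" for \<sigma> \<tau>
  proof -
    have l: "((\<lambda>s. x + s *\<^sub>R a + \<tau> *\<^sub>R b) has_derivative (\<lambda>s. s *\<^sub>R a)) (at \<sigma>)"
      by (auto intro!: derivative_eq_intros)
    have F: "(F has_derivative (\<lambda>v. dd v F (x + \<sigma> *\<^sub>R a + \<tau> *\<^sub>R b))) (at (x + \<sigma> *\<^sub>R a + \<tau> *\<^sub>R b))"
      by (rule Ck_on_has_derivative[OF C inb[OF that]])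
    have "dd (s *\<^sub>R a) F y = s * dd a F y" if "y \<in> ball x r" for s y
      using linear_scale[OF has_derivative_linear[OF Ck_on_has_derivative[OF C that]]] by simp
    then show ?thesis
      using has_derivative_compose[OF l F] inb[OF that]
      by (simp add: has_field_derivative_def mult_commute_abs)
  qed
  have d2: "((\<lambda>s. dd a F (x + \<sigma> *\<^sub>R a + s *\<^sub>R b)) has_real_derivative dd b (dd a F) (x + \<sigma> *\<^sub>R a + \<tau> *\<^sub>R b)) (at \<tau>)"
    if "0 \<le> \<sigma>" "\<sigma> \<le> t" "0 \<le> \<tau>" "\<tau> \<le> t" for \<sigma> \<tau>
  proof -
    have l: "((\<lambda>s. x + \<sigma> *\<^sub>R a + s *\<^sub>R b) has_derivative (\<lambda>s. s *\<^sub>R b)) (at \<tau>)"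
      by (auto intro!: derivative_eq_intros)
    have F: "(dd a F has_derivative (\<lambda>v. dd v (dd a F) (x + \<sigma> *\<^sub>R a + \<tau> *\<^sub>R b))) (at (x + \<sigma> *\<^sub>R a + \<tau> *\<^sub>R b))"
      by (rule Ck_on_has_derivative[OF C' inb[OF that]])
    have "dd (s *\<^sub>R b) (dd a F) y = s * dd b (dd a F) y" if "y \<in> ball x r" for s y
      using linear_scale[OF has_derivative_linear[OF Ck_on_has_derivative[OF C' that]]] by simp
    then show ?thesis
      using has_derivative_compose[OF l F] inb[OF that]
      by (simp add: has_field_derivative_def mult_commute_abs)
  qed
  define g where "g \<sigma> = F (x + \<sigma> *\<^sub>R a + t *\<^sub>R b) - F (x + \<sigma> *\<^sub>R a + 0 *\<^sub>R b)" for \<sigma>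
  have "\<exists>\<sigma>>0. \<sigma> < t \<and> g t - g 0 = (t - 0) * (dd a F (x + \<sigma> *\<^sub>R a + t *\<^sub>R b) - dd a F (x + \<sigma> *\<^sub>R a + 0 *\<^sub>R b))"
    unfolding g_def using assms(2) by (intro MVT2 DERIV_diff d1) auto
  then obtain \<sigma> where s: "0 < \<sigma>" "\<sigma> < t"
    and g: "g t - g 0 = t * (dd a F (x + \<sigma> *\<^sub>R a + t *\<^sub>R b) - dd a F (x + \<sigma> *\<^sub>R a + 0 *\<^sub>R b))"
    by auto
  have "\<exists>\<tau>>0. \<tau> < t \<and> dd a F (x + \<sigma> *\<^sub>R a + t *\<^sub>R b) - dd a F (x + \<sigma> *\<^sub>R a + 0 *\<^sub>R b)
      = (t - 0) * dd b (dd a F) (x + \<sigma> *\<^sub>R a + \<tau> *\<^sub>R b)"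
    using assms(2) s by (intro MVT2 d2) auto
  then obtain \<tau> where "0 < \<tau>" "\<tau> < t" "dd a F (x + \<sigma> *\<^sub>R a + t *\<^sub>R b) - dd a F (x + \<sigma> *\<^sub>R a + 0 *\<^sub>R b)
      = t * dd b (dd a F) (x + \<sigma> *\<^sub>R a + \<tau> *\<^sub>R b)"
    by auto
  then show ?thesis using s g
    by (intro exI[of _ \<sigma>] exI[of _ \<tau>]) (auto simp: g_def)
qed

lemma dd_inner:
  assumes "F differentiable at x"
  shows "dd v (\<lambda>x. F x \<bullet> e) x = dd v F x \<bullet> e"
  by (rule dd_eqI) (use assms in \<open>auto simp: dd_def frechet_derivative_works intro!: has_derivative_inner_left\<close>)

lemma dd_commute_real:
  fixes F :: "'a::euclidean_space \<Rightarrow> real"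
  assumes "open S" "Ck_on 2 F S" "x \<in> S"
  shows "dd b (dd a F) x = dd a (dd b F) x"
proof -
  obtain r where r: "r > 0" "ball x r \<subseteq> S" using assms openE by blast
  have C: "Ck_on 2 F (ball x r)" using assms(2) r(2) Ck_on_subset by blast
  have cont: "isCont (dd b (dd a F)) x" for a b
  proof -
    have "continuous_on (ball x r) (dd b (dd a F))"
      using C by (simp add: numeral_2_eq_2 Ck_on_Suc_dd)
    then show ?thesis using r continuous_on_eq_continuous_at by (metis centre_in_ball open_ball)
  qed
  show ?thesis
  proof (rule ccontr)
    assume ne: "\<not> ?thesis"
    define e where "e = \<bar>dd b (dd a F) x - dd a (dd b F) x\<bar> / 2"
    have e: "e > 0" using ne by (simp add: e_def)
    obtain d1 where d1: "d1 > 0" "\<And>y. dist y x < d1 \<Longrightarrow> \<bar>dd b (dd a F) y - dd b (dd a F) x\<bar> < e"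
      using cont[of b a] e unfolding continuous_at_eps_delta dist_real_def by blast
    obtain d2 where d2: "d2 > 0" "\<And>y. dist y x < d2 \<Longrightarrow> \<bar>dd a (dd b F) y - dd a (dd b F) x\<bar> < e"
      using cont[of a b] e unfolding continuous_at_eps_delta dist_real_def by blast
    define m where "m = min r (min d1 d2)"
    define t where "t = m / (2 * (norm a + norm b + 1))"
    have m: "m > 0" using r d1 d2 by (simp add: m_def)
    have n: "norm a + norm b + 1 > 0" by (simp add: add_nonneg_pos)
    have t: "t > 0" "t * (norm a + norm b) < m"
    proof -
      show "t > 0" using m n by (simp add: t_def)
      then have "t * (norm a + norm b) < t * (2 * (norm a + norm b + 1))"
        using n by (intro mult_strict_left_mono) auto
      also have "\<dots> = m" using n by (simp add: t_def)
      finally show "t * (norm a + norm b) < m" .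
    qed
    have near: "dist (x + \<sigma> *\<^sub>R u + \<tau> *\<^sub>R v) x < m"
      if "0 < \<sigma>" "\<sigma> < t" "0 < \<tau>" "\<tau> < t" "norm u + norm v = norm a + norm b" for \<sigma> \<tau> u v
    proof -
      have "norm (\<sigma> *\<^sub>R u + \<tau> *\<^sub>R v) \<le> \<sigma> * norm u + \<tau> * norm v"
        using norm_triangle_ineq[of "\<sigma> *\<^sub>R u" "\<tau> *\<^sub>R v"] that by simp
      also have "\<dots> \<le> t * norm u + t * norm v"
        using that by (intro add_mono mult_right_mono) auto
      also have "\<dots> < m" using t(2) that(5) by (metis distrib_left)
      finally show ?thesis by (simp add: dist_norm add.assoc)
    qed
    have tr: "t * (norm a + norm b) < r" "t * (norm b + norm a) < r"
      using t(2) by (auto simp: m_def add.commute)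
    obtain \<sigma> \<tau> where 1: "0 < \<sigma>" "\<sigma> < t" "0 < \<tau>" "\<tau> < t"
      "F (x + t *\<^sub>R a + t *\<^sub>R b) - F (x + t *\<^sub>R a) - F (x + t *\<^sub>R b) + F x
        = t * t * dd b (dd a F) (x + \<sigma> *\<^sub>R a + \<tau> *\<^sub>R b)"
      using second_difference_mvt[OF C t(1) tr(1)] by blast
    obtain \<sigma>' \<tau>' where 2: "0 < \<sigma>'" "\<sigma>' < t" "0 < \<tau>'" "\<tau>' < t"
      "F (x + t *\<^sub>R b + t *\<^sub>R a) - F (x + t *\<^sub>R b) - F (x + t *\<^sub>R a) + F x
        = t * t * dd a (dd b F) (x + \<sigma>' *\<^sub>R b + \<tau>' *\<^sub>R a)"
      using second_difference_mvt[OF C t(1) tr(2)] by blast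
    have "F (x + t *\<^sub>R b + t *\<^sub>R a) = F (x + t *\<^sub>R a + t *\<^sub>R b)" by (simp add: algebra_simps)
    then have "t * t * dd b (dd a F) (x + \<sigma> *\<^sub>R a + \<tau> *\<^sub>R b) = t * t * dd a (dd b F) (x + \<sigma>' *\<^sub>R b + \<tau>' *\<^sub>R a)"
      using 1(5) 2(5) by linarith
    then have "dd b (dd a F) (x + \<sigma> *\<^sub>R a + \<tau> *\<^sub>R b) = dd a (dd b F) (x + \<sigma>' *\<^sub>R b + \<tau>' *\<^sub>R a)"
      using t(1) by simp
    moreover have "\<bar>dd b (dd a F) (x + \<sigma> *\<^sub>R a + \<tau> *\<^sub>R b) - dd b (dd a F) x\<bar> < e"
      using near[OF 1(1-4), of a b] by (intro d1) (simp add: m_def)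
    moreover have "\<bar>dd a (dd b F) (x + \<sigma>' *\<^sub>R b + \<tau>' *\<^sub>R a) - dd a (dd b F) x\<bar> < e"
      using near[OF 2(1-4), of b a] by (intro d2) (simp add: m_def)
    ultimately have "\<bar>dd b (dd a F) x - dd a (dd b F) x\<bar> < 2 * e" by linarith
    then show False by (simp add: e_def)
  qed
qed

lemma dd_commute:
  assumes "open S" "Ck_on 2 F S" "x \<in> S"
  shows "dd b (dd a F) x = dd a (dd b F) x"
proof (rule euclidean_eqI)
  fix e :: 'b assume "e \<in> Basis"
  have df: "F differentiable at y" "dd a F differentiable at y" if "y \<in> S" for a y
    using assms(2) that by (simp_all add: numeral_2_eq_2 Ck_on_Suc_dd)
  have C: "Ck_on 2 (\<lambda>x. F x \<bullet> e) S"
    by (rule Ck_on_linear_compose[OF assms(1) bounded_linear_inner_left assms(2)])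
  have *: "dd b (dd a F) x \<bullet> e = dd b (dd a (\<lambda>x. F x \<bullet> e)) x" for a b
  proof -
    have "((\<lambda>y. dd a F y \<bullet> e) has_derivative (\<lambda>v. dd v (dd a F) x \<bullet> e)) (at x)"
      using has_derivative_inner_left[OF df(2)[OF assms(3), unfolded frechet_derivative_works], of a e]
      unfolding dd_def[of _ "dd a F"] .
    then have "(dd a (\<lambda>x. F x \<bullet> e) has_derivative (\<lambda>v. dd v (dd a F) x \<bullet> e)) (at x)"
      by (rule has_derivative_transform_within_open[OF _ assms(1,3)]) (simp add: dd_inner df)
    then show ?thesis by (simp add: dd_eqI)
  qed
  show "dd b (dd a F) x \<bullet> e = dd a (dd b F) x \<bullet> e"
    unfolding * by (rule dd_commute_real[OF assms(1) C assms(3)])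
qed

lemma smooth_on_bilinear:
  assumes "open S" "bounded_bilinear B" "smooth_on F S" "smooth_on G S"
  shows "smooth_on (\<lambda>x. B (F x) (G x)) S"
  using assms Ck_on_bilinear unfolding smooth_on_def by blast

lemma smooth_on_mult:
  fixes F G :: "_ \<Rightarrow> real"
  assumes "open S" "smooth_on F S" "smooth_on G S"
  shows "smooth_on (\<lambda>x. F x * G x) S"
  using smooth_on_bilinear[OF assms(1) bounded_bilinear_mult assms(2,3)] .

lemma smooth_on_scaleR:
  assumes "open S" "smooth_on f S" "smooth_on F S"
  shows "smooth_on (\<lambda>x. f x *\<^sub>R F x) S"
  using smooth_on_bilinear[OF assms(1) bounded_bilinear_scaleR assms(2,3)] .

lemma smooth_on_inner:
  assumes "open S" "smooth_on F S" "smooth_on G S"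
  shows "smooth_on (\<lambda>x. F x \<bullet> G x) S"
  using smooth_on_bilinear[OF assms(1) bounded_bilinear_inner assms(2,3)] .

lemma smooth_on_add:
  assumes "open S" "smooth_on F S" "smooth_on G S"
  shows "smooth_on (\<lambda>x. F x + G x) S"
  using assms Ck_on_add unfolding smooth_on_def by blast

lemma smooth_on_linear_compose:
  assumes "open S" "bounded_linear L" "smooth_on F S"
  shows "smooth_on (\<lambda>x. L (F x)) S"
  using assms Ck_on_linear_compose unfolding smooth_on_def by blast

lemma smooth_on_Pair:
  assumes "open S" "smooth_on F S" "smooth_on G S"
  shows "smooth_on (\<lambda>x. (F x, G x)) S"
proof -
  have "smooth_on (\<lambda>x. (F x, 0) + (0, G x)) S"
    by (intro smooth_on_add assms(1)
        smooth_on_linear_compose[OF assms(1) _ assms(2)] smooth_on_linear_compose[OF assms(1) _ assms(3)]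
        bounded_linear_Pair bounded_linear_ident bounded_linear_zero)
  then show ?thesis by simp
qed

lemma smooth_on_fst: "open S \<Longrightarrow> smooth_on F S \<Longrightarrow> smooth_on (\<lambda>x. fst (F x)) S"
  by (rule smooth_on_linear_compose[OF _ bounded_linear_fst])

lemma smooth_on_snd: "open S \<Longrightarrow> smooth_on F S \<Longrightarrow> smooth_on (\<lambda>x. snd (F x)) S"
  by (rule smooth_on_linear_compose[OF _ bounded_linear_snd])

lemma smooth_on_const: "smooth_on (\<lambda>x. c) S"
  by (simp add: smooth_on_def Ck_on_const)

lemma smooth_on_id: "open S \<Longrightarrow> smooth_on (\<lambda>x. x) S"
  by (simp add: smooth_on_def Ck_on_id)

lemma smooth_on_inverse:
  fixes F :: "_ \<Rightarrow> real"
  assumes "open S" "smooth_on F S" "\<And>x. x \<in> S \<Longrightarrow> F x \<noteq> 0"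
  shows "smooth_on (\<lambda>x. inverse (F x)) S"
  using assms Ck_on_inverse unfolding smooth_on_def by blast

lemma smooth_on_cong:
  assumes "open S" "smooth_on F S" "\<And>x. x \<in> S \<Longrightarrow> F x = G x"
  shows "smooth_on G S"
  using assms Ck_on_cong unfolding smooth_on_def by metis

lemma smooth_on_subset: "smooth_on F S \<Longrightarrow> T \<subseteq> S \<Longrightarrow> smooth_on F T"
  using Ck_on_subset unfolding smooth_on_def by blast

lemma smooth_on_local:
  assumes "\<And>x. x \<in> S \<Longrightarrow> \<exists>U. open U \<and> x \<in> U \<and> smooth_on F U"
  shows "smooth_on F S"
  unfolding smooth_on_def
proof
  fix k show "Ck_on k F S"
  proof (rule Ck_on_local)
    fix x assume "x \<in> S"
    from assms[OF this] show "\<exists>U. open U \<and> x \<in> U \<and> Ck_on k F U"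
      using smooth_on_imp_Ck by blast
  qed
qed

lemma smooth_on_compose:
  assumes "open S" "open T" "G ` S \<subseteq> T" "smooth_on F T" "smooth_on G S"
  shows "smooth_on (\<lambda>x. F (G x)) S"
  using assms Ck_on_compose[OF assms(1-3)] unfolding smooth_on_def by blast

lemma smooth_on_exp: "smooth_on (exp :: complex \<Rightarrow> complex) S"
proof -
  have "Ck_on k (exp :: complex \<Rightarrow> complex) UNIV" for k
  proof (induction k)
    case 0
    then show ?case by (simp add: continuous_on_exp)
  next
    case (Suc k)
    have *: "Ck_on k (\<lambda>x :: complex. exp x * v) UNIV" for v
      by (rule Ck_on_linear_compose[OF open_UNIV bounded_linear_mult_left Suc])
    have "(exp has_derivative (*) (exp x)) (at x)" for x :: complex
      using DERIV_exp[of x] by (simp add: has_field_derivative_def)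
    from Ck_on_SucI[OF open_UNIV this *] show ?case .
  qed
  then show ?thesis using Ck_on_subset unfolding smooth_on_def by blast
qed

lemma smooth_on_dd_commute:
  assumes "open S" "smooth_on F S" "x \<in> S"
  shows "dd b (dd a F) x = dd a (dd b F) x"
  using dd_commute[OF assms(1) smooth_on_imp_Ck[OF assms(2)] assms(3)] .

lemma dd_mult:
  fixes F G :: "_ \<Rightarrow> real"
  assumes "smooth_on F S" "smooth_on G S" "x \<in> S"
  shows "dd v (\<lambda>x. F x * G x) x = F x * dd v G x + dd v F x * G x"
  by (rule dd_eqI[OF has_derivative_mult[OF smooth_on_has_derivative[OF assms(1,3)]
          smooth_on_has_derivative[OF assms(2,3)]]])

lemma dd_add:
  assumes "smooth_on F S" "smooth_on G S" "x \<in> S"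
  shows "dd v (\<lambda>x. F x + G x) x = dd v F x + dd v G x"
  by (rule dd_eqI[OF has_derivative_add[OF smooth_on_has_derivative[OF assms(1,3)]
          smooth_on_has_derivative[OF assms(2,3)]]])

lemma dd_linear_compose:
  assumes "bounded_linear L" "smooth_on F S" "x \<in> S"
  shows "dd v (\<lambda>x. L (F x)) x = L (dd v F x)"
  by (rule dd_eqI[OF bounded_linear.has_derivative[OF assms(1) smooth_on_has_derivative[OF assms(2,3)]]])

lemma dd_const: "dd v (\<lambda>_. c) x = 0"
  by (rule dd_eqI) simp

lemma dd_cong:
  assumes "open S" "x \<in> S" "\<And>y. y \<in> S \<Longrightarrow> F y = G y"
  shows "dd v F x = dd v G x"
proof -
  have "(F has_derivative F') (at x) \<longleftrightarrow> (G has_derivative F') (at x)" for F'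
    using has_derivative_transform_within_open[OF _ assms(1,2), of F F' UNIV G]
      has_derivative_transform_within_open[OF _ assms(1,2), of G F' UNIV F] assms(3) by auto
  then show ?thesis by (simp add: dd_def frechet_derivative_def)
qed

lemma dd_complex_expand:
  assumes "smooth_on g S" "z \<in> S"
  shows "dd w g z = Re w *\<^sub>R dd 1 g z + Im w *\<^sub>R dd \<i> g z"
proof -
  note l = dd_lin[OF assms]
  have "dd (Re w *\<^sub>R 1 + Im w *\<^sub>R \<i>) g z = Re w *\<^sub>R dd 1 g z + Im w *\<^sub>R dd \<i> g z"
    using linear_add[OF l] linear_scale[OF l] by simp
  moreover have "Re w *\<^sub>R 1 + Im w *\<^sub>R \<i> = w" by (simp add: complex_eq_iff)
  ultimately show ?thesis by simp
qed

lemma norm_dd_le: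
  assumes "smooth_on g S" "z \<in> S"
  shows "norm (dd v g z) \<le> norm v * (norm (dd 1 g z) + norm (dd \<i> g z))"
proof -
  have "norm (dd v g z) \<le> \<bar>Re v\<bar> * norm (dd 1 g z) + \<bar>Im v\<bar> * norm (dd \<i> g z)"
    unfolding dd_complex_expand[OF assms, of v] by (rule norm_triangle_le) simp
  also have "\<dots> \<le> norm v * norm (dd 1 g z) + norm v * norm (dd \<i> g z)"
    by (intro add_mono mult_right_mono abs_Re_le_cmod abs_Im_le_cmod) auto
  finally show ?thesis by (simp add: distrib_left)
qed

text \<open>
Along a segment from \<open>p\<close>, the squared norm of \<open>V\<close> satisfies \<open>\<phi>' \<le> c \<phi>\<close>, so \<open>\<phi> e\<^sup>-\<^sup>c\<^sup>t\<close> decreases from \<open>0\<close>.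
\<close>

lemma gronwall_zero:
  fixes V :: "complex \<Rightarrow> 'b::euclidean_space"
  assumes V: "\<And>y. y \<in> ball p r \<Longrightarrow> (V has_derivative V' y) (at y)"
    and K: "\<And>y v. y \<in> ball p r \<Longrightarrow> norm (V' y v) \<le> K * norm v * norm (V y)"
    and p: "V p = 0" and y: "y \<in> ball p r"
  shows "V y = 0"
proof -
  \<comment> \<open>the segment from \<open>p\<close> to \<open>y\<close>\<close>
  define g where "g t = p + t *\<^sub>R (y - p)" for t :: real
  define c where "c = 2 * K * norm (y - p)"
  define \<phi> where "\<phi> t = V (g t) \<bullet> V (g t) * exp (- c * t)" for t
  have gb: "g t \<in> ball p r" if "0 \<le> t" "t \<le> 1" for t
  proof -
    have "norm (t *\<^sub>R (y - p)) \<le> norm (y - p)" using that by (simp add: mult_left_le_one_le)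
    then show ?thesis using y by (simp add: g_def dist_norm norm_minus_commute)
  qed
  have "\<phi> 1 \<le> \<phi> 0"
  proof (rule DERIV_nonpos_imp_nonincreasing[where f = \<phi>])
    fix t :: real assume t: "0 \<le> t" "t \<le> 1"
    note b = gb[OF t]
    interpret D: bounded_linear "V' (g t)" using V[OF b] by (rule has_derivative_bounded_linear)
    have "(g has_derivative (\<lambda>h. h *\<^sub>R (y - p))) (at t)"
      unfolding g_def[abs_def] by (auto intro!: derivative_eq_intros)
    from has_derivative_compose[OF this V[OF b]]
    have d: "((\<lambda>t. V (g t)) has_derivative (\<lambda>h. h *\<^sub>R V' (g t) (y - p))) (at t)"
      by (simp add: D.scaleR)
    have "((\<lambda>t. V (g t) \<bullet> V (g t)) has_derivative (\<lambda>h. h * (2 * (V (g t) \<bullet> V' (g t) (y - p))))) (at t)"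
      by (rule has_derivative_eq_rhs[OF has_derivative_inner[OF d d]]) (simp add: fun_eq_iff inner_commute)
    then have "((\<lambda>t. V (g t) \<bullet> V (g t)) has_real_derivative 2 * (V (g t) \<bullet> V' (g t) (y - p))) (at t)"
      by (simp add: has_field_derivative_def mult_commute_abs)
    then have "(\<phi> has_real_derivative
        (2 * (V (g t) \<bullet> V' (g t) (y - p)) - c * (V (g t) \<bullet> V (g t))) * exp (- c * t)) (at t)"
      unfolding \<phi>_def[abs_def] by (auto intro!: derivative_eq_intros simp: algebra_simps)
    moreover have "2 * (V (g t) \<bullet> V' (g t) (y - p)) \<le> c * (V (g t) \<bullet> V (g t))"
    proof -
      have "V (g t) \<bullet> V' (g t) (y - p) \<le> norm (V (g t)) * norm (V' (g t) (y - p))" by (rule norm_cauchy_schwarz)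
      also have "\<dots> \<le> norm (V (g t)) * (K * norm (y - p) * norm (V (g t)))"
        using K[OF b] by (intro mult_left_mono) auto
      finally show ?thesis by (simp add: c_def power2_norm_eq_inner[symmetric] power2_eq_square algebra_simps)
    qed
    ultimately show "\<exists>z. (\<phi> has_real_derivative z) (at t) \<and> z \<le> 0"
      by (intro exI conjI) (auto intro: mult_nonpos_nonneg)
  qed simp
  then have "V y \<bullet> V y * exp (- c) \<le> 0" by (simp add: \<phi>_def g_def p)
  then have "V y \<bullet> V y \<le> 0" by (simp add: mult_le_0_iff not_le)
  then show ?thesis by (metis inner_eq_zero_iff inner_ge_zero order_antisym)
qed

section \<open>Unique continuation for \<open>\<Delta>u = q u\<close> in the plane\<close>

text \<open>
The one-dimensional core of unique continuation. The hypotheses say that the frequency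
\<open>N = D / E\<close> satisfies \<open>N' \<ge> - K\<close> wherever \<open>E > 0\<close>, and that \<open>(ln E)' \<le> 2 N + K\<close>. Going to the left from \<open>t1\<close>, \<open>N\<close> stays
bounded above, hence \<open>ln E\<close> cannot tend to \<open>-\<infinity>\<close> in finite time.
\<close>

lemma frequency_positive:
  fixes E D E' D' :: "real \<Rightarrow> real"
  assumes "t0 \<le> t1"
    and dE: "\<And>t. t0 \<le> t \<Longrightarrow> t \<le> t1 \<Longrightarrow> (E has_real_derivative E' t) (at t)"
    and dD: "\<And>t. t0 \<le> t \<Longrightarrow> t \<le> t1 \<Longrightarrow> (D has_real_derivative D' t) (at t)"
    and pos: "\<And>t. t0 \<le> t \<Longrightarrow> t \<le> t1 \<Longrightarrow> 0 \<le> E t"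
    and K1: "\<And>t. t0 \<le> t \<Longrightarrow> t \<le> t1 \<Longrightarrow> E' t \<le> 2 * D t + K * E t"
    and K2: "\<And>t. t0 \<le> t \<Longrightarrow> t \<le> t1 \<Longrightarrow> 0 < E t \<Longrightarrow> D' t * E t - D t * E' t \<ge> - K * (E t)\<^sup>2"
    and K: "0 \<le> K"
    and E1: "0 < E t1"
  shows "0 < E t0"
proof (rule ccontr)
  assume "\<not> 0 < E t0"
  then have z0: "E t0 = 0" using pos[of t0] assms(1) by simp
  have cE: "continuous_on {t0..t1} E"
    by (rule continuous_at_imp_continuous_on) (use dE DERIV_isCont in \<open>metis atLeastAtMost_iff\<close>)
  \<comment> \<open>the last zero before \<open>t1\<close>; to the right of it the frequency is defined\<close>
  define Z where "Z = {t\<in>{t0..t1}. E t = 0}"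
  have "closed Z" unfolding Z_def using continuous_closed_preimage_constant[OF cE] by simp
  moreover have "Z \<subseteq> {t0..t1}" by (auto simp: Z_def)
  ultimately have cZ: "compact Z" using compact_Int_closed[of "{t0..t1}" Z] by (simp add: Int_absorb1)
  have "t0 \<in> Z" using z0 assms(1) by (simp add: Z_def)
  then obtain s where s: "s \<in> Z" "\<And>t. t \<in> Z \<Longrightarrow> t \<le> s"
    using compact_attains_sup[OF cZ] by blast
  have s': "t0 \<le> s" "s \<le> t1" "E s = 0" using s by (auto simp: Z_def)
  have st: "s < t1" using s' E1 by (cases "s = t1") auto
  have Epos: "0 < E t" if "s < t" "t \<le> t1" for t
  proof -
    have "t \<notin> Z" using s(2) that by force
    then show ?thesis using that s' pos[of t] by (auto simp: Z_def)
  qed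
  define N where "N t = D t / E t" for t
  define M where "M = 2 * (N t1 + K * (t1 - t0)) + K"
  have N: "N t \<le> N t1 + K * (t1 - t0)" if t: "s < t" "t \<le> t1" for t
  proof -
    have "N t + K * t \<le> N t1 + K * t1"
    proof (rule DERIV_nonneg_imp_nondecreasing[OF t(2)])
      fix x assume x: "t \<le> x" "x \<le> t1"
      have xE: "0 < E x" using Epos x t by simp
      have x0: "t0 \<le> x" using x t s' by simp
      have "(N has_real_derivative (D' x * E x - D x * E' x) / (E x * E x)) (at x)"
        unfolding N_def[abs_def] using xE by (intro DERIV_divide dE dD) (use x x0 in auto)
      then have "((\<lambda>x. N x + K * x) has_real_derivative (D' x * E x - D x * E' x) / (E x * E x) + K) (at x)"
        by (auto intro!: derivative_eq_intros)
      moreover have "- K \<le> (D' x * E x - D x * E' x) / (E x * E x)"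
        using K2[OF x0 x(2) xE] xE by (simp add: pos_le_divide_eq power2_eq_square)
      ultimately show "\<exists>y. ((\<lambda>x. N x + K * x) has_real_derivative y) (at x) \<and> 0 \<le> y" by force
    qed
    then have "N t \<le> N t1 + K * (t1 - t)" by (simp add: algebra_simps)
    also have "\<dots> \<le> N t1 + K * (t1 - t0)" using K t s' by (simp add: mult_left_mono)
    finally show ?thesis .
  qed
  have dec: "E t1 * exp (- M * t1) \<le> E t * exp (- M * t)" if t: "s < t" "t \<le> t1" for t
  proof (rule DERIV_nonpos_imp_nonincreasing[OF t(2)])
    fix x assume x: "t \<le> x" "x \<le> t1"
    have xE: "0 < E x" using Epos x t by simp
    have x0: "t0 \<le> x" using x t s' by simp
    have "((\<lambda>x. E x * exp (- M * x)) has_real_derivative (E' x - M * E x) * exp (- M * x)) (at x)"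
      using dE[OF x0 x(2)] by (auto intro!: derivative_eq_intros simp: algebra_simps)
    moreover have "E' x \<le> M * E x"
    proof -
      have "D x \<le> (N t1 + K * (t1 - t0)) * E x"
        using N[of x] x t xE unfolding N_def[of x] by (simp add: pos_divide_le_eq)
      then show ?thesis using K1[OF x0 x(2)] by (simp add: M_def algebra_simps)
    qed
    ultimately show "\<exists>y. ((\<lambda>x. E x * exp (- M * x)) has_real_derivative y) (at x) \<and> y \<le> 0"
      by (metis diff_le_0_iff_le exp_ge_zero mult_nonpos_nonneg)
  qed
  have "continuous (at s) (\<lambda>t. E t * exp (- M * t))"
    using DERIV_isCont[OF dE[OF s'(1,2)]] by (intro continuous_intros)
  then have "((\<lambda>t. E t * exp (- M * t)) \<longlongrightarrow> E s * exp (- M * s)) (at_right s)"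
    by (simp add: isCont_def filterlim_at_split)
  moreover have "eventually (\<lambda>t. E t1 * exp (- M * t1) \<le> E t * exp (- M * t)) (at_right s)"
    using dec st by (auto simp: eventually_at_right[OF st])
  ultimately have "E t1 * exp (- M * t1) \<le> E s * exp (- M * s)"
    by (intro tendsto_lowerbound) auto
  then show False using E1 s'(3) by (simp add: mult_le_0_iff)
qed

text \<open>
In the coordinate \<open>s = t + \<i> \<theta>\<close> with \<open>w = c + e\<^sup>s\<close>, this is the integral over the circle of radius \<open>e\<^sup>t\<close>
with respect to the angle.
\<close>

definition circle_integral :: "(complex \<Rightarrow> real) \<Rightarrow> real \<Rightarrow> real" where
  "circle_integral g t = integral {0..2*pi} (\<lambda>\<theta>. g (Complex t \<theta>))"

definition strip :: "real \<Rightarrow> real \<Rightarrow> complex set" where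
  "strip a b = {s. a < Re s \<and> Re s < b}"

lemma open_strip: "open (strip a b)"
proof -
  have "strip a b = {s. a < Re s} \<inter> {s. Re s < b}" by (auto simp: strip_def)
  then show ?thesis by (simp add: open_Int open_halfspace_Re_gt open_halfspace_Re_lt)
qed

lemma circle_integral_continuous:
  assumes "continuous_on (strip a b) g" "a < t" "t < b"
  shows "continuous_on {0..2*pi} (\<lambda>\<theta>. g (Complex t \<theta>))"
  by (rule continuous_on_compose2[OF assms(1)])
    (use assms in \<open>auto simp: strip_def intro!: continuous_intros\<close>)

lemma circle_integral_integrable:
  fixes g :: "complex \<Rightarrow> real"
  assumes "continuous_on (strip a b) g" "a < t" "t < b"
  shows "(\<lambda>\<theta>. g (Complex t \<theta>)) integrable_on {0..2*pi}"
  by (rule integrable_continuous_real[OF circle_integral_continuous[OF assms]])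

lemma circle_integral_lin:
  assumes "continuous_on (strip a b) g" "continuous_on (strip a b) h" "a < t" "t < b"
  shows "circle_integral (\<lambda>s. \<alpha> * g s + \<beta> * h s) t = \<alpha> * circle_integral g t + \<beta> * circle_integral h t"
proof -
  note i = circle_integral_integrable[OF assms(1,3,4)] circle_integral_integrable[OF assms(2-4)]
  have "circle_integral (\<lambda>s. \<alpha> * g s + \<beta> * h s) t
      = integral {0..2*pi} (\<lambda>\<theta>. \<alpha> * g (Complex t \<theta>)) + integral {0..2*pi} (\<lambda>\<theta>. \<beta> * h (Complex t \<theta>))"
    unfolding circle_integral_def
    by (rule integral_add[OF integrable_on_mult_right[OF i(1)] integrable_on_mult_right[OF i(2)]])
  then show ?thesis unfolding circle_integral_def integral_mult_right .
qed

lemma circle_integral_cong: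
  assumes "\<And>s. s \<in> strip a b \<Longrightarrow> g s = h s" "a < t" "t < b"
  shows "circle_integral g t = circle_integral h t"
  unfolding circle_integral_def by (rule integral_cong) (use assms in \<open>auto simp: strip_def\<close>)

lemma circle_integral_mono:
  assumes "continuous_on (strip a b) g" "continuous_on (strip a b) h" "a < t" "t < b"
    and "\<And>s. s \<in> strip a b \<Longrightarrow> g s \<le> h s"
  shows "circle_integral g t \<le> circle_integral h t"
  unfolding circle_integral_def
  by (rule integral_le[OF circle_integral_integrable[OF assms(1,3,4)] circle_integral_integrable[OF assms(2-4)]])
    (use assms in \<open>auto simp: strip_def\<close>)

lemma circle_integral_has_derivative:
  assumes "smooth_on g (strip a b)" "a < t" "t < b"
  shows "(circle_integral g has_real_derivative circle_integral (dd 1 g) t) (at t)"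
proof -
  have d: "((\<lambda>x. g (Complex x \<theta>)) has_real_derivative dd 1 g (Complex x \<theta>)) (at x)"
    if "a < x" "x < b" for x \<theta>
  proof -
    have "Complex x \<theta> \<in> strip a b" using that by (simp add: strip_def)
    from smooth_on_has_derivative[OF assms(1) this]
    have g: "(g has_derivative (\<lambda>v. dd v g (Complex x \<theta>))) (at (of_real x + \<i> * of_real \<theta>))"
      by (simp add: Complex_eq)
    have "((\<lambda>x. of_real x + \<i> * of_real \<theta>) has_derivative (\<lambda>h. complex_of_real h)) (at x)"
      by (auto intro!: derivative_eq_intros)
    from has_derivative_compose[OF this g]
    have "((\<lambda>x. g (Complex x \<theta>)) has_derivative (\<lambda>h. dd (of_real h) g (Complex x \<theta>))) (at x)"
      by (simp add: Complex_eq)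
    moreover have "dd (of_real h) g (Complex x \<theta>) = dd 1 g (Complex x \<theta>) * h" for h
    proof -
      have "linear (\<lambda>v. dd v g (Complex x \<theta>))"
        using dd_lin[OF assms(1) \<open>Complex x \<theta> \<in> strip a b\<close>] .
      from linear_scale[OF this, of h 1] show ?thesis by (simp add: scaleR_conv_of_real)
    qed
    ultimately show ?thesis by (simp add: has_field_derivative_def)
  qed
  have "continuous_on ({a<..<b} \<times> cbox 0 (2*pi)) (\<lambda>(x, \<theta>). dd 1 g (Complex x \<theta>))"
    unfolding split_beta
    by (rule continuous_on_compose2[OF smooth_on_continuous[OF smooth_on_dd[OF assms(1)]]])
      (auto simp: strip_def intro!: continuous_intros)
  then have "((\<lambda>x. integral (cbox 0 (2*pi)) (\<lambda>\<theta>. g (Complex x \<theta>))) has_real_derivative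
      integral (cbox 0 (2*pi)) (\<lambda>\<theta>. dd 1 g (Complex t \<theta>))) (at t within {a<..<b})"
    by (intro leibniz_rule_field_derivative)
      (use assms in \<open>auto intro!: has_field_derivative_at_within[OF d]
          circle_integral_integrable[OF smooth_on_continuous[OF assms(1)]]\<close>)
  moreover have "at t within {a<..<b} = at t"
    using assms by (intro at_within_open) auto
  ultimately show ?thesis unfolding circle_integral_def[abs_def] by simp
qed

definition periodic_on :: "(complex \<Rightarrow> real) \<Rightarrow> complex set \<Rightarrow> bool" where
  "periodic_on g S \<longleftrightarrow> (\<forall>s\<in>S. g (s + Complex 0 (2 * pi)) = g s)"

lemma circle_integral_dd_ii:
  assumes "smooth_on g (strip a b)" "a < t" "t < b" "periodic_on g (strip a b)"
  shows "circle_integral (dd \<i> g) t = 0"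
proof -
  have d: "((\<lambda>x. g (Complex t x)) has_vector_derivative dd \<i> g (Complex t x)) (at x within {0..2*pi})" for x
  proof -
    have "Complex t x \<in> strip a b" using assms by (simp add: strip_def)
    from smooth_on_has_derivative[OF assms(1) this]
    have g: "(g has_derivative (\<lambda>v. dd v g (Complex t x))) (at (of_real t + \<i> * of_real x))"
      by (simp add: Complex_eq)
    have "((\<lambda>x. of_real t + \<i> * of_real x) has_derivative (\<lambda>h. \<i> * complex_of_real h)) (at x)"
      by (auto intro!: derivative_eq_intros)
    from has_derivative_compose[OF this g]
    have "((\<lambda>x. g (Complex t x)) has_derivative (\<lambda>h. dd (\<i> * of_real h) g (Complex t x))) (at x)"
      by (simp add: Complex_eq)
    moreover have "dd (\<i> * of_real h) g (Complex t x) = h * dd \<i> g (Complex t x)" for h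
    proof -
      have "linear (\<lambda>v. dd v g (Complex t x))"
        using dd_lin[OF assms(1) \<open>Complex t x \<in> strip a b\<close>] .
      from linear_scale[OF this, of h \<i>] show ?thesis by (simp add: scaleR_conv_of_real mult.commute)
    qed
    ultimately show ?thesis
      by (simp add: has_vector_derivative_def has_derivative_at_withinI)
  qed
  have "((\<lambda>x. dd \<i> g (Complex t x)) has_integral g (Complex t (2*pi)) - g (Complex t 0)) {0..2*pi}"
    by (rule fundamental_theorem_of_calculus) (use d in auto)
  moreover have "g (Complex t (2*pi)) = g (Complex t 0)"
  proof -
    have "Complex t (2*pi) = Complex t 0 + Complex 0 (2*pi)" by (simp add: complex_eq_iff)
    then show ?thesis using assms(2-4) by (simp add: periodic_on_def strip_def)
  qed
  ultimately show ?thesis unfolding circle_integral_def by (simp add: integral_unique)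
qed

lemma periodic_on_dd:
  assumes "periodic_on g (strip a b)" "smooth_on g (strip a b)"
  shows "periodic_on (dd v g) (strip a b)"
  unfolding periodic_on_def
proof
  fix s assume s: "s \<in> strip a b"
  let ?w = "Complex 0 (2 * pi)"
  have s': "s + ?w \<in> strip a b" using s by (simp add: strip_def)
  have "((\<lambda>s. s + ?w) has_derivative (\<lambda>h. h)) (at s)"
    by (auto intro!: derivative_eq_intros)
  from has_derivative_compose[OF this, of g "\<lambda>v. dd v g (s + ?w)"]
  have "((\<lambda>s. g (s + ?w)) has_derivative (\<lambda>v. dd v g (s + ?w))) (at s)"
    using smooth_on_has_derivative[OF assms(2) s'] by simp
  then have "(g has_derivative (\<lambda>v. dd v g (s + ?w))) (at s)"
    by (rule has_derivative_transform_within_open[OF _ open_strip s])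
      (use assms(1) in \<open>simp add: periodic_on_def\<close>)
  from dd_eqI[OF this, of v] show "dd v g (s + ?w) = dd v g s" by simp
qed

lemma circle_integral_integration_by_parts:
  assumes "smooth_on f (strip a b)" "smooth_on g (strip a b)" "a < t" "t < b"
    and "periodic_on f (strip a b)" "periodic_on g (strip a b)"
  shows "circle_integral (\<lambda>s. f s * dd \<i> g s) t = - circle_integral (\<lambda>s. dd \<i> f s * g s) t"
proof -
  note o = open_strip[of a b]
  have "circle_integral (dd \<i> (\<lambda>s. f s * g s)) t = 0"
    by (rule circle_integral_dd_ii[OF smooth_on_mult[OF o assms(1,2)] assms(3,4)])
      (use assms(5,6) in \<open>simp add: periodic_on_def\<close>)
  moreover have "circle_integral (dd \<i> (\<lambda>s. f s * g s)) t = circle_integral (\<lambda>s. 1 * (f s * dd \<i> g s) + 1 * (dd \<i> f s * g s)) t"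
    by (rule circle_integral_cong[OF _ assms(3,4)]) (simp add: dd_mult[OF assms(1,2)])
  moreover have "\<dots> = 1 * circle_integral (\<lambda>s. f s * dd \<i> g s) t + 1 * circle_integral (\<lambda>s. dd \<i> f s * g s) t"
    by (rule circle_integral_lin[OF _ _ assms(3,4)])
      (intro continuous_on_mult smooth_on_continuous smooth_on_dd assms)+
  ultimately show ?thesis by simp
qed

text \<open>
Let \<open>E = \<integral> u\<^sup>2 + u\<^sub>t\<^sup>2 + u\<^sub>\<theta>\<^sup>2\<close> and \<open>D = - 2 \<integral> u\<^sub>t u\<^sub>\<theta>\<^sub>\<theta>\<close> on circles. The vector \<open>U = (u, u\<^sub>t, - u\<^sub>\<theta>)\<close> solves a
perturbed Cauchy-Riemann system \<open>U\<^sub>t = L U + g\<close> with \<open>L\<close> symmetric in \<open>L\<^sup>2\<close> of the circle,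
\<open>|g| \<le> (1 + C) |U|\<close> and \<open>D = \<langle>L U, U\<rangle>\<close>. With \<open>W = L U + g/2\<close>, the Cauchy-Schwarz inequality for \<open>W\<close> and \<open>U\<close> gives
\<open>(D / E)' \<ge> - \<langle>g, g\<rangle> / (2 E)\<close>, so \<open>frequency_positive\<close> applies.
\<close>

lemma strip_unique_continuation:
  assumes u: "smooth_on u (strip a b)" and per: "periodic_on u (strip a b)"
    and C: "0 \<le> C"
    and lap: "\<And>s. s \<in> strip a b \<Longrightarrow> \<bar>dd 1 (dd 1 u) s + dd \<i> (dd \<i> u) s\<bar> \<le> C * \<bar>u s\<bar>"
    and t: "a < t0" "t0 \<le> t1" "t1 < b"
    and z: "\<And>s. Re s = t0 \<Longrightarrow> u s = 0 \<and> dd 1 u s = 0 \<and> dd \<i> u s = 0"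
    and \<theta>: "0 \<le> \<theta>" "\<theta> \<le> 2 * pi"
  shows "u (Complex t1 \<theta>) = 0"
proof -
  note o = open_strip[of a b]
  let ?S = "strip a b"
  define ut where "ut = dd 1 u"
  define uh where "uh = dd \<i> u"
  define utt where "utt = dd 1 ut"
  define uth where "uth = dd \<i> ut"
  define uhh where "uhh = dd \<i> uh"
  define P where "P = (\<lambda>s. utt s + uhh s)"
  have sm: "smooth_on u ?S" "smooth_on ut ?S" "smooth_on uh ?S" "smooth_on utt ?S" "smooth_on uth ?S"
    "smooth_on uhh ?S" "smooth_on P ?S"
    unfolding ut_def uh_def utt_def uth_def uhh_def P_def
    by (intro smooth_on_add smooth_on_dd u o)+
  have p: "periodic_on ut ?S" "periodic_on uh ?S" "periodic_on uth ?S"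
    unfolding ut_def uh_def uth_def by (intro periodic_on_dd smooth_on_dd u per)+
  have sym: "dd 1 uh s = uth s" "dd 1 uhh s = dd \<i> uth s" if s: "s \<in> ?S" for s
  proof -
    have 1: "dd 1 uh s = uth s" if "s \<in> ?S" for s
      unfolding uh_def uth_def ut_def by (rule smooth_on_dd_commute[OF o u that])
    show "dd 1 uh s = uth s" using 1 s .
    have "dd 1 uhh s = dd \<i> (dd 1 uh) s"
      unfolding uhh_def by (rule smooth_on_dd_commute[OF o sm(3) s])
    also have "\<dots> = dd \<i> uth s" by (rule dd_cong[OF o s 1])
    finally show "dd 1 uhh s = dd \<i> uth s" .
  qed
  have Pb: "\<bar>P s\<bar> \<le> C * \<bar>u s\<bar>" if "s \<in> ?S" for s
    using lap[OF that] by (simp add: P_def utt_def uhh_def ut_def uh_def)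
  \<comment> \<open>integrands: \<open>e = |U|\<^sup>2\<close>, \<open>m = \<langle>g, U\<rangle>\<close>, \<open>q2 = |g|\<^sup>2\<close>; \<open>r\<close> integrates to \<open>D\<close> and \<open>q1\<close> to \<open>D' / 2\<close>\<close>
  define x where "x = (\<lambda>s. ut s * uhh s)"
  define y where "y = (\<lambda>s. uh s * uth s)"
  define m where "m = (\<lambda>s. u s * ut s + P s * ut s)"
  define q2 where "q2 = (\<lambda>s. ut s * ut s + P s * P s)"
  define v1 where "v1 = (\<lambda>s. uth s * uth s)"
  define v2 where "v2 = (\<lambda>s. P s * uhh s + (-1) * (uhh s * uhh s))"
  define q1 where "q1 = (\<lambda>s. 1 * v1 s + (-1) * v2 s)"
  define e where "e = (\<lambda>s. u s * u s + (ut s * ut s + uh s * uh s))"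
  define r where "r = (\<lambda>s. (-1) * x s + 1 * y s)"
  have smc: "smooth_on (\<lambda>s. c * f s) ?S" if "smooth_on f ?S" for c :: real and f
    using smooth_on_linear_compose[OF o bounded_linear_mult_right that] .
  have S: "smooth_on x ?S" "smooth_on y ?S" "smooth_on m ?S" "smooth_on q2 ?S" "smooth_on q1 ?S"
    "smooth_on e ?S" "smooth_on r ?S" "smooth_on v1 ?S" "smooth_on v2 ?S"
    unfolding x_def y_def m_def q2_def q1_def e_def r_def v1_def v2_def
    by (intro smooth_on_add smooth_on_mult smc sm o)+
  note K = S[THEN smooth_on_continuous]
  define D where "D = (\<lambda>t. - 2 * circle_integral x t)"
  define K0 where "K0 = 2 * (1 + C)\<^sup>2"
  have cy: "circle_integral y t = - circle_integral x t" if "a < t" "t < b" for t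
  proof -
    have "circle_integral y t = - circle_integral (\<lambda>s. uhh s * ut s) t"
      using circle_integral_integration_by_parts[OF sm(3,2) that p(2,1)] by (simp add: y_def uth_def uhh_def)
    then show ?thesis by (simp add: x_def mult.commute)
  qed
  have cr: "circle_integral r t = D t" if "a < t" "t < b" for t
    unfolding r_def D_def using circle_integral_lin[OF K(1,2) that, of "-1" 1] cy[OF that] by simp
  have dE: "(circle_integral e has_real_derivative 2 * D t + 2 * circle_integral m t) (at t)" if "a < t" "t < b" for t
  proof -
    have "dd 1 e s = 2 * m s + 2 * r s" if s: "s \<in> ?S" for s
    proof -
      note mm = smooth_on_mult[OF o]
      have "dd 1 e s = 2 * (u s * ut s + ut s * utt s + uh s * uth s)"
        unfolding e_def
        by (simp add: dd_add[OF mm smooth_on_add[OF o mm mm]] dd_add[OF mm mm] dd_mult sm sm[THEN dd_mult] s sym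
          ut_def[symmetric] utt_def[symmetric])
      then show ?thesis by (simp add: m_def r_def x_def y_def P_def algebra_simps)
    qed
    then have "circle_integral (dd 1 e) t = circle_integral (\<lambda>s. 2 * m s + 2 * r s) t" by (rule circle_integral_cong[OF _ that])
    also have "\<dots> = 2 * circle_integral m t + 2 * D t" using circle_integral_lin[OF K(3,7) that] cr[OF that] by simp
    finally show ?thesis using circle_integral_has_derivative[OF S(6) that] by (simp add: add.commute)
  qed
  have cq1: "circle_integral q1 t = circle_integral v1 t - circle_integral v2 t" if "a < t" "t < b" for t
    unfolding q1_def using circle_integral_lin[OF K(8,9) that, of 1 "-1"] by simp
  have dD: "(D has_real_derivative 2 * circle_integral q1 t) (at t)" if "a < t" "t < b" for t
  proof -
    have "dd 1 x s = 1 * (ut s * dd \<i> uth s) + 1 * v2 s" if s: "s \<in> ?S" for s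
      unfolding x_def dd_mult[OF sm(2,6) s] sym(2)[OF s] utt_def[symmetric]
      by (simp add: v2_def P_def algebra_simps)
    then have "circle_integral (dd 1 x) t = circle_integral (\<lambda>s. 1 * (ut s * dd \<i> uth s) + 1 * v2 s) t" by (rule circle_integral_cong[OF _ that])
    also have "\<dots> = 1 * circle_integral (\<lambda>s. ut s * dd \<i> uth s) t + 1 * circle_integral v2 t"
      by (rule circle_integral_lin[OF _ K(9) that]) (intro continuous_on_mult smooth_on_continuous smooth_on_dd sm)
    also have "circle_integral (\<lambda>s. ut s * dd \<i> uth s) t = - circle_integral v1 t"
      using circle_integral_integration_by_parts[OF sm(2,5) that p(1,3)] by (simp add: v1_def uth_def)
    finally have "circle_integral (dd 1 x) t = - circle_integral q1 t" using cq1[OF that] by simp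
    with circle_integral_has_derivative[OF S(1) that] have "(circle_integral x has_real_derivative - circle_integral q1 t) (at t)" by simp
    then show ?thesis unfolding D_def by (auto intro!: derivative_eq_intros)
  qed
  have cb: "circle_integral g t \<le> c * circle_integral e t" if "continuous_on ?S g" "\<And>s. s \<in> ?S \<Longrightarrow> g s \<le> c * e s" "a < t" "t < b" for g c t
  proof -
    have "circle_integral g t \<le> circle_integral (\<lambda>s. c * e s + 0 * e s) t"
      by (rule circle_integral_mono[OF that(1) _ that(3,4)]) (use that(2) in \<open>auto intro!: continuous_intros K\<close>)
    also have "\<dots> = c * circle_integral e t" using circle_integral_lin[OF K(6,6) that(3,4), of c 0] by simp
    finally show ?thesis .
  qed
  have e0: "0 \<le> e s" for s by (simp add: e_def)
  have Epos: "0 \<le> circle_integral e t" if "a < t" "t < b" for t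
    using circle_integral_mono[OF _ K(6) that, of "\<lambda>_. 0"] e0 by (simp add: circle_integral_def)
  have mb: "circle_integral m t \<le> (1 + C) * circle_integral e t" if "a < t" "t < b" for t
  proof (rule cb[OF K(3) _ that])
    fix s assume s: "s \<in> ?S"
    have "m s \<le> \<bar>u s + P s\<bar> * \<bar>ut s\<bar>"
      by (simp add: m_def distrib_right[symmetric] abs_mult[symmetric])
    also have "\<dots> \<le> ((1 + C) * \<bar>u s\<bar>) * \<bar>ut s\<bar>"
      using Pb[OF s] by (intro mult_right_mono) (auto simp: algebra_simps)
    also have "\<dots> \<le> (1 + C) * e s"
    proof -
      have "2 * (\<bar>u s\<bar> * \<bar>ut s\<bar>) \<le> u s * u s + ut s * ut s"
        using sum_squares_bound[of "\<bar>u s\<bar>" "\<bar>ut s\<bar>"] by (simp add: power2_eq_square mult.assoc)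
      moreover have "0 \<le> u s * u s" "0 \<le> ut s * ut s" "0 \<le> uh s * uh s" by simp_all
      ultimately have "\<bar>u s\<bar> * \<bar>ut s\<bar> \<le> e s" unfolding e_def by linarith
      then show ?thesis using C by (simp add: mult.assoc mult_left_mono)
    qed
    finally show "m s \<le> (1 + C) * e s" .
  qed
  have q2b: "circle_integral q2 t \<le> (1 + C)\<^sup>2 * circle_integral e t" if "a < t" "t < b" for t
  proof (rule cb[OF K(4) _ that])
    fix s assume s: "s \<in> ?S"
    have "(P s)\<^sup>2 \<le> (C * \<bar>u s\<bar>)\<^sup>2"
      using Pb[OF s] by (metis abs_ge_zero abs_of_nonneg order_trans power2_abs power_mono)
    then have "P s * P s \<le> C\<^sup>2 * (u s * u s)" by (simp add: power2_eq_square algebra_simps)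
    moreover have "C\<^sup>2 * (u s * u s) \<le> (1 + C)\<^sup>2 * (u s * u s)"
      using C by (intro mult_right_mono power_mono) auto
    moreover have "1 * (ut s * ut s) \<le> (1 + C)\<^sup>2 * (ut s * ut s)"
      using C by (intro mult_right_mono one_le_power) auto
    moreover have "0 \<le> (1 + C)\<^sup>2 * (uh s * uh s)" by simp
    ultimately show "q2 s \<le> (1 + C)\<^sup>2 * e s" by (simp add: q2_def e_def algebra_simps)
  qed
  \<comment> \<open>Cauchy-Schwarz, from \<open>\<integral> |W - l U|\<^sup>2 \<ge> 0\<close> with the optimal \<open>l\<close>\<close>
  have cs: "(D t + circle_integral m t / 2)\<^sup>2 \<le> (circle_integral q1 t + circle_integral q2 t / 4) * circle_integral e t"
    if "a < t" "t < b" "0 < circle_integral e t" for t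
  proof -
    define l where "l = (D t + circle_integral m t / 2) / circle_integral e t"
    define p' where "p' = (\<lambda>s. (1/2) * m s + 1 * r s)"
    define w where "w = (\<lambda>s. 1 * q1 s + (1/4) * q2 s)"
    define z' where "z' = (\<lambda>s. (-2 * l) * p' s + (l * l) * e s)"
    have c: "continuous_on ?S p'" "continuous_on ?S w" "continuous_on ?S z'"
      unfolding p'_def w_def z'_def by (intro continuous_intros K)+
    have 1: "circle_integral p' t = circle_integral m t / 2 + D t"
      unfolding p'_def circle_integral_lin[OF K(3,7) that(1,2)] cr[OF that(1,2)] by simp
    have 2: "circle_integral w t = circle_integral q1 t + circle_integral q2 t / 4"
      unfolding w_def circle_integral_lin[OF K(5,4) that(1,2)] by simp
    have 3: "circle_integral z' t = (-2 * l) * circle_integral p' t + (l * l) * circle_integral e t"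
      unfolding z'_def circle_integral_lin[OF c(1) K(6) that(1,2)] by simp
    have 4: "circle_integral (\<lambda>s. 1 * w s + 1 * z' s) t = circle_integral w t + circle_integral z' t"
      using circle_integral_lin[OF c(2,3) that(1,2), of 1 1] by simp
    have "0 \<le> 1 * w s + 1 * z' s" for s
    proof -
      have "1 * w s + 1 * z' s = (ut s / 2 - l * u s)\<^sup>2 + (P s / 2 - uhh s - l * ut s)\<^sup>2 + (uth s - l * uh s)\<^sup>2"
        unfolding w_def z'_def p'_def q1_def q2_def v1_def v2_def m_def r_def x_def y_def e_def
        by (simp add: power2_eq_square field_simps)
      then show ?thesis by simp
    qed
    then have "0 \<le> circle_integral (\<lambda>s. 1 * w s + 1 * z' s) t"
      using circle_integral_mono[OF _ _ that(1,2), of "\<lambda>_. 0" "\<lambda>s. 1 * w s + 1 * z' s"] c by (simp add: circle_integral_def continuous_on_add)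
    then have "0 \<le> (circle_integral q1 t + circle_integral q2 t / 4) - 2 * l * (D t + circle_integral m t / 2) + l * l * circle_integral e t"
      unfolding 4 3 2 1 by (simp add: algebra_simps)
    also have "l * l * circle_integral e t = l * (D t + circle_integral m t / 2)" using that(3) by (simp add: l_def)
    finally have "l * (D t + circle_integral m t / 2) \<le> circle_integral q1 t + circle_integral q2 t / 4" by simp
    then show ?thesis using that(3) by (simp add: l_def power2_eq_square pos_divide_le_eq)
  qed
  have "\<not> 0 < circle_integral e t1"
  proof
    assume pos: "0 < circle_integral e t1"
    have "0 < circle_integral e t0"
    proof (rule frequency_positive[where E' = "\<lambda>t. 2 * D t + 2 * circle_integral m t" and D' = "\<lambda>t. 2 * circle_integral q1 t" and D = D and K = K0, OF t(2)])
      fix t assume tt: "t0 \<le> t" "t \<le> t1"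
      then have ab: "a < t" "t < b" using t by auto
      show "(circle_integral e has_real_derivative 2 * D t + 2 * circle_integral m t) (at t)" by (rule dE[OF ab])
      show "(D has_real_derivative 2 * circle_integral q1 t) (at t)" by (rule dD[OF ab])
      show "0 \<le> circle_integral e t" by (rule Epos[OF ab])
      have "(1 + C) * circle_integral e t \<le> (1 + C)\<^sup>2 * circle_integral e t"
        using C Epos[OF ab] by (intro mult_right_mono) (auto simp: power2_eq_square algebra_simps)
      then show "2 * D t + 2 * circle_integral m t \<le> 2 * D t + K0 * circle_integral e t"
        using mb[OF ab] by (simp add: K0_def)
      assume E: "0 < circle_integral e t"
      have "circle_integral q2 t * circle_integral e t \<le> (1 + C)\<^sup>2 * circle_integral e t * circle_integral e t"
        using q2b[OF ab] E by (intro mult_right_mono) auto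
      moreover have "D t * (2 * D t + 2 * circle_integral m t) \<le> 2 * (D t + circle_integral m t / 2)\<^sup>2"
        by (simp add: power2_eq_square algebra_simps)
      moreover have "(circle_integral q1 t + circle_integral q2 t / 4) * circle_integral e t = circle_integral q1 t * circle_integral e t + circle_integral q2 t * circle_integral e t / 4"
        by (simp add: algebra_simps)
      moreover have "0 \<le> (1 + C)\<^sup>2 * circle_integral e t * circle_integral e t" using E by simp
      moreover have "K0 * (circle_integral e t)\<^sup>2 = 2 * ((1 + C)\<^sup>2 * circle_integral e t * circle_integral e t)"
        by (simp add: K0_def power2_eq_square)
      ultimately show "- K0 * (circle_integral e t)\<^sup>2 \<le> 2 * circle_integral q1 t * circle_integral e t - D t * (2 * D t + 2 * circle_integral m t)"
        using cs[OF ab E] by linarith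
    qed (use pos in \<open>auto simp: K0_def\<close>)
    moreover have "circle_integral e t0 = circle_integral (\<lambda>_. 0) t0"
      unfolding circle_integral_def by (rule integral_cong) (use z in \<open>auto simp: e_def ut_def uh_def\<close>)
    ultimately show False by (simp add: circle_integral_def)
  qed
  then have "integral {0..2*pi} (\<lambda>\<theta>. e (Complex t1 \<theta>)) = 0"
    using Epos[of t1] t by (simp add: circle_integral_def)
  then have "e (Complex t1 \<theta>) = 0"
    using integral_eq_0_iff[OF circle_integral_continuous[OF K(6)], of t1] e0 t \<theta> by auto
  then have "u (Complex t1 \<theta>) * u (Complex t1 \<theta>) = 0"
    unfolding e_def by (metis add_nonneg_eq_0_iff add_nonneg_nonneg zero_le_square)
  then show ?thesis by simp
qed

lemma dd_comp_exp:
  fixes g :: "complex \<Rightarrow> real"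
  assumes "smooth_on g S" "c + exp s \<in> S"
  shows "((\<lambda>s. g (c + exp s)) has_derivative
     (\<lambda>v. Re (v * exp s) * dd 1 g (c + exp s) + Im (v * exp s) * dd \<i> g (c + exp s))) (at s)"
proof -
  have "((\<lambda>s. c + exp s) has_derivative (\<lambda>v. v * exp s)) (at s)"
    by (auto intro!: derivative_eq_intros)
  from has_derivative_compose[OF this smooth_on_has_derivative[OF assms]]
  show ?thesis by (simp add: dd_complex_expand[OF assms, of "_ * exp s"])
qed

text \<open>
The exponential map is conformal with factor \<open>|e\<^sup>s|\<close>, so it turns \<open>|\<Delta>u| \<le> C |u|\<close> into an inequality of the
same kind.
\<close>

lemma laplacian_exp:
  fixes u :: "complex \<Rightarrow> real"
  assumes u: "smooth_on u (ball c R)" and s: "s \<in> strip a (ln R)" and R: "0 < R"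
  defines "U \<equiv> (\<lambda>s. u (c + exp s))"
  shows "dd 1 (dd 1 U) s + dd \<i> (dd \<i> U) s
    = (cmod (exp s))\<^sup>2 * (dd 1 (dd 1 u) (c + exp s) + dd \<i> (dd \<i> u) (c + exp s))"
proof -
  let ?S = "strip a (ln R)"
  have B: "c + exp s \<in> ball c R" if "s \<in> ?S" for s
    using that R by (simp add: strip_def dist_norm ln_less_cancel_iff[symmetric] del: ln_less_cancel_iff)
  define p where "p = dd 1 u"
  define q where "q = dd \<i> u"
  have sm: "smooth_on p (ball c R)" "smooth_on q (ball c R)"
    unfolding p_def q_def by (intro smooth_on_dd u)+
  have d: "dd v U s = Re (v * exp s) * p (c + exp s) + Im (v * exp s) * q (c + exp s)" if "s \<in> ?S" for s v
    unfolding U_def p_def q_def by (rule dd_eqI[OF dd_comp_exp[OF u B[OF that]]])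
  have "dd v (dd v U) s
    = Re (v * (v * exp s)) * p (c + exp s)
      + Re (v * exp s) * (Re (v * exp s) * dd 1 p (c + exp s) + Im (v * exp s) * dd \<i> p (c + exp s))
      + (Im (v * (v * exp s)) * q (c + exp s)
      + Im (v * exp s) * (Re (v * exp s) * dd 1 q (c + exp s) + Im (v * exp s) * dd \<i> q (c + exp s)))" for v
  proof -
    have e: "(exp has_derivative (\<lambda>h. h * exp s)) (at s)"
      using DERIV_exp[of s] by (simp add: has_field_derivative_def mult_commute_abs)
    have "((\<lambda>s. Re (v * exp s)) has_derivative (\<lambda>h. Re (v * (h * exp s)))) (at s)"
      "((\<lambda>s. Im (v * exp s)) has_derivative (\<lambda>h. Im (v * (h * exp s)))) (at s)"
      by (intro has_derivative_Re has_derivative_Im has_derivative_mult_right e)+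
    note der = has_derivative_add[OF has_derivative_mult[OF this(1) dd_comp_exp[OF sm(1) B[OF s]]]
        has_derivative_mult[OF this(2) dd_comp_exp[OF sm(2) B[OF s]]]]
    have "dd v (dd v U) s = dd v (\<lambda>s. Re (v * exp s) * p (c + exp s) + Im (v * exp s) * q (c + exp s)) s"
      by (rule dd_cong[OF open_strip s d])
    also have "\<dots> = Re (v * exp s) * (Re (v * exp s) * dd 1 p (c + exp s) + Im (v * exp s) * dd \<i> p (c + exp s))
        + Re (v * (v * exp s)) * p (c + exp s)
      + (Im (v * exp s) * (Re (v * exp s) * dd 1 q (c + exp s) + Im (v * exp s) * dd \<i> q (c + exp s))
        + Im (v * (v * exp s)) * q (c + exp s))"
      by (rule dd_eqI[OF der])
    finally show ?thesis by simp
  qed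
  note this[of 1] this[of \<i>]
  moreover have "(cmod (exp s))\<^sup>2 = Re (exp s) * Re (exp s) + Im (exp s) * Im (exp s)"
    unfolding cmod_power2 by (simp add: power2_eq_square)
  ultimately show ?thesis unfolding p_def[symmetric] q_def[symmetric]
    by (simp add: algebra_simps del: norm_exp_eq_Re)
qed

lemma ball_unique_continuation:
  fixes u :: "complex \<Rightarrow> real"
  assumes u: "smooth_on u (ball c R)" and r: "0 < r"
    and lap: "\<And>z. z \<in> ball c R \<Longrightarrow> \<bar>dd 1 (dd 1 u) z + dd \<i> (dd \<i> u) z\<bar> \<le> C * \<bar>u z\<bar>"
    and z: "\<And>z. z \<in> ball c r \<Longrightarrow> u z = 0"
    and x: "x \<in> ball c R"
  shows "u x = 0"
proof (cases "x \<in> ball c r")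
  case True
  then show ?thesis by (rule z)
next
  case False
  have R: "0 < R" using x by (metis ball_eq_empty empty_iff not_le)
  define a where "a = ln r - 1"
  define U where "U = (\<lambda>s. u (c + exp s))"
  let ?S = "strip a (ln R)"
  have B: "c + exp s \<in> ball c R" if "s \<in> ?S" for s
    using that R by (simp add: strip_def dist_norm ln_less_cancel_iff[symmetric] del: ln_less_cancel_iff)
  have smU: "smooth_on U ?S" unfolding U_def
    by (rule smooth_on_compose[OF open_strip open_ball _ u])
      (use B in \<open>auto intro!: smooth_on_add smooth_on_const smooth_on_exp open_strip\<close>)
  have per: "periodic_on U ?S"
  proof -
    have "exp (s + Complex 0 (2 * pi)) = exp s" for s
      using exp_eq_polar[of "Complex 0 (2 * pi)"] by (simp add: exp_add)
    then show ?thesis by (simp add: periodic_on_def U_def)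
  qed
  have near: "U s = 0" if "Re s < ln r" for s
    unfolding U_def using that r by (intro z) (simp add: dist_norm ln_less_cancel_iff[symmetric] del: ln_less_cancel_iff)
  \<comment> \<open>any circle inside the small ball will do as a starting point\<close>
  define t0 where "t0 = ln r - 1/2"
  define t1 where "t1 = ln (cmod (x - c))"
  have xc: "r \<le> cmod (x - c)" "cmod (x - c) < R" using False x by (auto simp: dist_norm norm_minus_commute)
  have "exp (Complex t1 (Arg2pi (x - c))) = x - c"
  proof -
    have "exp (ln (cmod (x - c))) = cmod (x - c)" using r xc by (intro exp_ln) linarith
    then show ?thesis
      using Arg2pi[of "x - c"] exp_eq_polar[of "Complex t1 (Arg2pi (x - c))"]
      unfolding t1_def is_Arg_def by (simp add: cis_conv_exp del: exp_ln exp_ln_iff)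
  qed
  moreover have "U (Complex t1 (Arg2pi (x - c))) = 0"
  proof (rule strip_unique_continuation[where a = a and b = "ln R" and C = "R\<^sup>2 * \<bar>C\<bar>" and ?t0.0 = t0, OF smU per])
    show "0 \<le> R\<^sup>2 * \<bar>C\<bar>" "0 \<le> Arg2pi (x - c)" "Arg2pi (x - c) \<le> 2 * pi" "a < t0"
      using Arg2pi[of "x - c"] by (auto simp: a_def t0_def)
    have "ln r \<le> t1" unfolding t1_def using r xc by (intro ln_mono) auto
    then show "t0 \<le> t1" by (simp add: t0_def)
    have "0 < cmod (x - c)" using r xc by linarith
    then show "t1 < ln R" unfolding t1_def using R xc by (subst ln_less_cancel_iff) auto
    fix s
    show "\<bar>dd 1 (dd 1 U) s + dd \<i> (dd \<i> U) s\<bar> \<le> R\<^sup>2 * \<bar>C\<bar> * \<bar>U s\<bar>" if s: "s \<in> ?S"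
    proof -
      have "cmod (exp s) \<le> R" using B[OF s] by (simp add: dist_norm)
      then have e: "(cmod (exp s))\<^sup>2 \<le> R\<^sup>2" by (intro power_mono) auto
      have "\<bar>dd 1 (dd 1 U) s + dd \<i> (dd \<i> U) s\<bar> \<le> (cmod (exp s))\<^sup>2 * (C * \<bar>U s\<bar>)"
        unfolding U_def laplacian_exp[OF u s R] abs_mult
        using lap[OF B[OF s]] by (simp add: mult_left_mono)
      also have "\<dots> \<le> (cmod (exp s))\<^sup>2 * (\<bar>C\<bar> * \<bar>U s\<bar>)"
        by (intro mult_left_mono mult_right_mono) auto
      also have "\<dots> \<le> R\<^sup>2 * (\<bar>C\<bar> * \<bar>U s\<bar>)"
        using e by (intro mult_right_mono) auto
      finally show ?thesis by simp
    qed
    show "U s = 0 \<and> dd 1 U s = 0 \<and> dd \<i> U s = 0" if "Re s = t0"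
    proof -
      have s: "s \<in> strip a (ln r)" using that by (simp add: strip_def a_def t0_def)
      have "dd v U s = dd v (\<lambda>_. 0) s" for v
        by (rule dd_cong[OF open_strip s]) (simp add: strip_def near)
      moreover have "dd v (\<lambda>_. 0::real) s = 0" for v by (rule dd_eqI) simp
      ultimately show ?thesis using near[of s] that by (simp add: t0_def)
    qed
  qed
  ultimately show ?thesis by (simp add: U_def)
qed

text \<open>
The interior of the zero set is relatively closed: near one of its limit points \<open>p\<close> there is a ball that
contains \<open>p\<close> and is centred at a point around which \<open>u\<close> vanishes, so that \<open>ball_unique_continuation\<close> applies.
\<close>

theorem unique_continuation:
  fixes u q :: "complex \<Rightarrow> real"
  assumes \<Omega>: "open \<Omega>" "connected \<Omega>" and u: "smooth_on u \<Omega>" and q: "continuous_on \<Omega> q"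
    and lap: "\<And>z. z \<in> \<Omega> \<Longrightarrow> dd 1 (dd 1 u) z + dd \<i> (dd \<i> u) z = q z * u z"
    and U: "open U" "U \<noteq> {}" "U \<subseteq> \<Omega>" "\<And>z. z \<in> U \<Longrightarrow> u z = 0"
    and z: "z \<in> \<Omega>"
  shows "u z = 0"
proof -
  define Z where "Z = interior {z\<in>\<Omega>. u z = 0}"
  have UZ: "U \<subseteq> Z" unfolding Z_def using U by (intro interior_maximal) auto
  have "p \<in> Z" if p: "p \<in> \<Omega>" "p \<in> closure Z" for p
  proof -
    obtain r where r: "r > 0" "cball p (2 * r) \<subseteq> \<Omega>"
    proof -
      obtain d where "d > 0" "cball p d \<subseteq> \<Omega>" using \<Omega>(1) p(1) open_contains_cball by blast
      then show thesis using that[of "d/2"] by simp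
    qed
    obtain c where c: "c \<in> Z" "dist c p < r" using p(2) r(1) closure_approachable by blast
    have cb: "ball c r \<subseteq> cball p (2 * r)"
    proof
      fix x assume "x \<in> ball c r"
      then show "x \<in> cball p (2 * r)" using c(2) dist_triangle[of p x c] by (simp add: dist_commute)
    qed
    obtain e where e: "e > 0" "ball c e \<subseteq> Z"
      using c(1) openE unfolding Z_def by blast
    have "continuous_on (cball p (2*r)) q" using q r(2) continuous_on_subset by blast
    then have "bounded (q ` cball p (2*r))"
      using compact_continuous_image compact_cball compact_imp_bounded by blast
    then obtain C where "\<forall>y\<in>q ` cball p (2*r). norm y \<le> C" unfolding bounded_iff by blast
    then have C: "\<bar>q x\<bar> \<le> C" if "x \<in> cball p (2*r)" for x using that by auto
    have *: "u x = 0" if "x \<in> ball c r" for x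
    proof (rule ball_unique_continuation[OF _ e(1) _ _ that])
      show "smooth_on u (ball c r)" by (rule smooth_on_subset[OF u]) (use cb r in auto)
      show "\<bar>dd 1 (dd 1 u) z + dd \<i> (dd \<i> u) z\<bar> \<le> C * \<bar>u z\<bar>" if "z \<in> ball c r" for z
      proof -
        have "z \<in> cball p (2 * r)" using that cb by blast
        then show ?thesis using lap[OF subsetD[OF r(2)]] C by (simp add: abs_mult mult_right_mono)
      qed
      show "u z = 0" if "z \<in> ball c e" for z
        using e(2) that interior_subset unfolding Z_def by blast
    qed
    have "ball c r \<subseteq> Z" unfolding Z_def
      by (rule interior_maximal) (use * cb r in auto)
    then show ?thesis using c(2) by (auto simp: dist_commute)
  qed
  then have "closedin (top_of_set \<Omega>) Z"
    using interior_subset unfolding Z_def by (intro closedin_limpt[THEN iffD2]) (auto simp: closure_def)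
  moreover have "openin (top_of_set \<Omega>) Z"
    unfolding Z_def using interior_subset[of "{z\<in>\<Omega>. u z = 0}"]
    by (intro open_openin_trans \<Omega>) auto
  ultimately have "Z = \<Omega>" using \<Omega>(2) UZ U(2) unfolding connected_clopen by blast
  then show ?thesis using z interior_subset unfolding Z_def by blast
qed

section \<open>Harmonic functions with equal squares of their gradients\<close>

lemma harmonic_locally_constant:
  fixes u :: "complex \<Rightarrow> real"
  assumes \<Omega>: "open \<Omega>" "connected \<Omega>" and u: "smooth_on u \<Omega>"
    and harm: "\<And>y. y \<in> \<Omega> \<Longrightarrow> dd 1 (dd 1 u) y + dd \<i> (dd \<i> u) y = 0"
    and r: "0 < r" "ball p r \<subseteq> \<Omega>" and flat: "\<And>y. y \<in> ball p r \<Longrightarrow> dd 1 u y = 0 \<and> dd \<i> u y = 0"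
    and y: "y \<in> \<Omega>"
  shows "u y = u p"
proof -
  define v where "v y = u y + - u p" for y
  have d: "dd a v z = dd a u z" if "z \<in> \<Omega>" for a z
    unfolding v_def[abs_def] dd_add[OF u smooth_on_const that] by (simp add: dd_const)
  have vs: "smooth_on v \<Omega>" unfolding v_def by (intro smooth_on_add smooth_on_const u \<Omega>)
  have loc: "v z = 0" if z: "z \<in> ball p r" for z
  proof (rule gronwall_zero[OF _ _ _ z])
    show "v p = 0" by (simp add: v_def)
    fix z assume z: "z \<in> ball p r"
    then have zO: "z \<in> \<Omega>" using r by blast
    show "(v has_derivative (\<lambda>a. dd a v z)) (at z)" by (rule smooth_on_has_derivative[OF vs zO])
    have "dd a v z = 0" for a
      using dd_complex_expand[OF u zO, of a] d[OF zO, of a] flat[OF z] by simp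
    then show "norm (dd a v z) \<le> 0 * norm a * norm (v z)" for a by simp
  qed
  have "v y = 0"
  proof (rule unique_continuation[OF \<Omega> vs continuous_on_const[of _ 0] _ open_ball _ r(2) loc y])
    show "ball p r \<noteq> {}" using r by simp
    show "dd 1 (dd 1 v) z + dd \<i> (dd \<i> v) z = 0 * v z" if z: "z \<in> \<Omega>" for z
    proof -
      have "dd a (dd a v) z = dd a (dd a u) z" for a by (rule dd_cong[OF \<Omega>(1) z d])
      then show ?thesis using harm[OF z] by simp
    qed
  qed
  then show ?thesis by (simp add: v_def)
qed

text \<open>
At each point the gradient of \<open>f' - f\<close> or that of \<open>f' + f\<close> vanishes. If the first is nonzero somewhere,
it is nonzero on a disc, so \<open>f' + f\<close> is constant there, and by unique continuation on \<open>\<Omega>\<close>.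
\<close>

lemma harmonic_equal_squares:
  fixes f f' :: "complex \<Rightarrow> real"
  assumes \<Omega>: "open \<Omega>" "connected \<Omega>" "\<Omega> \<noteq> {}" and f: "smooth_on f \<Omega>" "smooth_on f' \<Omega>"
    and harm: "\<And>y. y \<in> \<Omega> \<Longrightarrow> dd 1 (dd 1 f) y + dd \<i> (dd \<i> f) y = 0"
      "\<And>y. y \<in> \<Omega> \<Longrightarrow> dd 1 (dd 1 f') y + dd \<i> (dd \<i> f') y = 0"
    and sq: "\<And>y. y \<in> \<Omega> \<Longrightarrow> (dd 1 f' y = dd 1 f y \<and> dd \<i> f' y = dd \<i> f y)
      \<or> (dd 1 f' y = - dd 1 f y \<and> dd \<i> f' y = - dd \<i> f y)"
  obtains s d where "s * s = 1" "\<And>y. y \<in> \<Omega> \<Longrightarrow> f' y = s * f y + d"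
proof -
  \<comment> \<open>\<open>s = 1\<close> and \<open>s = - 1\<close> are the two candidates for the sign\<close>
  define u where "u s y = f' y + (- s) * f y" for s y
  have sf: "smooth_on (\<lambda>y. (- s) * f y) \<Omega>" for s by (intro smooth_on_mult smooth_on_const f \<Omega>)
  have us: "smooth_on (u s) \<Omega>" for s unfolding u_def[abs_def] by (rule smooth_on_add[OF \<Omega>(1) f(2) sf])
  have dc: "dd a (\<lambda>y. c * g y) z = c * dd a g z" if "smooth_on g \<Omega>" "z \<in> \<Omega>" for a c and g :: "complex \<Rightarrow> real" and z
    by (rule dd_linear_compose[OF bounded_linear_mult_right that])
  have d: "dd a (u s) z = dd a f' z + (- s) * dd a f z" if "z \<in> \<Omega>" for a s z
    unfolding u_def[abs_def] dd_add[OF f(2) sf that] dc[OF f(1) that] ..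
  have h: "dd 1 (dd 1 (u s)) z + dd \<i> (dd \<i> (u s)) z = 0" if z: "z \<in> \<Omega>" for s z
  proof -
    have "dd a (dd a (u s)) z = dd a (dd a f') z + (- s) * dd a (dd a f) z" for a
    proof -
      have "dd a (dd a (u s)) z = dd a (\<lambda>z. dd a f' z + (- s) * dd a f z) z" by (rule dd_cong[OF \<Omega>(1) z d])
      also have "\<dots> = dd a (dd a f') z + (- s) * dd a (dd a f) z"
        unfolding dd_add[OF smooth_on_dd[OF f(2)] smooth_on_mult[OF \<Omega>(1) smooth_on_const smooth_on_dd[OF f(1)]] z]
          dc[OF smooth_on_dd[OF f(1)] z] ..
      finally show ?thesis .
    qed
    then show ?thesis using harm(2)[OF z] distrib_left[of s "dd 1 (dd 1 f) z" "dd \<i> (dd \<i> f) z"] harm(1)[OF z] by simp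
  qed
  note witness = that
  have fin: thesis if "s * s = 1" "0 < r" "ball p r \<subseteq> \<Omega>" "\<And>y. y \<in> ball p r \<Longrightarrow> dd 1 (u s) y = 0 \<and> dd \<i> (u s) y = 0" for s p r
  proof (rule witness[of s "u s p"])
    show "s * s = 1" by fact
    show "f' y = s * f y + u s p" if y: "y \<in> \<Omega>" for y
      using harmonic_locally_constant[OF \<Omega>(1,2) us h \<open>0 < r\<close> \<open>ball p r \<subseteq> \<Omega>\<close> \<open>\<And>y. y \<in> ball p r \<Longrightarrow> dd 1 (u s) y = 0 \<and> dd \<i> (u s) y = 0\<close> y]
      by (simp add: u_def)
  qed
  define g where "g y = (dd 1 (u 1) y)\<^sup>2 + (dd \<i> (u 1) y)\<^sup>2" for y
  have gc: "continuous_on \<Omega> g"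
    unfolding g_def by (intro continuous_intros smooth_on_continuous smooth_on_dd us)
  show thesis
  proof (cases "\<exists>p\<in>\<Omega>. g p \<noteq> 0")
    case True
    then obtain p where p: "p \<in> \<Omega>" "g p \<noteq> 0" by blast
    have "open (\<Omega> \<inter> g -` (- {0}))" by (rule continuous_open_preimage[OF gc \<Omega>(1)]) auto
    then obtain r where r: "r > 0" "ball p r \<subseteq> \<Omega> \<inter> g -` (- {0})"
      using p open_contains_ball by blast
    show thesis
    proof (rule fin[of "- 1" r p])
      fix y assume "y \<in> ball p r"
      then have y: "y \<in> \<Omega>" "g y \<noteq> 0" using r by auto
      then show "dd 1 (u (- 1)) y = 0 \<and> dd \<i> (u (- 1)) y = 0"
        using sq[OF y(1)] by (auto simp: g_def d)
    qed (use r in auto)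
  next
    case False
    obtain p where "p \<in> \<Omega>" using \<Omega> by blast
    then obtain r where r: "r > 0" "ball p r \<subseteq> \<Omega>" using \<Omega>(1) open_contains_ball by blast
    show thesis
    proof (rule fin[of 1 r p])
      fix y assume "y \<in> ball p r"
      then have "g y = 0" using False r by blast
      then show "dd 1 (u 1) y = 0 \<and> dd \<i> (u 1) y = 0" by (simp add: g_def add_nonneg_eq_0_iff)
    qed (use r in auto)
  qed
qed

section \<open>The three surfaces as quadrics in \<open>\<real>\<^sup>3\<close>\<close>

fun curv :: "surface \<Rightarrow> real" where
  "curv Euclidean = 0" | "curv Hyperbolic = -1" | "curv Spherical = 1"

text \<open>
For \<open>\<kappa> = 1\<close> this is the Euclidean inner product, for \<open>\<kappa> = - 1\<close> the Lorentz form, and for \<open>\<kappa> = 0\<close> it is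
degenerate.
\<close>

definition form :: "real \<Rightarrow> point \<Rightarrow> point \<Rightarrow> real" where
  "form \<kappa> x y = fst x \<bullet> fst y + \<kappa> * (snd x * snd y)"

text \<open>
If \<open>P\<close> lies on the quadric, this is the coefficient of \<open>P\<close> in the decomposition of \<open>v\<close> along the line through
\<open>P\<close> and the tangent plane at \<open>P\<close>; the tangent plane is its kernel. The second summand replaces the first one
in the flat case, where the form does not see the third coordinate.
\<close>

definition radial :: "real \<Rightarrow> point \<Rightarrow> point \<Rightarrow> real" where
  "radial \<kappa> P v = \<kappa> * form \<kappa> P v + (1 - \<kappa>\<^sup>2) * snd v"

text \<open>
The affine plane at height 1, the upper sheet of the hyperboloid, or the unit sphere.
\<close>

definition model :: "surface \<Rightarrow> point set" where
  "model M = {P. radial (curv M) P P = 1 \<and> (M = Hyperbolic \<longrightarrow> 0 < snd P)}"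

lemma bounded_bilinear_form: "bounded_bilinear (form \<kappa>)"
proof -
  have "bilinear (form \<kappa>)"
    unfolding bilinear_def
    by (intro conjI allI linearI) (simp_all add: form_def inner_add_left inner_add_right algebra_simps)
  then show ?thesis by (rule bilinear_conv_bounded_bilinear[THEN iffD1])
qed

lemmas form_simps = bounded_bilinear.add_left[OF bounded_bilinear_form] bounded_bilinear.add_right[OF bounded_bilinear_form]
  bounded_bilinear.scaleR_left[OF bounded_bilinear_form] bounded_bilinear.scaleR_right[OF bounded_bilinear_form]
  bounded_bilinear.zero_left[OF bounded_bilinear_form] bounded_bilinear.zero_right[OF bounded_bilinear_form]
  bounded_bilinear.diff_left[OF bounded_bilinear_form] bounded_bilinear.diff_right[OF bounded_bilinear_form]
  bounded_bilinear.minus_left[OF bounded_bilinear_form] bounded_bilinear.minus_right[OF bounded_bilinear_form]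

lemma form_commute: "form \<kappa> x y = form \<kappa> y x"
  by (simp add: form_def inner_commute mult.commute)

lemma linear_radial: "linear (radial \<kappa> P)"
  by (rule linearI) (simp_all add: radial_def form_simps algebra_simps)

lemmas radial_simps = linear_add[OF linear_radial] linear_scale[OF linear_radial] linear_0[OF linear_radial]
  linear_diff[OF linear_radial] linear_neg[OF linear_radial]

lemma curv_cases: "curv M = 0 \<or> curv M = 1 \<or> curv M = -1"
  by (cases M) auto

fun emb :: "surface \<Rightarrow> point \<Rightarrow> point" where
  "emb Euclidean p = (fst p, 1)"
| "emb Hyperbolic p = (conf Hyperbolic (fst p) *\<^sub>R fst p, conf Hyperbolic (fst p) - 1)"
| "emb Spherical p = p"

fun emb_inv :: "surface \<Rightarrow> point \<Rightarrow> point" where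
  "emb_inv Euclidean P = (fst P, 0)"
| "emb_inv Hyperbolic P = (fst P /\<^sub>R (1 + snd P), 0)"
| "emb_inv Spherical P = P"

text \<open>
The parameter \<open>\<epsilon>\<close> that describes the preferred chart at \<open>p\<close> uniformly as \<open>P \<mapsto> fst P / (1 + \<epsilon> snd P)\<close>: the
central projection from \<open>(0, - \<epsilon>)\<close> if \<open>\<epsilon> = \<plusminus> 1\<close>, the vertical projection if \<open>\<epsilon> = 0\<close>.
\<close>

fun pole :: "surface \<Rightarrow> point \<Rightarrow> real" where
  "pole Euclidean p = 0"
| "pole Hyperbolic p = 1"
| "pole Spherical p = (if p = (0, 1) then 1 else - 1)"

text \<open>
The range of the charts: the unit disc for \<open>\<kappa> = - 1\<close>, otherwise the whole plane.
\<close>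

definition chart_range :: "real \<Rightarrow> complex set" where
  "chart_range \<kappa> = {z. 0 < 1 + \<kappa> * (z \<bullet> z)}"

text \<open>
The conformal factor \<open>\<sigma>\<close>, written so that one formula covers the three curvatures.
\<close>

definition conf_factor :: "real \<Rightarrow> complex \<Rightarrow> real" where
  "conf_factor \<kappa> z = (1 + \<kappa>\<^sup>2) / (1 + \<kappa> * (z \<bullet> z))"

text \<open>
The inverse of the chart with parameter \<open>\<epsilon>\<close>, composed with the embedding. The last summand puts the
Euclidean plane at height 1.
\<close>

definition chart_emb :: "real \<Rightarrow> real \<Rightarrow> complex \<Rightarrow> point" where
  "chart_emb \<kappa> \<epsilon> z = (conf_factor \<kappa> z *\<^sub>R z, \<epsilon> * (conf_factor \<kappa> z - 1) + (1 - \<kappa>\<^sup>2))"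

text \<open>
The differential of \<open>\<sigma>\<close> at \<open>z\<close> in the direction \<open>\<xi>\<close>; similarly below for the inverse chart. This form of it
uses that \<open>\<kappa>\<close> is \<open>0\<close>, \<open>1\<close> or \<open>- 1\<close>.
\<close>

definition d_conf_factor :: "real \<Rightarrow> complex \<Rightarrow> complex \<Rightarrow> real" where
  "d_conf_factor \<kappa> z \<xi> = - \<kappa> * (conf_factor \<kappa> z)\<^sup>2 * (z \<bullet> \<xi>)"

definition d_chart_emb :: "real \<Rightarrow> real \<Rightarrow> complex \<Rightarrow> complex \<Rightarrow> point" where
  "d_chart_emb \<kappa> \<epsilon> z \<xi> = (conf_factor \<kappa> z *\<^sub>R \<xi> + d_conf_factor \<kappa> z \<xi> *\<^sub>R z, \<epsilon> * d_conf_factor \<kappa> z \<xi>)"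

definition admissible :: "real \<Rightarrow> real \<Rightarrow> bool" where
  "admissible \<kappa> \<epsilon> \<longleftrightarrow> (\<kappa> = 0 \<and> \<epsilon> = 0) \<or> ((\<kappa> = 1 \<or> \<kappa> = -1) \<and> (\<epsilon> = 1 \<or> \<epsilon> = -1))"

lemma admissible_pole: "admissible (curv M) (pole M p)"
  by (cases M) (auto simp: admissible_def)

lemma admissible_cases: "admissible \<kappa> \<epsilon> \<Longrightarrow> \<kappa> = 0 \<or> \<kappa> = 1 \<or> \<kappa> = -1"
  by (auto simp: admissible_def)

lemma conf_eq_conf_factor: "conf M z = conf_factor (curv M) z"
  by (cases M) (auto simp: conf_factor_def power2_norm_eq_inner)

lemma conf_factor_pos: "z \<in> chart_range \<kappa> \<Longrightarrow> 0 < conf_factor \<kappa> z"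
  by (simp add: conf_factor_def chart_range_def add_pos_nonneg)

lemma conf_factor_eq: "z \<in> chart_range \<kappa> \<Longrightarrow> conf_factor \<kappa> z * (1 + \<kappa> * (z \<bullet> z)) = 1 + \<kappa>\<^sup>2"
  by (simp add: conf_factor_def chart_range_def)

lemma zz_eq:
  "z \<in> chart_range 1 \<Longrightarrow> z \<bullet> z = 2 / conf_factor 1 z - 1" "z \<in> chart_range (-1) \<Longrightarrow> z \<bullet> z = 1 - 2 / conf_factor (-1) z"
proof -
  assume z: "z \<in> chart_range 1"
  have "1 + z \<bullet> z = 2 / conf_factor 1 z"
    by (rule eq_divide_imp) (use conf_factor_eq[OF z] conf_factor_pos[OF z] in \<open>simp_all add: mult.commute\<close>)
  then show "z \<bullet> z = 2 / conf_factor 1 z - 1" by linarith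
next
  assume z: "z \<in> chart_range (-1)"
  have "1 - z \<bullet> z = 2 / conf_factor (-1) z"
    by (rule eq_divide_imp) (use conf_factor_eq[OF z] conf_factor_pos[OF z] in \<open>simp_all add: mult.commute\<close>)
  then show "z \<bullet> z = 1 - 2 / conf_factor (-1) z" by linarith
qed

lemma conf_factor0[simp]: "conf_factor 0 z = 1" by (simp add: conf_factor_def)

lemma d_conf_factor0[simp]: "d_conf_factor 0 z \<xi> = 0" by (simp add: d_conf_factor_def)

lemma open_chart_range: "open (chart_range \<kappa>)"
  unfolding chart_range_def by (intro open_Collect_less continuous_intros)

text \<open>
The embedding is isometric: it pulls the form back to \<open>\<sigma>\<^sup>2 |dz|\<^sup>2\<close>. The terms in \<open>z\<close> cancel because
\<open>\<sigma> (1 + \<kappa> |z|\<^sup>2) = 2\<close> unless \<open>\<kappa> = 0\<close>.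
\<close>

lemma form_d_chart_emb:
  assumes "admissible \<kappa> \<epsilon>" "z \<in> chart_range \<kappa>"
  shows "form \<kappa> (d_chart_emb \<kappa> \<epsilon> z \<xi>) (d_chart_emb \<kappa> \<epsilon> z \<eta>) = (conf_factor \<kappa> z)\<^sup>2 * (\<xi> \<bullet> \<eta>)"
proof -
  have "form \<kappa> (d_chart_emb \<kappa> \<epsilon> z \<xi>) (d_chart_emb \<kappa> \<epsilon> z \<eta>)
    = (conf_factor \<kappa> z)\<^sup>2 * (\<xi> \<bullet> \<eta>) + (-2 * \<kappa> * (conf_factor \<kappa> z)^3 + \<kappa>\<^sup>2 * (conf_factor \<kappa> z)^4 * (z \<bullet> z) + \<kappa>^3 * \<epsilon>\<^sup>2 * (conf_factor \<kappa> z)^4) * (z \<bullet> \<xi>) * (z \<bullet> \<eta>)"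
    by (simp add: form_def d_chart_emb_def d_conf_factor_def inner_add_left inner_add_right inner_commute[of \<xi> z] inner_commute[of \<eta> z] power2_eq_square
        power3_eq_cube power4_eq_xxxx algebra_simps)
  moreover have "-2 * \<kappa> * (conf_factor \<kappa> z)^3 + \<kappa>\<^sup>2 * (conf_factor \<kappa> z)^4 * (z \<bullet> z) + \<kappa>^3 * \<epsilon>\<^sup>2 * (conf_factor \<kappa> z)^4 = 0"
  proof -
    consider "\<kappa> = 0" | "\<kappa> = 1" "\<epsilon>\<^sup>2 = 1" | "\<kappa> = -1" "\<epsilon>\<^sup>2 = 1" using assms(1) by (auto simp: admissible_def)
    then show ?thesis
    proof cases
      case 2
      then show ?thesis using assms(2) conf_factor_pos[of z 1] by (simp add: zz_eq field_simps power3_eq_cube power4_eq_xxxx)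
    next
      case 3
      then show ?thesis using assms(2) conf_factor_pos[of z "-1"] by (simp add: zz_eq field_simps power3_eq_cube power4_eq_xxxx)
    qed simp
  qed
  ultimately show ?thesis by simp
qed

lemma radial_chart_emb:
  assumes "admissible \<kappa> \<epsilon>" "z \<in> chart_range \<kappa>"
  shows "radial \<kappa> (chart_emb \<kappa> \<epsilon> z) (chart_emb \<kappa> \<epsilon> z) = 1"
proof -
  consider "\<kappa> = 0" "\<epsilon> = 0" | "\<kappa> = 1" "\<epsilon> * \<epsilon> = 1" | "\<kappa> = -1" "\<epsilon> * \<epsilon> = 1" using assms(1) by (auto simp: admissible_def)
  then show ?thesis
  proof cases
    case 1
    then show ?thesis by (simp add: radial_def chart_emb_def form_def)
  next
    case 2
    have "radial \<kappa> (chart_emb \<kappa> \<epsilon> z) (chart_emb \<kappa> \<epsilon> z) = conf_factor 1 z * conf_factor 1 z * (z \<bullet> z) + \<epsilon> * \<epsilon> * (conf_factor 1 z - 1)\<^sup>2"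
      using 2(1) by (simp add: radial_def chart_emb_def form_def power2_eq_square algebra_simps)
    then show ?thesis using 2 assms(2) conf_factor_pos[of z 1] by (simp add: zz_eq field_simps power2_eq_square)
  next
    case 3
    have "radial \<kappa> (chart_emb \<kappa> \<epsilon> z) (chart_emb \<kappa> \<epsilon> z) = - (conf_factor (-1) z * conf_factor (-1) z * (z \<bullet> z)) + \<epsilon> * \<epsilon> * (conf_factor (-1) z - 1)\<^sup>2"
      using 3(1) by (simp add: radial_def chart_emb_def form_def power2_eq_square algebra_simps)
    then show ?thesis using 3 assms(2) conf_factor_pos[of z "-1"] by (simp add: zz_eq field_simps power2_eq_square)
  qed
qed

lemma radial_d_chart_emb:
  assumes "admissible \<kappa> \<epsilon>" "z \<in> chart_range \<kappa>"
  shows "radial \<kappa> (chart_emb \<kappa> \<epsilon> z) (d_chart_emb \<kappa> \<epsilon> z \<xi>) = 0"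
proof -
  have e: "radial \<kappa> (chart_emb \<kappa> \<epsilon> z) (d_chart_emb \<kappa> \<epsilon> z \<xi>) =
     (z \<bullet> \<xi>) * (\<kappa> * (conf_factor \<kappa> z)\<^sup>2 - \<kappa>\<^sup>2 * (conf_factor \<kappa> z)^3 * (z \<bullet> z) - \<kappa>^3 * \<epsilon>\<^sup>2 * (conf_factor \<kappa> z - 1) * (conf_factor \<kappa> z)\<^sup>2
        - (1 - \<kappa>\<^sup>2) * (\<kappa>^3 * \<epsilon> + \<kappa> * \<epsilon>) * (conf_factor \<kappa> z)\<^sup>2)"
    by (simp add: form_def radial_def chart_emb_def d_chart_emb_def d_conf_factor_def inner_add_left inner_add_right power2_eq_square
        power3_eq_cube power4_eq_xxxx algebra_simps)
  consider "\<kappa> = 0" | "\<kappa> = 1" "\<epsilon>\<^sup>2 = 1" | "\<kappa> = -1" "\<epsilon>\<^sup>2 = 1" using assms(1) by (auto simp: admissible_def)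
  then show ?thesis
  proof cases
    case 2
    then show ?thesis unfolding e using assms(2) conf_factor_pos[of z 1] by (simp add: zz_eq field_simps power3_eq_cube power2_eq_square[of "conf_factor _ _"])
  next
    case 3
    then show ?thesis unfolding e using assms(2) conf_factor_pos[of z "-1"] by (simp add: zz_eq field_simps power3_eq_cube power2_eq_square[of "conf_factor _ _"])
  next
    case 1
    then show ?thesis unfolding e by simp
  qed
qed

text \<open>
The preimage is found by differentiating the chart \<open>P \<mapsto> fst P / (1 + \<epsilon> snd P)\<close>, whose denominator
equals \<open>\<sigma>\<close>.
\<close>

lemma tangent_is_d_chart_emb:
  assumes "admissible \<kappa> \<epsilon>" "z \<in> chart_range \<kappa>" "radial \<kappa> (chart_emb \<kappa> \<epsilon> z) v = 0"
  shows "\<exists>\<xi>. v = d_chart_emb \<kappa> \<epsilon> z \<xi>"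
proof -
  define s where "s = conf_factor \<kappa> z"
  have s: "s > 0" using conf_factor_pos[OF assms(2)] by (simp add: s_def)
  define \<xi> where "\<xi> = (1 / s) *\<^sub>R (fst v - (\<epsilon> * snd v) *\<^sub>R z)"
  have h: "\<kappa> * (s * (z \<bullet> fst v) + \<kappa> * ((\<epsilon> * (s - 1) + (1 - \<kappa>\<^sup>2)) * snd v)) + (1 - \<kappa>\<^sup>2) * snd v = 0"
    using assms(3) by (simp add: radial_def chart_emb_def form_def s_def)
  have d: "d_conf_factor \<kappa> z \<xi> = - \<kappa> * s * (z \<bullet> fst v) + \<kappa> * s * (z \<bullet> z) * \<epsilon> * snd v"
    using s by (simp add: d_conf_factor_def s_def[symmetric] \<xi>_def inner_diff_right power2_eq_square field_simps)
  have "d_conf_factor \<kappa> z \<xi> = \<epsilon> * snd v \<and> \<epsilon> * \<epsilon> * snd v = snd v"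
  proof -
    consider "\<kappa> = 0" "\<epsilon> = 0" | "\<kappa> = 1" "\<epsilon> * \<epsilon> = 1" | "\<kappa> = -1" "\<epsilon> * \<epsilon> = 1" using assms(1) by (auto simp: admissible_def)
    then show ?thesis
    proof cases
      case 1
      then show ?thesis using h by simp
    next
      case 2
      have "s * (z \<bullet> fst v) = - (\<epsilon> * (s - 1)) * snd v" using h 2 by simp
      moreover have "s * (z \<bullet> z) = 2 - s"
        using conf_factor_eq[OF assms(2)] 2 by (simp add: s_def algebra_simps)
      ultimately have "d_conf_factor \<kappa> z \<xi> = (\<epsilon> * (s - 1)) * snd v + (2 - s) * \<epsilon> * snd v"
        unfolding d using 2 by simp
      then show ?thesis using 2 by (simp add: algebra_simps)
    next
      case 3
      have "s * (z \<bullet> fst v) = (\<epsilon> * (s - 1)) * snd v" using h 3 by simp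
      moreover have "s * (z \<bullet> z) = s - 2"
        using conf_factor_eq[OF assms(2)] 3 by (simp add: s_def algebra_simps)
      moreover have "d_conf_factor \<kappa> z \<xi> = s * (z \<bullet> fst v) - (s * (z \<bullet> z)) * \<epsilon> * snd v"
        unfolding d using 3 by simp
      ultimately have "d_conf_factor \<kappa> z \<xi> = (\<epsilon> * (s - 1)) * snd v - (s - 2) * \<epsilon> * snd v"
        by (simp only:)
      then show ?thesis using 3 by (simp add: algebra_simps)
    qed
  qed
  then have "v = d_chart_emb \<kappa> \<epsilon> z \<xi>"
    using s by (simp add: d_chart_emb_def prod_eq_iff s_def[symmetric] \<xi>_def mult.assoc)
  then show ?thesis ..
qed

lemma bounded_linear_d_chart_emb: "bounded_linear (d_chart_emb \<kappa> \<epsilon> z)"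
proof -
  have "linear (d_chart_emb \<kappa> \<epsilon> z)"
    by (rule linearI) (simp_all add: d_chart_emb_def d_conf_factor_def prod_eq_iff inner_add_right algebra_simps)
  then show ?thesis by (rule linear_conv_bounded_linear[THEN iffD1])
qed

lemma d_chart_emb_eq_0_iff:
  assumes "admissible \<kappa> \<epsilon>" "z \<in> chart_range \<kappa>"
  shows "d_chart_emb \<kappa> \<epsilon> z \<xi> = 0 \<longleftrightarrow> \<xi> = 0"
proof
  assume "d_chart_emb \<kappa> \<epsilon> z \<xi> = 0"
  then have "form \<kappa> (d_chart_emb \<kappa> \<epsilon> z \<xi>) (d_chart_emb \<kappa> \<epsilon> z \<xi>) = 0" by (simp add: form_def)
  then show "\<xi> = 0" using form_d_chart_emb[OF assms, of \<xi> \<xi>] conf_factor_pos[OF assms(2)] by simp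
qed (simp add: bounded_linear_d_chart_emb[THEN bounded_linear.linear, THEN linear_0])

lemma emb_chart:
  assumes "p \<in> points M" "q \<in> chart_domain M p"
  shows "chart M p q \<in> chart_range (curv M)" "emb M q = chart_emb (curv M) (pole M p) (chart M p q)"
proof -
  have "chart M p q \<in> chart_range (curv M) \<and> emb M q = chart_emb (curv M) (pole M p) (chart M p q)"
  proof (cases M)
    case Euclidean
    then show ?thesis by (simp add: chart_range_def chart_emb_def)
  next
    case Hyperbolic
    then have "cmod (fst q) < 1" using assms by simp
    then have "fst q \<bullet> fst q < 1" by (simp add: norm_lt_square)
    then show ?thesis using Hyperbolic by (simp add: chart_range_def chart_emb_def conf_eq_conf_factor del: conf.simps)
  next
    case Spherical
    define e where "e = pole M p"
    have e: "e = 1 \<or> e = - 1" using Spherical by (auto simp: e_def)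
    have ch: "chart M p q = fst q /\<^sub>R (1 + e * snd q)" using Spherical by (simp add: e_def)
    have "q \<in> sphere 0 1" using assms Spherical by auto
    then have n: "fst q \<bullet> fst q + (snd q)\<^sup>2 = 1"
      by (simp add: norm_eq_1 inner_prod_def power2_eq_square)
    have ne: "q \<noteq> (0, - e)" using assms Spherical by (auto simp: e_def split: if_splits)
    have d: "1 + e * snd q \<noteq> 0"
    proof
      assume "1 + e * snd q = 0"
      then have "snd q = - e" using e by auto
      moreover from this have "fst q \<bullet> fst q = 0" using n e by auto
      ultimately show False using ne by (simp add: prod_eq_iff)
    qed
    have zz: "chart M p q \<bullet> chart M p q = (1 - e * snd q) / (1 + e * snd q)"
    proof -
      have "chart M p q \<bullet> chart M p q = (fst q \<bullet> fst q) / (1 + e * snd q)\<^sup>2"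
        by (simp add: ch power2_eq_square divide_inverse mult_ac)
      also have "fst q \<bullet> fst q = (1 - e * snd q) * (1 + e * snd q)"
        using n e by (auto simp: power2_eq_square algebra_simps)
      finally show ?thesis using d by (simp add: power2_eq_square)
    qed
    have "1 + chart M p q \<bullet> chart M p q > 0" by (simp add: add_pos_nonneg)
    moreover have s: "conf_factor 1 (chart M p q) = 1 + e * snd q"
      unfolding conf_factor_def zz using d by (simp add: field_simps)
    moreover have "fst q = (1 + e * snd q) *\<^sub>R chart M p q" "e * (e * snd q) = snd q"
      using d e by (auto simp: ch)
    moreover have "pole Spherical p = e" using Spherical by (simp add: e_def)
    ultimately show ?thesis
      using Spherical by (simp add: chart_range_def chart_emb_def prod_eq_iff del: chart.simps pole.simps)
  qed
  then show "chart M p q \<in> chart_range (curv M)" "emb M q = chart_emb (curv M) (pole M p) (chart M p q)" by auto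
qed

lemma points_in_own_chart: "p \<in> points M \<Longrightarrow> p \<in> chart_domain M p"
  by (cases M) auto

lemma chart_domain_subset: "chart_domain M p \<subseteq> points M"
  by (cases M) auto

lemma chart_emb_in_model:
  assumes "z \<in> chart_range (curv M)"
  shows "chart_emb (curv M) (pole M p) z \<in> model M"
proof -
  have "0 < snd (chart_emb (curv M) (pole M p) z)" if "M = Hyperbolic"
  proof -
    have "z \<bullet> z < 1" using assms that by (simp add: chart_range_def)
    then have "1 < 2 / (1 - z \<bullet> z)" using inner_ge_zero[of z] by (simp add: less_divide_eq del: inner_ge_zero)
    then show ?thesis using that by (simp add: chart_emb_def conf_factor_def)
  qed
  then show ?thesis using radial_chart_emb[OF admissible_pole assms] by (simp add: model_def)
qed

lemma emb_in_model: "p \<in> points M \<Longrightarrow> emb M p \<in> model M"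
  using emb_chart[of p M p] chart_emb_in_model points_in_own_chart by metis

lemma emb_inv_emb: "p \<in> points M \<Longrightarrow> emb_inv M (emb M p) = p"
proof (cases M)
  case Hyperbolic
  assume p: "p \<in> points M"
  then have "z \<in> chart_range (-1)" if "z = fst p" for z
    using emb_chart(1)[of p M p] points_in_own_chart[of p M] that Hyperbolic by simp
  then have "conf_factor (-1) (fst p) > 0" using conf_factor_pos by blast
  then show ?thesis using Hyperbolic p
    by (simp add: prod_eq_iff conf_eq_conf_factor[of Hyperbolic] del: conf.simps)
qed (auto simp: prod_eq_iff)

lemma model_emb:
  assumes "P \<in> model M"
  shows "emb_inv M P \<in> points M" "emb M (emb_inv M P) = P"
proof -
  have "emb_inv M P \<in> points M \<and> emb M (emb_inv M P) = P"
  proof (cases M)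
    case Euclidean
    then show ?thesis using assms by (simp add: model_def radial_def form_def prod_eq_iff)
  next
    case Hyperbolic
    define s where "s = snd P"
    have s: "0 < s" "fst P \<bullet> fst P = (s - 1) * (s + 1)"
      using assms Hyperbolic by (auto simp: model_def radial_def form_def s_def algebra_simps)
    define z where "z = fst P /\<^sub>R (1 + s)"
    have "z \<bullet> z = (fst P \<bullet> fst P) / (1 + s)\<^sup>2"
      by (simp add: z_def power2_eq_square divide_inverse mult_ac)
    then have zz: "z \<bullet> z = (s - 1) / (s + 1)" using s by (simp add: power2_eq_square add.commute)
    then have "cmod z < 1" using s by (simp add: norm_lt_square)
    moreover have "conf Hyperbolic z = 1 + s"
      unfolding conf.simps power2_norm_eq_inner zz using s by (simp add: field_simps)
    ultimately show ?thesis using Hyperbolic s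
      by (simp add: prod_eq_iff s_def[symmetric] z_def[symmetric] del: conf.simps) (simp add: z_def)
  next
    case Spherical
    then show ?thesis using assms
      by (simp add: model_def radial_def form_def norm_eq_1 inner_prod_def)
  qed
  then show "emb_inv M P \<in> points M" "emb M (emb_inv M P) = P" by auto
qed

lemma chart_formula:
  assumes "q \<in> points M"
  shows "chart M p q = fst (emb M q) /\<^sub>R (1 + pole M p * snd (emb M q))"
proof (cases M)
  case Hyperbolic
  have "fst q \<in> chart_range (-1)"
    using emb_chart(1)[of q M q] points_in_own_chart[of q M] Hyperbolic assms by simp
  then have "conf_factor (-1) (fst q) > 0" using conf_factor_pos by blast
  then show ?thesis using Hyperbolic by (simp add: conf_eq_conf_factor[of Hyperbolic] del: conf.simps)
qed auto

lemma chart_domain_iff: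
  "q \<in> chart_domain M p \<longleftrightarrow> q \<in> points M \<and> 1 + pole M p * snd (emb M q) \<noteq> 0"
proof (cases M)
  case Hyperbolic
  have "0 < snd (emb M q)" if "q \<in> points M"
    using emb_in_model[OF that] Hyperbolic by (simp add: model_def)
  then show ?thesis using Hyperbolic by force
next
  case Spherical
  have "q = (0, - e)" if "q \<in> sphere 0 1" "e = 1 \<or> e = -1" "1 + e * snd q = 0" for e
  proof -
    have "fst q \<bullet> fst q + (snd q)\<^sup>2 = 1"
      using that(1) by (simp add: norm_eq_1 inner_prod_def power2_eq_square)
    moreover have "snd q = - e" using that by auto
    ultimately show ?thesis using that(2) by (auto simp: prod_eq_iff)
  qed
  from this[of 1] this[of "-1"] show ?thesis using Spherical by (auto simp: algebra_simps)
qed auto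

lemma chart_chart_emb:
  fixes M p z
  assumes "z \<in> chart_range (curv M)"
  defines "q \<equiv> emb_inv M (chart_emb (curv M) (pole M p) z)"
  shows "q \<in> chart_domain M p" "chart M p q = z" "emb M q = chart_emb (curv M) (pole M p) z"
proof -
  note m = model_emb[OF chart_emb_in_model[OF assms(1)], of p]
  show e: "emb M q = chart_emb (curv M) (pole M p) z" using m by (simp add: q_def)
  define s where "s = conf_factor (curv M) z"
  have s: "s > 0" using conf_factor_pos[OF assms(1)] by (simp add: s_def)
  have "(curv M = 0 \<and> pole M p = 0) \<or> ((curv M)\<^sup>2 = 1 \<and> pole M p * pole M p = 1)"
    using admissible_pole[of M p] by (auto simp: admissible_def)
  then have d: "(curv M = 0 \<and> 1 + pole M p * snd (emb M q) = 1) \<or> 1 + pole M p * snd (emb M q) = s"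
    unfolding e by (auto simp: chart_emb_def s_def algebra_simps)
  have s0: "s = 1" if "curv M = 0" using that by (simp add: s_def)
  have d': "1 + pole M p * snd (emb M q) = s" using d s0 by auto
  show "q \<in> chart_domain M p"
    unfolding chart_domain_iff using m(1) s d' by (simp add: q_def)
  show "chart M p q = z"
    using chart_formula[OF m(1)[folded q_def], of p] s d' e
    by (simp add: q_def[symmetric] chart_emb_def s_def[symmetric] del: chart.simps)
qed

lemma model_chart_emb:
  assumes "P \<in> model M"
  obtains \<epsilon> z where "admissible (curv M) \<epsilon>" "z \<in> chart_range (curv M)" "P = chart_emb (curv M) \<epsilon> z"
proof -
  note p = model_emb[OF assms]
  note c = emb_chart[OF p(1) points_in_own_chart[OF p(1)]]
  show ?thesis by (rule that[OF admissible_pole c(1)]) (use c(2) p(2) in simp)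
qed

text \<open>
Although the form may be indefinite, tangent planes are spacelike, because charts are conformal.
\<close>

lemma tangent_form_pos:
  assumes "P \<in> model M" "radial (curv M) P v = 0" "v \<noteq> 0"
  shows "0 < form (curv M) v v"
proof -
  obtain \<epsilon> z where e: "admissible (curv M) \<epsilon>" "z \<in> chart_range (curv M)" "P = chart_emb (curv M) \<epsilon> z"
    by (rule model_chart_emb[OF assms(1)])
  obtain \<xi> where \<xi>: "v = d_chart_emb (curv M) \<epsilon> z \<xi>"
    using tangent_is_d_chart_emb[OF e(1,2)] assms(2) e(3) by blast
  then have "\<xi> \<noteq> 0" using assms(3) d_chart_emb_eq_0_iff[OF e(1,2)] by blast
  then show ?thesis unfolding \<xi> form_d_chart_emb[OF e(1,2)] using conf_factor_pos[OF e(2)] by simp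
qed

lemma smooth_on_conf_factor: "smooth_on (conf_factor \<kappa>) (chart_range \<kappa>)"
proof -
  have "smooth_on (\<lambda>z. (1 + \<kappa>\<^sup>2) * inverse (1 + \<kappa> * (z \<bullet> z))) (chart_range \<kappa>)"
    by (intro smooth_on_mult smooth_on_inverse smooth_on_add smooth_on_const smooth_on_inner smooth_on_id open_chart_range)
      (simp add: chart_range_def)
  then show ?thesis by (simp add: conf_factor_def[abs_def] divide_inverse)
qed

lemma smooth_on_chart_emb: "smooth_on (chart_emb \<kappa> \<epsilon>) (chart_range \<kappa>)"
proof -
  have "smooth_on (\<lambda>z. (conf_factor \<kappa> z *\<^sub>R z, \<epsilon> * (conf_factor \<kappa> z + - 1) + (1 - \<kappa>\<^sup>2))) (chart_range \<kappa>)"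
    by (intro smooth_on_Pair smooth_on_scaleR smooth_on_mult smooth_on_add smooth_on_const smooth_on_id
        smooth_on_conf_factor open_chart_range)
  then show ?thesis by (simp add: chart_emb_def[abs_def])
qed

lemma conf_factor_has_derivative:
  assumes "\<kappa> = 0 \<or> \<kappa> = 1 \<or> \<kappa> = -1" "z \<in> chart_range \<kappa>"
  shows "(conf_factor \<kappa> has_derivative d_conf_factor \<kappa> z) (at z)"
proof -
  have n: "1 + \<kappa> * (z \<bullet> z) \<noteq> 0" using assms(2) by (simp add: chart_range_def)
  have "((\<lambda>z. (1 + \<kappa>\<^sup>2) / (1 + \<kappa> * (z \<bullet> z))) has_derivative
      (\<lambda>\<xi>. - ((1 + \<kappa>\<^sup>2) * (\<kappa> * (z \<bullet> \<xi> + \<xi> \<bullet> z)) / (1 + \<kappa> * (z \<bullet> z))\<^sup>2))) (at z)"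
    using n by (auto intro!: derivative_eq_intros simp: power2_eq_square)
  moreover have "- ((1 + \<kappa>\<^sup>2) * (\<kappa> * (z \<bullet> \<xi> + \<xi> \<bullet> z)) / (1 + \<kappa> * (z \<bullet> z))\<^sup>2) = d_conf_factor \<kappa> z \<xi>" for \<xi>
  proof -
    have "d_conf_factor \<kappa> z \<xi> = - (\<kappa> * (1 + \<kappa>\<^sup>2)\<^sup>2 * (z \<bullet> \<xi>) / (1 + \<kappa> * (z \<bullet> z))\<^sup>2)"
      by (simp add: d_conf_factor_def conf_factor_def power_divide)
    moreover have "(1 + \<kappa>\<^sup>2) * (\<kappa> * (z \<bullet> \<xi> + \<xi> \<bullet> z)) = \<kappa> * (1 + \<kappa>\<^sup>2)\<^sup>2 * (z \<bullet> \<xi>)"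
      using assms(1) by (auto simp: inner_commute[of \<xi> z])
    ultimately show ?thesis by simp
  qed
  ultimately show ?thesis by (simp add: conf_factor_def[abs_def])
qed

lemma chart_emb_has_derivative:
  assumes "admissible \<kappa> \<epsilon>" "z \<in> chart_range \<kappa>"
  shows "(chart_emb \<kappa> \<epsilon> has_derivative d_chart_emb \<kappa> \<epsilon> z) (at z)"
proof -
  note [derivative_intros] = conf_factor_has_derivative[OF admissible_cases[OF assms(1)] assms(2)]
  show ?thesis
    unfolding chart_emb_def[abs_def] d_chart_emb_def[abs_def]
    by (auto intro!: derivative_eq_intros)
qed

section \<open>Metric and second fundamental form in terms of the embedded map\<close>

text \<open>
The horizontal component of a map into the product, seen in \<open>\<real>\<^sup>3\<close>. In contrast to the charts, which
change from point to point, this is one smooth map.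
\<close>

definition horizontal :: "surface \<Rightarrow> ('a \<Rightarrow> point \<times> real) \<Rightarrow> 'a \<Rightarrow> point" where
  "horizontal M X y = emb M (fst (X y))"

definition height :: "('a \<Rightarrow> point \<times> real) \<Rightarrow> 'a \<Rightarrow> real" where
  "height X y = snd (X y)"

lemma chart_rep:
  assumes "smooth_into M X S" "x \<in> S"
  obtains U z where "open U" "x \<in> U" "U \<subseteq> S" "smooth_on z U" "smooth_on (height X) U"
    "\<And>y. y \<in> U \<Longrightarrow> local_rep M X x y = (z y, height X y)"
    "\<And>y. y \<in> U \<Longrightarrow> z y \<in> chart_range (curv M)"
    "\<And>y. y \<in> U \<Longrightarrow> horizontal M X y = chart_emb (curv M) (pole M (fst (X x))) (z y)"
proof -
  obtain U where U: "open U" "x \<in> U" "U \<subseteq> S" "X ` U \<subseteq> prod_chart_domain M (X x)" "smooth_on (local_rep M X x) U"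
    using assms unfolding smooth_into_def by blast
  define z where "z = (\<lambda>y. chart M (fst (X x)) (fst (X y)))"
  have rep: "local_rep M X x y = (z y, height X y)" for y
    by (simp add: local_rep_def prod_chart_def z_def height_def)
  have p: "fst (X x) \<in> points M" using assms by (auto simp: smooth_into_def prod_points_def)
  have q: "fst (X y) \<in> chart_domain M (fst (X x))" if "y \<in> U" for y
    using U(4) that by (auto simp: prod_chart_domain_def)
  show ?thesis
  proof (rule that[OF U(1-3)])
    show "smooth_on z U" "smooth_on (height X) U"
      using smooth_on_fst[OF U(1,5)] smooth_on_snd[OF U(1,5)] by (simp_all add: rep)
    show "local_rep M X x y = (z y, height X y)" for y by (rule rep)
    show "z y \<in> chart_range (curv M)" "horizontal M X y = chart_emb (curv M) (pole M (fst (X x))) (z y)" if "y \<in> U" for y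
      using emb_chart[OF p q[OF that]] by (simp_all add: z_def horizontal_def)
  qed
qed

lemma smooth_on_horizontal:
  assumes "smooth_into M X S"
  shows "smooth_on (horizontal M X) S"
proof (rule smooth_on_local)
  fix x assume x: "x \<in> S"
  obtain U z where U: "open U" "x \<in> U" "U \<subseteq> S" "smooth_on z U" "smooth_on (height X) U"
    "\<And>y. y \<in> U \<Longrightarrow> local_rep M X x y = (z y, height X y)"
    "\<And>y. y \<in> U \<Longrightarrow> z y \<in> chart_range (curv M)"
    "\<And>y. y \<in> U \<Longrightarrow> horizontal M X y = chart_emb (curv M) (pole M (fst (X x))) (z y)"
    by (rule chart_rep[OF assms x]) (rule that)
  have "smooth_on (\<lambda>y. chart_emb (curv M) (pole M (fst (X x))) (z y)) U"
    by (rule smooth_on_compose[OF U(1) open_chart_range _ smooth_on_chart_emb U(4)]) (use U(7) in auto)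
  then have "smooth_on (horizontal M X) U" by (rule smooth_on_cong[OF U(1)]) (use U(8) in simp)
  then show "\<exists>U. open U \<and> x \<in> U \<and> smooth_on (horizontal M X) U" using U(1,2) by blast
qed

lemma smooth_on_height:
  assumes "smooth_into M X S"
  shows "smooth_on (height X) S"
proof (rule smooth_on_local)
  fix x assume x: "x \<in> S"
  obtain U z where U: "open U" "x \<in> U" "U \<subseteq> S" "smooth_on z U" "smooth_on (height X) U"
    "\<And>y. y \<in> U \<Longrightarrow> local_rep M X x y = (z y, height X y)"
    "\<And>y. y \<in> U \<Longrightarrow> z y \<in> chart_range (curv M)"
    "\<And>y. y \<in> U \<Longrightarrow> horizontal M X y = chart_emb (curv M) (pole M (fst (X x))) (z y)"
    by (rule chart_rep[OF assms x]) (rule that)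
  show "\<exists>U. open U \<and> x \<in> U \<and> smooth_on (height X) U" using U(1,2,5) by blast
qed

lemma horizontal_in_model:
  assumes "smooth_into M X S" "x \<in> S"
  shows "horizontal M X x \<in> model M"
proof -
  have "X x \<in> prod_points M" using assms by (auto simp: smooth_into_def)
  then have "fst (X x) \<in> points M" by (auto simp: prod_points_def)
  then show ?thesis unfolding horizontal_def by (rule emb_in_model)
qed

lemma dd_chart_emb_compose:
  assumes "admissible \<kappa> \<epsilon>" "open U" "smooth_on z U" "x \<in> U" "\<And>y. y \<in> U \<Longrightarrow> z y \<in> chart_range \<kappa>"
    and H: "\<And>y. y \<in> U \<Longrightarrow> H y = chart_emb \<kappa> \<epsilon> (z y)"
  shows "dd v H x = d_chart_emb \<kappa> \<epsilon> (z x) (dd v z x)"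
proof -
  have "dd v H x = dd v (\<lambda>y. chart_emb \<kappa> \<epsilon> (z y)) x" by (rule dd_cong[OF assms(2,4) H])
  also have "\<dots> = d_chart_emb \<kappa> \<epsilon> (z x) (dd v z x)"
    by (rule dd_eqI[OF has_derivative_compose[OF smooth_on_has_derivative[OF assms(3,4)]
            chart_emb_has_derivative[OF assms(1) assms(5)[OF assms(4)]]]])
  finally show ?thesis .
qed

lemma tangent_rep:
  assumes "smooth_on z U" "smooth_on f U" "open U" "x \<in> U" "\<And>y. y \<in> U \<Longrightarrow> local_rep M X x y = (z y, f y)"
  shows "tangent M X x v = (dd v z x, dd v f x)"
proof -
  have "tangent M X x v = dd v (local_rep M X x) x" by (simp add: tangent_def dd_def)
  also have "\<dots> = dd v (\<lambda>y. (z y, f y)) x" by (rule dd_cong[OF assms(3-5)])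
  also have "\<dots> = (dd v z x, dd v f x)"
    by (rule dd_eqI[OF has_derivative_Pair[OF smooth_on_has_derivative[OF assms(1,4)]
            smooth_on_has_derivative[OF assms(2,4)]]])
  finally show ?thesis .
qed

lemma induced_metric_horizontal:
  assumes "smooth_into M X S" "x \<in> S"
  shows "induced_metric M X x v w
    = form (curv M) (dd v (horizontal M X) x) (dd w (horizontal M X) x) + dd v (height X) x * dd w (height X) x"
proof -
  obtain U z where UU: "open U" "x \<in> U" "U \<subseteq> S" "smooth_on z U" "smooth_on (height X) U"
    "\<And>y. y \<in> U \<Longrightarrow> local_rep M X x y = (z y, height X y)"
    "\<And>y. y \<in> U \<Longrightarrow> z y \<in> chart_range (curv M)"
    "\<And>y. y \<in> U \<Longrightarrow> horizontal M X y = chart_emb (curv M) (pole M (fst (X x))) (z y)"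
    by (rule chart_rep[OF assms]) (rule that)
  note U = UU(1,2,4-8)
  have "dd v (horizontal M X) x = d_chart_emb (curv M) (pole M (fst (X x))) (z x) (dd v z x)" for v
    by (rule dd_chart_emb_compose[OF admissible_pole U(1,3,2,6,7)])
  then show ?thesis
    by (simp add: form_d_chart_emb[OF admissible_pole U(6)[OF U(2)]] induced_metric_def tangent_rep[OF U(3,4,1,2,5)] U(5)[OF U(2)] prod_metric_def conf_eq_conf_factor)
qed

text \<open>
Christoffel symbols of a conformal metric: only the derivatives of \<open>\<sigma>\<^sup>2\<close> enter.
\<close>

lemma koszul_formula:
  assumes "fst x \<in> chart_range (curv M)"
  defines "\<sigma> \<equiv> conf_factor (curv M) (fst x)" and "d \<equiv> d_conf_factor (curv M) (fst x)"
  shows "koszul M x \<xi> \<eta> \<zeta> = \<sigma> * (d (fst \<xi>) * (fst \<eta> \<bullet> fst \<zeta>) + d (fst \<eta>) * (fst \<xi> \<bullet> fst \<zeta>) - d (fst \<zeta>) * (fst \<xi> \<bullet> fst \<eta>))"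
proof -
  have k: "curv M = 0 \<or> curv M = 1 \<or> curv M = -1" by (cases M) auto
  have "frechet_derivative (\<lambda>y. prod_metric M y a b) (at x) v = 2 * \<sigma> * d (fst v) * (fst a \<bullet> fst b)" for a b v
  proof -
    have s: "((\<lambda>y. conf_factor (curv M) (fst y)) has_derivative (\<lambda>v. d (fst v))) (at x)"
      unfolding d_def
      by (rule has_derivative_compose[OF has_derivative_fst[OF has_derivative_ident] conf_factor_has_derivative[OF k assms(1)]])
    have "((\<lambda>y. (conf_factor (curv M) (fst y))\<^sup>2 * (fst a \<bullet> fst b) + snd a * snd b) has_derivative
       (\<lambda>v. 2 * \<sigma> * d (fst v) * (fst a \<bullet> fst b))) (at x)"
      by (rule derivative_eq_intros s refl)+ (simp add: \<sigma>_def fun_eq_iff)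
    from dd_eqI[OF this, of v] show ?thesis
      by (simp add: prod_metric_def conf_eq_conf_factor dd_def)
  qed
  then show ?thesis by (simp add: koszul_def field_simps)
qed

text \<open>
The vector on the left is the second derivative of the inverse chart \<open>E\<close> in the directions \<open>\<xi>\<close>, \<open>\<eta>\<close>. Since \<open>E\<close>
is isometric, its product with \<open>E\<^sub>\<zeta>\<close> is a Christoffel symbol of the first kind.
\<close>

lemma form_second_derivative:
  fixes z \<xi> \<eta> \<zeta> :: complex
  assumes "admissible \<kappa> \<epsilon>" "z \<in> chart_range \<kappa>"
  defines "\<sigma> \<equiv> conf_factor \<kappa> z" and "d \<equiv> d_conf_factor \<kappa> z"
  defines "e \<equiv> 2 * \<kappa>\<^sup>2 * \<sigma> ^ 3 * (z \<bullet> \<xi>) * (z \<bullet> \<eta>) - \<kappa> * \<sigma>\<^sup>2 * (\<xi> \<bullet> \<eta>)"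
  shows "form \<kappa> (d \<xi> *\<^sub>R \<eta> + d \<eta> *\<^sub>R \<xi> + e *\<^sub>R z, \<epsilon> * e) (d_chart_emb \<kappa> \<epsilon> z \<zeta>)
    = \<sigma> * (d \<xi> * (\<eta> \<bullet> \<zeta>) + d \<eta> * (\<xi> \<bullet> \<zeta>) - d \<zeta> * (\<xi> \<bullet> \<eta>))"
proof -
  have s: "\<sigma> > 0" using conf_factor_pos[OF assms(2)] by (simp add: \<sigma>_def)
  have "form \<kappa> (d \<xi> *\<^sub>R \<eta> + d \<eta> *\<^sub>R \<xi> + e *\<^sub>R z, \<epsilon> * e) (d_chart_emb \<kappa> \<epsilon> z \<zeta>)
    = \<sigma> * (d \<xi> * (\<eta> \<bullet> \<zeta>) + d \<eta> * (\<xi> \<bullet> \<zeta>)) + \<sigma> * e * (z \<bullet> \<zeta>)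
      + d \<zeta> * (d \<xi> * (z \<bullet> \<eta>) + d \<eta> * (z \<bullet> \<xi>) + e * (z \<bullet> z + \<kappa> * \<epsilon>\<^sup>2))"
    by (simp add: form_def d_chart_emb_def \<sigma>_def[symmetric] d_def[symmetric] inner_add_left inner_add_right
        inner_commute[of \<xi> z] inner_commute[of \<eta> z] power2_eq_square algebra_simps)
  moreover have "\<sigma> * e * (z \<bullet> \<zeta>) + d \<zeta> * (d \<xi> * (z \<bullet> \<eta>) + d \<eta> * (z \<bullet> \<xi>) + e * (z \<bullet> z + \<kappa> * \<epsilon>\<^sup>2))
     = - \<sigma> * d \<zeta> * (\<xi> \<bullet> \<eta>)"
  proof -
    consider "\<kappa> = 0" | "\<kappa> * \<kappa> = 1" "z \<bullet> z + \<kappa> * \<epsilon>\<^sup>2 = 2 * \<kappa> / \<sigma>"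
      using assms(1,2) zz_eq[of z] by (auto simp: admissible_def \<sigma>_def)
    then show ?thesis
    proof cases
      case 1
      then show ?thesis by (simp add: e_def d_def)
    next
      case 2
      define A where "A = z \<bullet> \<xi>"
      define B where "B = z \<bullet> \<eta>"
      define C where "C = z \<bullet> \<zeta>"
      define D where "D = \<xi> \<bullet> \<eta>"
      have e: "e = 2 * \<sigma> ^ 3 * A * B - \<kappa> * \<sigma>\<^sup>2 * D"
        using 2(1) by (simp add: e_def A_def B_def D_def power2_eq_square)
      have dd: "d \<xi> = - \<kappa> * \<sigma>\<^sup>2 * A" "d \<eta> = - \<kappa> * \<sigma>\<^sup>2 * B" "d \<zeta> = - \<kappa> * \<sigma>\<^sup>2 * C"
        by (simp_all add: d_def d_conf_factor_def \<sigma>_def A_def B_def C_def)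
      have "e * (2 * \<kappa> / \<sigma>) = 4 * \<kappa> * \<sigma>\<^sup>2 * A * B - 2 * (\<kappa> * \<kappa>) * \<sigma> * D"
        unfolding e using s by (simp add: field_simps power2_eq_square power3_eq_cube)
      note k = this[unfolded 2(1)]
      have k2: "d \<xi> * B + d \<eta> * A + e * (2 * \<kappa> / \<sigma>) = 2 * \<kappa> * \<sigma>\<^sup>2 * A * B - 2 * \<sigma> * D"
        unfolding k dd by (simp add: algebra_simps)
      have "\<sigma> * e * C + d \<zeta> * (d \<xi> * B + d \<eta> * A + e * (2 * \<kappa> / \<sigma>))
          = \<sigma> * (2 * \<sigma> ^ 3 * A * B - \<kappa> * \<sigma>\<^sup>2 * D) * C - 2 * (\<kappa> * \<kappa>) * \<sigma> ^ 4 * A * B * C + 2 * \<kappa> * \<sigma> ^ 3 * C * D"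
        unfolding k2 dd(3) unfolding e by (simp add: power2_eq_square power3_eq_cube power4_eq_xxxx algebra_simps)
      also have "\<dots> = - \<sigma> * d \<zeta> * D"
        unfolding 2(1) dd(3) by (simp add: power2_eq_square power3_eq_cube power4_eq_xxxx algebra_simps)
      finally show ?thesis unfolding 2(2) A_def B_def C_def D_def .
    qed
  qed
  ultimately show ?thesis by (simp add: algebra_simps)
qed

text \<open>
Since \<open>H = E \<circ> z\<close>, we have \<open>H\<^sub>a\<^sub>b = E\<^sub>z (z\<^sub>a\<^sub>b) + E\<^sub>z\<^sub>z (z\<^sub>a, z\<^sub>b)\<close>. The product of the last term with a tangent vector is the
Koszul term, so the intrinsic second fundamental form is the tangential part of \<open>H\<^sub>a\<^sub>b\<close>, tested
against the normal.
\<close>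

lemma second_form_horizontal:
  assumes "smooth_into M X S" "x \<in> S"
  obtains \<epsilon> z \<zeta> where "admissible (curv M) \<epsilon>" "z \<in> chart_range (curv M)"
    "horizontal M X x = chart_emb (curv M) \<epsilon> z" "local_rep M X x x = (z, height X x)"
    "\<And>v. tangent M X x v = (\<zeta> v, dd v (height X) x)"
    "\<And>v. dd v (horizontal M X) x = d_chart_emb (curv M) \<epsilon> z (\<zeta> v)"
    "\<And>\<nu> a b. second_form M X x \<nu> a b
      = form (curv M) (dd a (dd b (horizontal M X)) x) (d_chart_emb (curv M) \<epsilon> z (fst \<nu>)) + dd a (dd b (height X)) x * snd \<nu>"
proof -
  obtain U z where UU: "open U" "x \<in> U" "U \<subseteq> S" "smooth_on z U" "smooth_on (height X) U"
    "\<And>y. y \<in> U \<Longrightarrow> local_rep M X x y = (z y, height X y)"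
    "\<And>y. y \<in> U \<Longrightarrow> z y \<in> chart_range (curv M)"
    "\<And>y. y \<in> U \<Longrightarrow> horizontal M X y = chart_emb (curv M) (pole M (fst (X x))) (z y)"
    by (rule chart_rep[OF assms]) (rule that)
  note U = UU(1,2,4-8)
  let ?\<kappa> = "curv M"
  define \<epsilon> where "\<epsilon> = pole M (fst (X x))"
  have adm: "admissible ?\<kappa> \<epsilon>" unfolding \<epsilon>_def by (rule admissible_pole)
  have zx: "z x \<in> chart_range ?\<kappa>" using U by blast
  have d1: "dd v (horizontal M X) y = d_chart_emb ?\<kappa> \<epsilon> (z y) (dd v z y)" if "y \<in> U" for v y
    unfolding \<epsilon>_def by (rule dd_chart_emb_compose[OF admissible_pole U(1,3) that U(6,7)])
  have "second_form M X x \<nu> a b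
      = form ?\<kappa> (dd a (dd b (horizontal M X)) x) (d_chart_emb ?\<kappa> \<epsilon> (z x) (fst \<nu>)) + dd a (dd b (height X)) x * snd \<nu>" for \<nu> a b
  proof -
    define \<sigma> where "\<sigma> = conf_factor ?\<kappa> (z x)"
    define d where "d = d_conf_factor ?\<kappa> (z x)"
    define za where "za = dd a z x"
    define zb where "zb = dd b z x"
    define zab where "zab = dd a (dd b z) x"
    define e where "e = 2 * ?\<kappa>\<^sup>2 * \<sigma> ^ 3 * (z x \<bullet> za) * (z x \<bullet> zb) - ?\<kappa> * \<sigma>\<^sup>2 * (za \<bullet> zb)"
    have dz: "(z has_derivative (\<lambda>v. dd v z x)) (at x)" by (rule smooth_on_has_derivative[OF U(3,2)])
    have dzb: "(dd b z has_derivative (\<lambda>v. dd v (dd b z) x)) (at x)"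
      by (rule smooth_on_has_derivative[OF smooth_on_dd[OF U(3)] U(2)])
    have ds: "((\<lambda>y. conf_factor ?\<kappa> (z y)) has_derivative (\<lambda>v. d (dd v z x))) (at x)"
      unfolding d_def
      by (rule has_derivative_compose[OF dz conf_factor_has_derivative[OF admissible_cases[OF adm] zx]])
    have dds: "((\<lambda>y. d_conf_factor ?\<kappa> (z y) (dd b z y)) has_derivative
        (\<lambda>v. - ?\<kappa> * (2 * \<sigma> * d (dd v z x) * (z x \<bullet> zb) + \<sigma>\<^sup>2 * (dd v z x \<bullet> zb + z x \<bullet> dd v (dd b z) x)))) (at x)"
      unfolding d_conf_factor_def
      by (rule derivative_eq_intros ds dz dzb refl)+
        (simp add: fun_eq_iff \<sigma>_def[symmetric] zb_def[symmetric] algebra_simps)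
    have "dd a (dd b (horizontal M X)) x
      = dd a (\<lambda>y. (conf_factor ?\<kappa> (z y) *\<^sub>R dd b z y + d_conf_factor ?\<kappa> (z y) (dd b z y) *\<^sub>R z y, \<epsilon> * d_conf_factor ?\<kappa> (z y) (dd b z y))) x"
      by (rule dd_cong[OF U(1,2)]) (simp add: d1 d_chart_emb_def)
    also have "\<dots> = (\<sigma> *\<^sub>R zab + d za *\<^sub>R zb
        + (d_conf_factor ?\<kappa> (z x) zb *\<^sub>R za
           + (- ?\<kappa> * (2 * \<sigma> * d za * (z x \<bullet> zb) + \<sigma>\<^sup>2 * (za \<bullet> zb + z x \<bullet> zab))) *\<^sub>R z x),
        \<epsilon> * (- ?\<kappa> * (2 * \<sigma> * d za * (z x \<bullet> zb) + \<sigma>\<^sup>2 * (za \<bullet> zb + z x \<bullet> zab))))"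
      unfolding \<sigma>_def za_def zb_def zab_def
      by (rule dd_eqI[OF has_derivative_Pair[OF has_derivative_add[OF has_derivative_scaleR[OF ds dzb]
                has_derivative_scaleR[OF dds dz]] has_derivative_mult_right[OF dds]],
            unfolded \<sigma>_def zb_def])
    also have "- ?\<kappa> * (2 * \<sigma> * d za * (z x \<bullet> zb) + \<sigma>\<^sup>2 * (za \<bullet> zb + z x \<bullet> zab)) = d zab + e"
      by (simp add: d_def d_conf_factor_def e_def \<sigma>_def[symmetric] power2_eq_square power3_eq_cube algebra_simps)
    finally have "dd a (dd b (horizontal M X)) x = d_chart_emb ?\<kappa> \<epsilon> (z x) zab + (d za *\<^sub>R zb + d zb *\<^sub>R za + e *\<^sub>R z x, \<epsilon> * e)"
      by (simp add: d_chart_emb_def d_def \<sigma>_def algebra_simps)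
    then have "form ?\<kappa> (dd a (dd b (horizontal M X)) x) (d_chart_emb ?\<kappa> \<epsilon> (z x) (fst \<nu>))
      = form ?\<kappa> (d_chart_emb ?\<kappa> \<epsilon> (z x) zab) (d_chart_emb ?\<kappa> \<epsilon> (z x) (fst \<nu>))
        + form ?\<kappa> (d za *\<^sub>R zb + d zb *\<^sub>R za + e *\<^sub>R z x, \<epsilon> * e) (d_chart_emb ?\<kappa> \<epsilon> (z x) (fst \<nu>))"
      by (simp add: form_def inner_add_left algebra_simps)
    also have "\<dots> = \<sigma>\<^sup>2 * (zab \<bullet> fst \<nu>)
        + \<sigma> * (d za * (zb \<bullet> fst \<nu>) + d zb * (za \<bullet> fst \<nu>) - d (fst \<nu>) * (za \<bullet> zb))"
      unfolding form_d_chart_emb[OF adm zx] e_def \<sigma>_def d_def form_second_derivative[OF adm zx] ..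
    finally have F: "form ?\<kappa> (dd a (dd b (horizontal M X)) x) (d_chart_emb ?\<kappa> \<epsilon> (z x) (fst \<nu>)) = \<dots>" .
    have r2: "frechet_derivative (\<lambda>y. frechet_derivative (local_rep M X x) (at y) b) (at x) a = (zab, dd a (dd b (height X)) x)"
    proof -
      have "dd a (dd b (local_rep M X x)) x = dd a (\<lambda>y. (dd b z y, dd b (height X) y)) x"
      proof (rule dd_cong[OF U(1,2)])
        fix y assume y: "y \<in> U"
        have "dd b (local_rep M X x) y = dd b (\<lambda>y. (z y, height X y)) y" by (rule dd_cong[OF U(1) y U(5)])
        also have "\<dots> = (dd b z y, dd b (height X) y)"
          by (rule dd_eqI[OF has_derivative_Pair[OF smooth_on_has_derivative[OF U(3) y] smooth_on_has_derivative[OF U(4) y]]])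
        finally show "dd b (local_rep M X x) y = (dd b z y, dd b (height X) y)" .
      qed
      also have "\<dots> = (zab, dd a (dd b (height X)) x)"
        unfolding zab_def
        by (rule dd_eqI[OF has_derivative_Pair[OF dzb smooth_on_has_derivative[OF smooth_on_dd[OF U(4)] U(2)]]])
      finally show ?thesis by (simp add: dd_def[abs_def])
    qed
    have "fst (local_rep M X x x) \<in> chart_range ?\<kappa>" using U(5)[OF U(2)] zx by simp
    from koszul_formula[OF this, of "tangent M X x a" "tangent M X x b" \<nu>]
    show ?thesis
      unfolding second_form_def r2 F
      by (simp add: tangent_rep[OF U(3,4,1,2,5)] U(5)[OF U(2)] prod_metric_def conf_eq_conf_factor
          \<sigma>_def d_def za_def zb_def)
  qed
  with adm zx show ?thesis
    using U(7)[OF U(2)] U(5)[OF U(2)] tangent_rep[OF U(3,4,1,2,5)] d1[OF U(2)]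
    by (intro that[of \<epsilon> "z x" "\<lambda>v. dd v z x"]) (simp_all add: \<epsilon>_def)
qed

section \<open>The equations of a conformal minimal immersion\<close>

lemma dd_form:
  assumes "smooth_on F S" "smooth_on G S" "x \<in> S"
  shows "dd v (\<lambda>x. form \<kappa> (F x) (G x)) x = form \<kappa> (F x) (dd v G x) + form \<kappa> (dd v F x) (G x)"
  by (rule dd_eqI[OF bounded_bilinear.FDERIV[OF bounded_bilinear_form smooth_on_has_derivative[OF assms(1,3)]
          smooth_on_has_derivative[OF assms(2,3)]]])

lemma smooth_on_form:
  assumes "open S" "smooth_on F S" "smooth_on G S"
  shows "smooth_on (\<lambda>x. form \<kappa> (F x) (G x)) S"
  using smooth_on_bilinear[OF assms(1) bounded_bilinear_form assms(2,3)] .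

text \<open>
Differentiate the equation of the quadric.
\<close>

lemma radial_dd:
  assumes S: "open S" and F: "smooth_on F S" "\<And>y. y \<in> S \<Longrightarrow> F y \<in> model M" and x: "x \<in> S"
  shows "radial (curv M) (F x) (dd v F x) = 0"
proof -
  let ?\<kappa> = "curv M"
  have "dd v (\<lambda>y. ?\<kappa> * form ?\<kappa> (F y) (F y) + (1 - ?\<kappa>\<^sup>2) * snd (F y)) x = dd v (\<lambda>_. 1 :: real) x"
    by (rule dd_cong[OF S x]) (use F(2) in \<open>simp add: model_def radial_def\<close>)
  moreover have "dd v (\<lambda>y. ?\<kappa> * form ?\<kappa> (F y) (F y) + (1 - ?\<kappa>\<^sup>2) * snd (F y)) x
      = ?\<kappa> * (form ?\<kappa> (F x) (dd v F x) + form ?\<kappa> (dd v F x) (F x)) + (1 - ?\<kappa>\<^sup>2) * snd (dd v F x)"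
    using smooth_on_has_derivative[OF F(1) x]
    by (intro dd_eqI has_derivative_add has_derivative_mult_right has_derivative_snd
        bounded_bilinear.FDERIV[OF bounded_bilinear_form])
  ultimately have "2 * ?\<kappa> * form ?\<kappa> (F x) (dd v F x) + (1 - ?\<kappa>\<^sup>2) * snd (dd v F x) = 0"
    by (simp add: dd_const form_commute[of _ "dd v F x"])
  then show ?thesis using curv_cases[of M] by (auto simp: radial_def)
qed

text \<open>
Differentiate once more: the radial part of a second derivative is determined by the first derivatives.
\<close>

lemma radial_dd_dd:
  assumes S: "open S" and F: "smooth_on F S" "\<And>y. y \<in> S \<Longrightarrow> F y \<in> model M" and x: "x \<in> S"
  shows "radial (curv M) (F x) (dd a (dd b F) x) = - curv M * form (curv M) (dd a F x) (dd b F x)"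
proof -
  let ?\<kappa> = "curv M"
  have "dd a (\<lambda>y. ?\<kappa> * form ?\<kappa> (F y) (dd b F y) + (1 - ?\<kappa>\<^sup>2) * snd (dd b F y)) x = dd a (\<lambda>_. 0 :: real) x"
    by (rule dd_cong[OF S x]) (use radial_dd[OF S F] in \<open>simp add: radial_def\<close>)
  moreover have "dd a (\<lambda>y. ?\<kappa> * form ?\<kappa> (F y) (dd b F y) + (1 - ?\<kappa>\<^sup>2) * snd (dd b F y)) x
      = ?\<kappa> * (form ?\<kappa> (F x) (dd a (dd b F) x) + form ?\<kappa> (dd a F x) (dd b F x)) + (1 - ?\<kappa>\<^sup>2) * snd (dd a (dd b F) x)"
    using smooth_on_has_derivative[OF F(1) x] smooth_on_has_derivative[OF smooth_on_dd[OF F(1)] x]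
    by (intro dd_eqI has_derivative_add has_derivative_mult_right has_derivative_snd
        bounded_bilinear.FDERIV[OF bounded_bilinear_form])
  ultimately show ?thesis by (simp add: dd_const radial_def algebra_simps)
qed

text \<open>
\<open>Q(h)\<close> is the \<open>(2, 0)\<close>-part of the pulled-back metric: \<open>4 Q = G\<^sub>u\<^sub>u - G\<^sub>v\<^sub>v - 2 \<i> G\<^sub>u\<^sub>v\<close>.
\<close>

lemma hopf_horizontal:
  assumes "smooth_into M X \<Omega>" "w \<in> \<Omega>" "X = (\<lambda>w. (h w, f w))"
  shows "hopf M h w = Complex ((form (curv M) (dd 1 (horizontal M X) w) (dd 1 (horizontal M X) w)
      - form (curv M) (dd \<i> (horizontal M X) w) (dd \<i> (horizontal M X) w)) / 4)
    (- form (curv M) (dd 1 (horizontal M X) w) (dd \<i> (horizontal M X) w) / 2)"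
proof -
  obtain U z where U: "open U" "w \<in> U" "U \<subseteq> \<Omega>" "smooth_on z U" "smooth_on (height X) U"
    "\<And>y. y \<in> U \<Longrightarrow> local_rep M X w y = (z y, height X y)"
    "\<And>y. y \<in> U \<Longrightarrow> z y \<in> chart_range (curv M)"
    "\<And>y. y \<in> U \<Longrightarrow> horizontal M X y = chart_emb (curv M) (pole M (fst (X w))) (z y)"
    by (rule chart_rep[OF assms(1,2)]) (rule that)
  have zy: "chart M (h w) (h y) = z y" if "y \<in> U" for y
    using U(6)[OF that] by (simp add: local_rep_def prod_chart_def assms(3))
  have d1: "frechet_derivative (\<lambda>y. chart M (h w) (h y)) (at w) v = dd v z w" for v
    using dd_cong[OF U(1,2), of "\<lambda>y. chart M (h w) (h y)" z v] zy by (simp add: dd_def)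
  have d2: "frechet_derivative (\<lambda>y. cnj (chart M (h w) (h y))) (at w) v = cnj (dd v z w)" for v
  proof -
    have "dd v (\<lambda>y. cnj (chart M (h w) (h y))) w = dd v (\<lambda>y. cnj (z y)) w"
      by (rule dd_cong[OF U(1,2)]) (simp add: zy)
    also have "\<dots> = cnj (dd v z w)" by (rule dd_linear_compose[OF bounded_linear_cnj U(4,2)])
    finally show ?thesis by (simp add: dd_def)
  qed
  have L: "dd v (horizontal M X) w = d_chart_emb (curv M) (pole M (fst (X w))) (z w) (dd v z w)" for v
    by (rule dd_chart_emb_compose[OF admissible_pole U(1,4,2,7,8)])
  show ?thesis
    unfolding hopf_def Let_def d_w_def d1 d2 zy[OF U(2)] L form_d_chart_emb[OF admissible_pole U(7)[OF U(2)]] conf_eq_conf_factor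
    by (simp add: complex_eq_iff inner_complex_def power2_eq_square field_simps)
qed

text \<open>
The tension field \<open>(\<Delta>H, \<Delta>f)\<close> is orthogonal to the surface because the parametrisation is conformal, and
its tangential part in \<open>\<M> \<times> \<real>\<close> is orthogonal to every unit normal because the mean curvature
vanishes. Hence this part is zero, and the radial part of \<open>\<Delta>H\<close> is known from \<open>radial_dd_dd\<close>.
\<close>

lemma conformal_minimal_equations:
  assumes \<Omega>: "open \<Omega>" and X: "conformal_minimal_immersion M \<Omega> X" and x: "x \<in> \<Omega>"
  defines "H \<equiv> horizontal M X" and "f \<equiv> height X" and "\<kappa> \<equiv> curv M"
  shows "0 < form \<kappa> (dd 1 H x) (dd 1 H x) + (dd 1 f x)\<^sup>2"
    and "form \<kappa> (dd 1 H x) (dd 1 H x) + (dd 1 f x)\<^sup>2 = form \<kappa> (dd \<i> H x) (dd \<i> H x) + (dd \<i> f x)\<^sup>2"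
    and "form \<kappa> (dd 1 H x) (dd \<i> H x) + dd 1 f x * dd \<i> f x = 0"
    and "dd 1 (dd 1 f) x + dd \<i> (dd \<i> f) x = 0"
    and "dd 1 (dd 1 H) x + dd \<i> (dd \<i> H) x
      = (- \<kappa> * (form \<kappa> (dd 1 H x) (dd 1 H x) + form \<kappa> (dd \<i> H x) (dd \<i> H x))) *\<^sub>R H x"
proof -
  have sm: "smooth_into M X \<Omega>" and conf: "conformal_on M \<Omega> X" and min: "minimal_on M \<Omega> X"
    using X by (auto simp: conformal_minimal_immersion_def immersion_on_def)
  have H: "smooth_on H \<Omega>" and f: "smooth_on f \<Omega>" and Hm: "\<And>y. y \<in> \<Omega> \<Longrightarrow> H y \<in> model M"
    unfolding H_def f_def using smooth_on_horizontal smooth_on_height horizontal_in_model sm by auto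
  have I: "induced_metric M X y a b = form \<kappa> (dd a H y) (dd b H y) + dd a f y * dd b f y" if "y \<in> \<Omega>" for y a b
    unfolding H_def f_def \<kappa>_def by (rule induced_metric_horizontal[OF sm that])
  have c: "\<exists>c>0. form \<kappa> (dd 1 H y) (dd 1 H y) + dd 1 f y * dd 1 f y = c
      \<and> form \<kappa> (dd \<i> H y) (dd \<i> H y) + dd \<i> f y * dd \<i> f y = c
      \<and> form \<kappa> (dd 1 H y) (dd \<i> H y) + dd 1 f y * dd \<i> f y = 0" if y: "y \<in> \<Omega>" for y
  proof -
    obtain c where c: "c > 0" "\<And>a b. induced_metric M X y a b = c * (a \<bullet> b)"
      using conf y unfolding conformal_on_def by blast
    show ?thesis using c(1) c(2)[of 1 1] c(2)[of \<i> \<i>] c(2)[of 1 \<i>] unfolding I[OF y] by auto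
  qed
  obtain c where cx: "0 < c" "form \<kappa> (dd 1 H x) (dd 1 H x) + dd 1 f x * dd 1 f x = c"
    "form \<kappa> (dd \<i> H x) (dd \<i> H x) + dd \<i> f x * dd \<i> f x = c"
    "form \<kappa> (dd 1 H x) (dd \<i> H x) + dd 1 f x * dd \<i> f x = 0"
    using c[OF x] by blast
  show "0 < form \<kappa> (dd 1 H x) (dd 1 H x) + (dd 1 f x)\<^sup>2"
    "form \<kappa> (dd 1 H x) (dd 1 H x) + (dd 1 f x)\<^sup>2 = form \<kappa> (dd \<i> H x) (dd \<i> H x) + (dd \<i> f x)\<^sup>2"
    "form \<kappa> (dd 1 H x) (dd \<i> H x) + dd 1 f x * dd \<i> f x = 0"
    using cx by (simp_all add: power2_eq_square)
  define L where "L = dd 1 (dd 1 H) x + dd \<i> (dd \<i> H) x"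
  define l where "l = dd 1 (dd 1 f) x + dd \<i> (dd \<i> f) x"
  \<comment> \<open>\<open>\<langle>X\<^sub>u\<^sub>u + X\<^sub>v\<^sub>v, X\<^sub>a\<rangle> = 0\<close>, by differentiating \<open>|X\<^sub>u|\<^sup>2 = |X\<^sub>v|\<^sup>2\<close> and \<open>\<langle>X\<^sub>u, X\<^sub>v\<rangle> = 0\<close>\<close>
  have der: "dd v (\<lambda>y. form \<kappa> (dd a H y) (dd b H y) + dd a f y * dd b f y) x
     = form \<kappa> (dd a H x) (dd v (dd b H) x) + form \<kappa> (dd v (dd a H) x) (dd b H x)
       + (dd a f x * dd v (dd b f) x + dd v (dd a f) x * dd b f x)" for v a b
  proof -
    note H' = smooth_on_dd[OF H] and f' = smooth_on_dd[OF f]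
    have "dd v (\<lambda>y. form \<kappa> (dd a H y) (dd b H y) + dd a f y * dd b f y) x
      = dd v (\<lambda>y. form \<kappa> (dd a H y) (dd b H y)) x + dd v (\<lambda>y. dd a f y * dd b f y) x"
      by (rule dd_add[OF smooth_on_form[OF \<Omega> H' H'] smooth_on_mult[OF \<Omega> f' f'] x])
    then show ?thesis unfolding dd_form[OF H' H' x] dd_mult[OF f' f' x] .
  qed
  have t1: "dd v (\<lambda>y. form \<kappa> (dd 1 H y) (dd 1 H y) + dd 1 f y * dd 1 f y) x
      = dd v (\<lambda>y. form \<kappa> (dd \<i> H y) (dd \<i> H y) + dd \<i> f y * dd \<i> f y) x" for v
    by (rule dd_cong[OF \<Omega> x]) (use c in force)
  have t2: "dd v (\<lambda>y. form \<kappa> (dd 1 H y) (dd \<i> H y) + dd 1 f y * dd \<i> f y) x = dd v (\<lambda>y. 0) x" for v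
    by (rule dd_cong[OF \<Omega> x]) (use c in force)
  have sH: "dd \<i> (dd 1 H) x = dd 1 (dd \<i> H) x" and sf: "dd \<i> (dd 1 f) x = dd 1 (dd \<i> f) x"
    using smooth_on_dd_commute[OF \<Omega> H x] smooth_on_dd_commute[OF \<Omega> f x] by auto
  have tang: "form \<kappa> L (dd a H x) + l * dd a f x = 0" if "a = 1 \<or> a = \<i>" for a
    using that t1[of 1] t2[of \<i>] t1[of \<i>] t2[of 1] unfolding der dd_const sH sf L_def l_def
    by (auto simp: form_simps form_commute[of _ "dd 1 H x"] form_commute[of _ "dd \<i> H x"] algebra_simps)
  obtain \<epsilon> z \<zeta> where e: "admissible \<kappa> \<epsilon>" "z \<in> chart_range \<kappa>" "H x = chart_emb \<kappa> \<epsilon> z"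
    and lr: "local_rep M X x x = (z, f x)"
    and tg: "\<And>v. tangent M X x v = (\<zeta> v, dd v f x)"
    and Ht: "\<And>v. dd v H x = d_chart_emb \<kappa> \<epsilon> z (\<zeta> v)"
    and sf2: "\<And>\<nu> a b. second_form M X x \<nu> a b
      = form \<kappa> (dd a (dd b H) x) (d_chart_emb \<kappa> \<epsilon> z (fst \<nu>)) + dd a (dd b f) x * snd \<nu>"
    by (rule second_form_horizontal[OF sm x, folded H_def f_def \<kappa>_def]) (rule that)
  note lin = bounded_linear_d_chart_emb[THEN bounded_linear.linear, of \<kappa> \<epsilon> z]
  define s where "s = conf_factor \<kappa> z"
  have s: "s > 0" unfolding s_def by (rule conf_factor_pos[OF e(2)])
  have normal: "form \<kappa> L (d_chart_emb \<kappa> \<epsilon> z (fst \<nu>)) + l * snd \<nu> = 0" if "unit_normal M X x \<nu>" for \<nu>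
  proof -
    have "mean_curvature M X x \<nu> = 0" using min x that unfolding minimal_on_def by blast
    moreover have "induced_metric M X x 1 1 = c" "induced_metric M X x \<i> \<i> = c" "induced_metric M X x 1 \<i> = 0"
      unfolding I[OF x] using cx by simp_all
    ultimately have "c * (second_form M X x \<nu> \<i> \<i> + second_form M X x \<nu> 1 1) / (2 * (c * c)) = 0"
      unfolding mean_curvature_def Let_def by (simp add: distrib_left)
    then have "second_form M X x \<nu> \<i> \<i> + second_form M X x \<nu> 1 1 = 0" using cx(1) by simp
    then show ?thesis unfolding sf2 L_def l_def by (simp add: form_simps algebra_simps)
  qed
  \<comment> \<open>\<open>(\<zeta>0, l)\<close> represents the tension field in the chart. By \<open>tang\<close> it is normal, so if it were not zero, it
    could be normalised and tested against itself.\<close>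
  define \<zeta>0 where "\<zeta>0 = Complex (form \<kappa> L (d_chart_emb \<kappa> \<epsilon> z 1) / s\<^sup>2) (form \<kappa> L (d_chart_emb \<kappa> \<epsilon> z \<i>) / s\<^sup>2)"
  have rep: "s\<^sup>2 * (\<zeta>0 \<bullet> \<xi>) = form \<kappa> L (d_chart_emb \<kappa> \<epsilon> z \<xi>)" for \<xi>
  proof -
    have "\<xi> = Re \<xi> *\<^sub>R 1 + Im \<xi> *\<^sub>R \<i>" by (simp add: complex_eq_iff)
    then have "d_chart_emb \<kappa> \<epsilon> z \<xi> = Re \<xi> *\<^sub>R d_chart_emb \<kappa> \<epsilon> z 1 + Im \<xi> *\<^sub>R d_chart_emb \<kappa> \<epsilon> z \<i>"
      by (metis linear_add[OF lin] linear_scale[OF lin])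
    then show ?thesis using s by (simp add: form_simps \<zeta>0_def inner_complex_def field_simps)
  qed
  have pm: "prod_metric M (z, t) (\<zeta>0, l) \<nu> = form \<kappa> L (d_chart_emb \<kappa> \<epsilon> z (fst \<nu>)) + l * snd \<nu>" for t \<nu>
    by (simp add: prod_metric_def conf_eq_conf_factor \<kappa>_def[symmetric] s_def[symmetric] rep)
  define N where "N = prod_metric M (z, f x) (\<zeta>0, l) (\<zeta>0, l)"
  have N: "N = s\<^sup>2 * (\<zeta>0 \<bullet> \<zeta>0) + l * l"
    by (simp add: N_def prod_metric_def conf_eq_conf_factor \<kappa>_def[symmetric] s_def[symmetric])
  have "N = 0"
  proof (rule ccontr)
    assume "N \<noteq> 0"
    moreover have "0 \<le> N" unfolding N by simp
    ultimately have Np: "N > 0" by simp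
    define \<nu> where "\<nu> = (1 / sqrt N) *\<^sub>R (\<zeta>0, l)"
    have sc: "prod_metric M y u (r *\<^sub>R v) = r * prod_metric M y u v"
      "prod_metric M y (r *\<^sub>R u) v = r * prod_metric M y u v" for y u v r
      by (simp_all add: prod_metric_def algebra_simps)
    have cm: "prod_metric M y u v = prod_metric M y v u" for y u v
      by (simp add: prod_metric_def inner_commute mult.commute)
    have "unit_normal M X x \<nu>"
      unfolding unit_normal_def lr tg
    proof (intro conjI allI)
      show "prod_metric M (z, f x) \<nu> \<nu> = 1"
        using Np unfolding \<nu>_def sc N_def[symmetric] by simp
      fix a :: complex
      have "prod_metric M (z, f x) (\<zeta>0, l) (\<zeta> a, dd a f x) = form \<kappa> L (dd a H x) + l * dd a f x"
        unfolding pm by (simp add: Ht)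
      also have "\<dots> = Re a * (form \<kappa> L (dd 1 H x) + l * dd 1 f x) + Im a * (form \<kappa> L (dd \<i> H x) + l * dd \<i> f x)"
        unfolding dd_complex_expand[OF H x, of a] dd_complex_expand[OF f x, of a] by (simp add: form_simps algebra_simps)
      also have "\<dots> = 0" using tang by simp
      finally show "prod_metric M (z, f x) (\<zeta> a, dd a f x) \<nu> = 0"
        unfolding \<nu>_def sc by (simp add: cm[of _ "(\<zeta> a, dd a f x)"])
    qed
    from normal[OF this] have "prod_metric M (z, f x) (\<zeta>0, l) \<nu> = 0" unfolding pm .
    then have "N / sqrt N = 0" unfolding \<nu>_def sc N_def[symmetric] by simp
    then show False using Np by simp
  qed
  then have z0: "\<zeta>0 = 0" and l0: "l = 0"
    using s unfolding N by (simp_all add: add_nonneg_eq_0_iff)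
  show "dd 1 (dd 1 f) x + dd \<i> (dd \<i> f) x = 0" using l0 by (simp add: l_def)
  \<comment> \<open>\<open>Z\<close> is tangent and orthogonal to all tangent vectors\<close>
  define tr where "tr = form \<kappa> (dd 1 H x) (dd 1 H x) + form \<kappa> (dd \<i> H x) (dd \<i> H x)"
  define Z where "Z = L + (\<kappa> * tr) *\<^sub>R H x"
  have k: "\<kappa> = 0 \<or> \<kappa> = 1 \<or> \<kappa> = -1" unfolding \<kappa>_def by (rule curv_cases)
  have HT: "\<kappa> * form \<kappa> (H x) (d_chart_emb \<kappa> \<epsilon> z \<xi>) = 0" for \<xi>
    using radial_d_chart_emb[OF e(1,2), of \<xi>] k unfolding e(3) by (auto simp: radial_def)
  have ZT: "form \<kappa> Z (d_chart_emb \<kappa> \<epsilon> z \<xi>) = 0" for \<xi>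
    using rep[of \<xi>] HT[of \<xi>] z0 by (auto simp: Z_def form_simps)
  have "radial \<kappa> (H x) (H x) = 1" using Hm[OF x] by (simp add: model_def \<kappa>_def)
  moreover have "radial \<kappa> (H x) L = - \<kappa> * tr"
    unfolding L_def radial_simps tr_def
    using radial_dd_dd[OF \<Omega> H Hm x, folded \<kappa>_def] by (simp add: algebra_simps)
  ultimately have Zr: "radial \<kappa> (H x) Z = 0" by (simp add: Z_def radial_simps)
  then obtain \<xi> where "Z = d_chart_emb \<kappa> \<epsilon> z \<xi>" using tangent_is_d_chart_emb[OF e(1,2)] e(3) by metis
  then have "form \<kappa> Z Z = 0" using ZT by simp
  then have "Z = 0" using tangent_form_pos[OF Hm[OF x], folded \<kappa>_def, OF Zr] by fastforce
  then show "dd 1 (dd 1 H) x + dd \<i> (dd \<i> H) x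
      = (- \<kappa> * (form \<kappa> (dd 1 H x) (dd 1 H x) + form \<kappa> (dd \<i> H x) (dd \<i> H x))) *\<^sub>R H x"
    unfolding Z_def L_def tr_def by (simp add: add_eq_0_iff2 add_eq_0_iff)
qed

section \<open>Linear isometries of the quadrics\<close>

text \<open>
The tangent plane is two-dimensional, and a nonzero Gram determinant makes \<open>v1\<close>, \<open>v2\<close> a basis of it.
\<close>

lemma tangent_nondegenerate:
  assumes P: "P \<in> model M" "radial (curv M) P v1 = 0" "radial (curv M) P v2 = 0" "radial (curv M) P w = 0"
    and det: "form (curv M) v1 v1 * form (curv M) v2 v2 \<noteq> (form (curv M) v1 v2)\<^sup>2"
    and w: "form (curv M) w v1 = 0" "form (curv M) w v2 = 0"
  shows "w = 0"
proof -
  obtain \<epsilon> z where e: "admissible (curv M) \<epsilon>" "z \<in> chart_range (curv M)" "P = chart_emb (curv M) \<epsilon> z"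
    by (rule model_chart_emb[OF P(1)])
  obtain \<xi>1 \<xi>2 \<rho> where x: "v1 = d_chart_emb (curv M) \<epsilon> z \<xi>1" "v2 = d_chart_emb (curv M) \<epsilon> z \<xi>2" "w = d_chart_emb (curv M) \<epsilon> z \<rho>"
    using tangent_is_d_chart_emb[OF e(1,2)] P(2-4) unfolding e(3) by metis
  define s where "s = conf_factor (curv M) z"
  have s: "s > 0" unfolding s_def by (rule conf_factor_pos[OF e(2)])
  have i: "\<xi>1 \<bullet> \<rho> = 0" "\<xi>2 \<bullet> \<rho> = 0"
    using w s unfolding x form_d_chart_emb[OF e(1,2)] by (auto simp: s_def[symmetric] inner_commute)
  have d: "Re \<xi>1 * Im \<xi>2 - Im \<xi>1 * Re \<xi>2 \<noteq> 0"
  proof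
    assume 0: "Re \<xi>1 * Im \<xi>2 - Im \<xi>1 * Re \<xi>2 = 0"
    have "(\<xi>1 \<bullet> \<xi>1) * (\<xi>2 \<bullet> \<xi>2) - (\<xi>1 \<bullet> \<xi>2)\<^sup>2 = (Re \<xi>1 * Im \<xi>2 - Im \<xi>1 * Re \<xi>2)\<^sup>2"
      by (simp add: inner_complex_def power2_eq_square algebra_simps)
    then have g: "(\<xi>1 \<bullet> \<xi>1) * (\<xi>2 \<bullet> \<xi>2) = (\<xi>1 \<bullet> \<xi>2)\<^sup>2" using 0 by simp
    have "form (curv M) v1 v1 * form (curv M) v2 v2 = (s\<^sup>2)\<^sup>2 * ((\<xi>1 \<bullet> \<xi>1) * (\<xi>2 \<bullet> \<xi>2))"
      unfolding x form_d_chart_emb[OF e(1,2)] by (simp add: s_def power2_eq_square)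
    also have "\<dots> = (form (curv M) v1 v2)\<^sup>2"
      unfolding g x form_d_chart_emb[OF e(1,2)] by (simp add: s_def power_mult_distrib)
    finally show False using det by simp
  qed
  have "(Re \<xi>1 * Im \<xi>2 - Im \<xi>1 * Re \<xi>2) * Re \<rho> = Im \<xi>2 * (\<xi>1 \<bullet> \<rho>) - Im \<xi>1 * (\<xi>2 \<bullet> \<rho>)"
    "(Re \<xi>1 * Im \<xi>2 - Im \<xi>1 * Re \<xi>2) * Im \<rho> = Re \<xi>1 * (\<xi>2 \<bullet> \<rho>) - Re \<xi>2 * (\<xi>1 \<bullet> \<rho>)"
    by (simp_all add: inner_complex_def algebra_simps)
  then have "Re \<rho> = 0" "Im \<rho> = 0" using d i by simp_all
  then have "\<rho> = 0" by (simp add: complex_eq_iff)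
  then show ?thesis unfolding x using d_chart_emb_eq_0_iff[OF e(1,2)] by simp
qed

definition frame :: "surface \<Rightarrow> point \<Rightarrow> point \<Rightarrow> point \<Rightarrow> bool" where
  "frame M P v1 v2 \<longleftrightarrow> P \<in> model M \<and> radial (curv M) P v1 = 0 \<and> radial (curv M) P v2 = 0 \<and>
     form (curv M) v1 v1 * form (curv M) v2 v2 \<noteq> (form (curv M) v1 v2)\<^sup>2"

text \<open>
The coefficient of \<open>P\<close> is the radial part; the others solve the \<open>2 \<times> 2\<close> Gram system.
\<close>

lemma frame_coordinates:
  assumes F: "frame M P v1 v2"
  obtains c0 c1 c2 :: "point \<Rightarrow> real" where "linear c0" "linear c1" "linear c2"
    "\<And>x. x = c0 x *\<^sub>R P + c1 x *\<^sub>R v1 + c2 x *\<^sub>R v2"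
    "c0 P = 1" "c1 P = 0" "c2 P = 0" "c0 v1 = 0" "c1 v1 = 1" "c2 v1 = 0" "c0 v2 = 0" "c1 v2 = 0" "c2 v2 = 1"
    "c0 = radial (curv M) P"
proof -
  let ?\<kappa> = "curv M"
  define a where "a = form ?\<kappa> v1 v1"
  define b where "b = form ?\<kappa> v1 v2"
  define c where "c = form ?\<kappa> v2 v2"
  define d where "d = a * c - b * b"
  have P: "P \<in> model M" "radial ?\<kappa> P v1 = 0" "radial ?\<kappa> P v2 = 0" and d: "d \<noteq> 0"
    using F by (auto simp: frame_def d_def a_def b_def c_def power2_eq_square)
  have PP: "radial ?\<kappa> P P = 1" using P(1) by (simp add: model_def)
  define T where "T x = x - radial ?\<kappa> P x *\<^sub>R P" for x
  define c1 where "c1 x = (form ?\<kappa> (T x) v1 * c - form ?\<kappa> (T x) v2 * b) / d" for x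
  define c2 where "c2 x = (form ?\<kappa> (T x) v2 * a - form ?\<kappa> (T x) v1 * b) / d" for x
  have T: "T (x + y) = T x + T y" "T (r *\<^sub>R x) = r *\<^sub>R T x" for x y r
    by (simp_all add: T_def radial_simps algebra_simps)
  have l: "linear c1" "linear c2"
    by (rule linearI; simp add: c1_def c2_def T form_simps add_divide_distrib diff_divide_distrib algebra_simps)+
  have v: "T v1 = v1" "T v2 = v2" "T P = 0" using P PP by (simp_all add: T_def)
  have vals: "c1 P = 0" "c2 P = 0" "c1 v1 = 1" "c2 v1 = 0" "c1 v2 = 0" "c2 v2 = 1"
    using d by (simp_all add: c1_def c2_def v form_simps a_def[symmetric] b_def[symmetric] c_def[symmetric]
        form_commute[of _ v2 v1] d_def mult.commute)
  have ex: "x = radial ?\<kappa> P x *\<^sub>R P + c1 x *\<^sub>R v1 + c2 x *\<^sub>R v2" for x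
  proof -
    define w where "w = T x - (c1 x *\<^sub>R v1 + c2 x *\<^sub>R v2)"
    define p where "p = form ?\<kappa> (T x) v1"
    define q where "q = form ?\<kappa> (T x) v2"
    have cc: "c1 x * d = p * c - q * b" "c2 x * d = q * a - p * b" using d by (simp_all add: c1_def c2_def p_def q_def)
    have "d * form ?\<kappa> w v1 = d * p - ((c1 x * d) * a + (c2 x * d) * b)"
      by (simp add: w_def form_simps p_def a_def b_def form_commute[of _ v2 v1] algebra_simps)
    also have "\<dots> = 0" unfolding cc by (simp add: d_def algebra_simps)
    finally have w1: "form ?\<kappa> w v1 = 0" using d by simp
    have "d * form ?\<kappa> w v2 = d * q - ((c1 x * d) * b + (c2 x * d) * c)"
      by (simp add: w_def form_simps q_def c_def b_def algebra_simps)
    also have "\<dots> = 0" unfolding cc by (simp add: d_def algebra_simps)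
    finally have w2: "form ?\<kappa> w v2 = 0" using d by simp
    have "radial ?\<kappa> P w = 0" using P PP by (simp add: w_def T_def radial_simps)
    then have "w = 0" using tangent_nondegenerate[OF P] w1 w2 F by (simp add: frame_def)
    then show ?thesis by (simp add: w_def T_def algebra_simps)
  qed
  show ?thesis
    by (rule that[OF linear_radial l ex PP vals(1,2) P(2) vals(3,4) P(3) vals(5,6) refl])
qed

lemma frame_linear_eq:
  fixes A B :: "point \<Rightarrow> point"
  assumes "frame M P v1 v2" "linear A" "linear B" "A P = B P" "A v1 = B v1" "A v2 = B v2"
  shows "A x = B x"
proof -
  obtain c0 c1 c2 where ex: "\<And>x. x = c0 x *\<^sub>R P + c1 x *\<^sub>R v1 + c2 x *\<^sub>R v2"
    by (rule frame_coordinates[OF assms(1)]) (rule that)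
  have "L x = c0 x *\<^sub>R L P + c1 x *\<^sub>R L v1 + c2 x *\<^sub>R L v2" if "linear L" for L :: "point \<Rightarrow> point"
  proof -
    have "L (c0 x *\<^sub>R P + c1 x *\<^sub>R v1 + c2 x *\<^sub>R v2) = c0 x *\<^sub>R L P + c1 x *\<^sub>R L v1 + c2 x *\<^sub>R L v2"
      by (simp add: linear_add[OF that] linear_scale[OF that])
    then show ?thesis using ex[of x] by simp
  qed
  from this[OF assms(2)] this[OF assms(3)] show ?thesis using assms(4-6) by simp
qed

text \<open>
Preservation of the form is required on tangent vectors only: in the flat case a linear map that
induces a translation of the plane at height 1 does not preserve the degenerate form on \<open>\<real>\<^sup>3\<close>.
\<close>

definition model_isometry :: "surface \<Rightarrow> (point \<Rightarrow> point) \<Rightarrow> bool" where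
  "model_isometry M A \<longleftrightarrow> linear A \<and> (\<forall>P\<in>model M. A P \<in> model M \<and>
     (\<forall>v w. radial (curv M) P v = 0 \<longrightarrow> radial (curv M) P w = 0 \<longrightarrow> form (curv M) (A v) (A w) = form (curv M) v w))"

text \<open>
Two unit timelike vectors lie on the same sheet iff their product is negative; this is the reversed
Cauchy-Schwarz inequality. It keeps a Lorentz transformation that maps one point of the upper
sheet into it from exchanging the sheets.
\<close>

lemma hyperboloid_sheet:
  assumes "form (-1) x x = -1" "form (-1) y y = -1" "0 < snd y"
  shows "form (-1) x y < 0 \<longleftrightarrow> 0 < snd x"
proof -
  have n: "(norm (fst x))\<^sup>2 = (snd x)\<^sup>2 - 1" "(norm (fst y))\<^sup>2 = (snd y)\<^sup>2 - 1"
  proof -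
    have "fst x \<bullet> fst x = snd x * snd x - 1" "fst y \<bullet> fst y = snd y * snd y - 1"
      using assms(1,2) unfolding form_def by linarith+
    then show "(norm (fst x))\<^sup>2 = (snd x)\<^sup>2 - 1" "(norm (fst y))\<^sup>2 = (snd y)\<^sup>2 - 1"
      by (simp_all only: power2_norm_eq_inner power2_eq_square[of "snd _"])
  qed
  have "norm (fst x) < \<bar>snd x\<bar>" "norm (fst y) < \<bar>snd y\<bar>"
    by (rule power2_less_imp_less; simp add: n)+
  then have "norm (fst x) * norm (fst y) < \<bar>snd x\<bar> * \<bar>snd y\<bar>"
    by (intro mult_strict_mono') auto
  then have "\<bar>fst x \<bullet> fst y\<bar> < \<bar>snd x\<bar> * snd y"
    using Cauchy_Schwarz_ineq2[of "fst x" "fst y"] assms(3) by simp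
  moreover have "snd x \<noteq> 0" using \<open>norm (fst x) < \<bar>snd x\<bar>\<close> norm_ge_zero[of "fst x"] by auto
  ultimately show ?thesis
    unfolding form_def using assms(3) by (cases "0 < snd x") (auto simp: abs_if mult_less_0_iff split: if_splits)
qed

text \<open>
The linear map between the frames. For \<open>\<kappa> \<noteq> 0\<close> the frames have the same Gram matrix in \<open>\<real>\<^sup>3\<close>, so the form is
preserved, and with it the quadric. For \<open>\<kappa> = 0\<close> the map preserves the third coordinate.
\<close>

lemma exists_model_isometry:
  assumes F: "frame M P v1 v2" and F': "frame M P' v1' v2'"
    and G: "form (curv M) v1 v1 = form (curv M) v1' v1'" "form (curv M) v1 v2 = form (curv M) v1' v2'"
      "form (curv M) v2 v2 = form (curv M) v2' v2'"
  shows "\<exists>A. model_isometry M A \<and> A P = P' \<and> A v1 = v1' \<and> A v2 = v2'"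
proof -
  let ?\<kappa> = "curv M"
  obtain c0 c1 c2 where l: "linear c0" "linear c1" "linear c2"
    and ex: "\<And>x. x = c0 x *\<^sub>R P + c1 x *\<^sub>R v1 + c2 x *\<^sub>R v2"
    and vals: "c0 P = 1" "c1 P = 0" "c2 P = 0" "c0 v1 = 0" "c1 v1 = 1" "c2 v1 = 0" "c0 v2 = 0" "c1 v2 = 0" "c2 v2 = 1"
    and c0: "c0 = radial ?\<kappa> P"
    by (rule frame_coordinates[OF F]) (rule that)
  define A where "A x = c0 x *\<^sub>R P' + c1 x *\<^sub>R v1' + c2 x *\<^sub>R v2'" for x
  have lA: "linear A"
    by (rule linearI) (simp_all add: A_def linear_add[OF l(1)] linear_add[OF l(2)] linear_add[OF l(3)]
        linear_scale[OF l(1)] linear_scale[OF l(2)] linear_scale[OF l(3)] algebra_simps)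
  have P: "P \<in> model M" "radial ?\<kappa> P v1 = 0" "radial ?\<kappa> P v2 = 0"
    "P' \<in> model M" "radial ?\<kappa> P' v1' = 0" "radial ?\<kappa> P' v2' = 0"
    using F F' by (auto simp: frame_def)
  have tang: "form ?\<kappa> (A x) (A y) = form ?\<kappa> x y" if "c0 x = 0" "c0 y = 0" for x y
  proof -
    have "x = c1 x *\<^sub>R v1 + c2 x *\<^sub>R v2" "y = c1 y *\<^sub>R v1 + c2 y *\<^sub>R v2"
      using ex[of x] ex[of y] that by simp_all
    then have "form ?\<kappa> x y = form ?\<kappa> (c1 x *\<^sub>R v1 + c2 x *\<^sub>R v2) (c1 y *\<^sub>R v1 + c2 y *\<^sub>R v2)" by simp
    then show ?thesis
      by (simp add: A_def that form_simps G form_commute[of _ v2 v1] form_commute[of _ v2' v1'])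
  qed
  have "model_isometry M A"
  proof (cases "?\<kappa> = 0")
    case True
    then have M: "M = Euclidean" by (cases M) auto
    have r: "radial 0 Q v = snd v" for Q v by (simp add: radial_def)
    have "snd P' = 1" "snd v1' = 0" "snd v2' = 0" using P M by (simp_all add: model_def r)
    then have "snd (A x) = snd x" for x unfolding A_def using c0 M by (simp add: r)
    then show ?thesis using lA tang M c0 by (auto simp: model_isometry_def model_def r)
  next
    case False
    then have k: "?\<kappa> * ?\<kappa> = 1" "?\<kappa>\<^sup>2 = 1" using curv_cases[of M] by auto
    have r: "radial ?\<kappa> Q v = ?\<kappa> * form ?\<kappa> Q v" for Q v by (simp add: radial_def k)
    have o: "form ?\<kappa> P v1 = 0" "form ?\<kappa> P v2 = 0" "form ?\<kappa> P' v1' = 0" "form ?\<kappa> P' v2' = 0"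
      using P False by (simp_all add: r)
    then have o': "form ?\<kappa> v1 P = 0" "form ?\<kappa> v2 P = 0" "form ?\<kappa> v1' P' = 0" "form ?\<kappa> v2' P' = 0"
      by (simp_all only: form_commute[of _ v1 P] form_commute[of _ v2 P] form_commute[of _ v1' P'] form_commute[of _ v2' P'])
    have n: "form ?\<kappa> Q Q = ?\<kappa>" if "Q \<in> model M" for Q
    proof -
      have "?\<kappa> * form ?\<kappa> Q Q = 1" using that by (simp add: model_def r)
      then have "?\<kappa> * (?\<kappa> * form ?\<kappa> Q Q) = ?\<kappa>" by simp
      then show ?thesis using k(1) by (metis mult.assoc mult_1)
    qed
    have iso: "form ?\<kappa> (A x) (A y) = form ?\<kappa> x y" for x y
    proof -
      have "form ?\<kappa> x y = form ?\<kappa> (c0 x *\<^sub>R P + c1 x *\<^sub>R v1 + c2 x *\<^sub>R v2) (c0 y *\<^sub>R P + c1 y *\<^sub>R v1 + c2 y *\<^sub>R v2)"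
        using ex[of x] ex[of y] by simp
      then show ?thesis
        by (simp add: A_def form_simps G form_commute[of _ v2 v1] form_commute[of _ v2' v1'] o
            o' n[OF P(1)] n[OF P(4)])
    qed
    have AP: "A P = P'" by (simp add: A_def vals)
    have "A Q \<in> model M" if Q: "Q \<in> model M" for Q
    proof -
      have "0 < snd (A Q)" if M: "M = Hyperbolic"
      proof -
        have "0 < snd Q" "0 < snd P" "0 < snd P'" using Q P M by (auto simp: model_def)
        moreover have "form (-1) Q Q = -1" "form (-1) P P = -1" "form (-1) P' P' = -1"
          using n[OF Q] n[OF P(1)] n[OF P(4)] M by auto
        moreover have "form (-1) (A Q) (A Q) = -1" "form (-1) (A Q) P' = form (-1) Q P"
          using iso[of Q Q] iso[of Q P] n[OF Q] M by (auto simp: AP)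
        ultimately show ?thesis using hyperboloid_sheet[of Q P] hyperboloid_sheet[of "A Q" P'] by simp
      qed
      then show ?thesis using n[OF Q] iso[of Q Q] by (auto simp: model_def r k)
    qed
    then show ?thesis using lA iso by (simp add: model_isometry_def)
  qed
  then show ?thesis by (intro exI[of _ A]) (simp add: A_def vals)
qed

lemma exists_model_isometry_inverse:
  assumes F: "frame M P v1 v2" and F': "frame M P' v1' v2'"
    and G: "form (curv M) v1 v1 = form (curv M) v1' v1'" "form (curv M) v1 v2 = form (curv M) v1' v2'"
      "form (curv M) v2 v2 = form (curv M) v2' v2'"
  obtains A B where "model_isometry M A" "model_isometry M B" "\<And>x. B (A x) = x" "\<And>x. A (B x) = x"
    "A P = P'" "A v1 = v1'" "A v2 = v2'"
proof -
  obtain A where A: "model_isometry M A" "A P = P'" "A v1 = v1'" "A v2 = v2'"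
    using exists_model_isometry[OF F F' G] by blast
  obtain B where B: "model_isometry M B" "B P' = P" "B v1' = v1" "B v2' = v2"
    using exists_model_isometry[OF F' F G[symmetric]] by blast
  have l: "linear A" "linear B" using A B by (simp_all add: model_isometry_def)
  have "B (A x) = x" for x
    using frame_linear_eq[OF F linear_compose[OF l] linear_ident, of x] A B by simp
  moreover have "A (B x) = x" for x
    using frame_linear_eq[OF F' linear_compose[OF l(2,1)] linear_ident, of x] A B by simp
  ultimately show ?thesis using that A B by blast
qed

section \<open>Harmonic maps with the same pulled-back metric\<close>

text \<open>
\<open>2 \<langle>F\<^sub>a\<^sub>b, F\<^sub>c\<rangle> = \<partial>\<^sub>a G\<^sub>b\<^sub>c + \<partial>\<^sub>b G\<^sub>a\<^sub>c - \<partial>\<^sub>c G\<^sub>a\<^sub>b\<close> for every map \<open>F\<close> with pulled-back form \<open>G\<close>.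
\<close>

lemma christoffel_determined:
  assumes S: "open S" and F: "smooth_on F S" "smooth_on F' S" and x: "x \<in> S"
    and D: "a \<in> D" "b \<in> D" "c \<in> D"
    and G: "\<And>y a b. y \<in> S \<Longrightarrow> a \<in> D \<Longrightarrow> b \<in> D \<Longrightarrow> form \<kappa> (dd a F' y) (dd b F' y) = form \<kappa> (dd a F y) (dd b F y)"
  shows "form \<kappa> (dd a (dd b F') x) (dd c F' x) = form \<kappa> (dd a (dd b F) x) (dd c F x)"
proof -
  define g where "g F a b = (\<lambda>y. form \<kappa> (dd a F y) (dd b F y))" for F :: "'a \<Rightarrow> point" and a b
  have k: "2 * form \<kappa> (dd a (dd b F) x) (dd c F x) = dd a (g F b c) x + dd b (g F a c) x - dd c (g F a b) x"
    if F: "smooth_on F S" for F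
  proof -
    have e: "dd u (g F v w) x = form \<kappa> (dd v F x) (dd u (dd w F) x) + form \<kappa> (dd u (dd v F) x) (dd w F x)" for u v w
      unfolding g_def by (rule dd_form[OF smooth_on_dd[OF F] smooth_on_dd[OF F] x])
    show ?thesis
      unfolding e smooth_on_dd_commute[OF S F x, of b a] smooth_on_dd_commute[OF S F x, of c a]
        smooth_on_dd_commute[OF S F x, of c b]
      by (simp add: form_commute[of _ "dd b F x" "dd a (dd c F) x"] form_commute[of _ "dd a F x" "dd b (dd c F) x"]
          form_commute[of _ "dd c F x" "dd a (dd b F) x"])
  qed
  have g: "dd u (g F' v w) x = dd u (g F v w) x" if "v \<in> D" "w \<in> D" for u v w
    by (rule dd_cong[OF S x]) (simp add: g_def G that)
  show ?thesis using k[OF F(1)] k[OF F(2)] by (simp add: g D)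
qed

lemma linear_imp_bounded_linear: "linear (A :: point \<Rightarrow> point) \<Longrightarrow> bounded_linear A"
  by (simp add: linear_conv_bounded_linear)

text \<open>
The products with a frame determine a vector; compactness makes this quantitative.
\<close>

lemma uniform_nondegeneracy:
  fixes K Ku Kv :: "complex \<Rightarrow> point"
  assumes C: "compact C" "continuous_on C K" "continuous_on C Ku" "continuous_on C Kv"
    and F: "\<And>y. y \<in> C \<Longrightarrow> frame M (K y) (Ku y) (Kv y)"
  obtains m where "m > 0" "\<And>y w. y \<in> C \<Longrightarrow>
    m * norm w \<le> \<bar>form (curv M) w (Ku y)\<bar> + \<bar>form (curv M) w (Kv y)\<bar> + \<bar>radial (curv M) (K y) w\<bar>"
proof (cases "C = {}")
  case True
  show ?thesis by (rule that[of 1]) (use True in auto)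
next
  case False
  let ?\<kappa> = "curv M"
  define L where "L y w = \<bar>form ?\<kappa> w (Ku y)\<bar> + \<bar>form ?\<kappa> w (Kv y)\<bar> + \<bar>radial ?\<kappa> (K y) w\<bar>" for y w
  let ?S = "C \<times> sphere (0::point) 1"
  note cf = bounded_bilinear.continuous_on[OF bounded_bilinear_form]
  have cc: "continuous_on ?S (\<lambda>p. g (fst p))" if "continuous_on C g" for g :: "complex \<Rightarrow> point"
    by (rule continuous_on_compose2[OF that]) (auto intro!: continuous_intros)
  have "continuous_on ?S (\<lambda>p. L (fst p) (snd p))"
    unfolding L_def radial_def
    by (intro continuous_on_add continuous_on_rabs continuous_on_mult continuous_on_const cf cc C
        continuous_on_snd continuous_on_id)
  moreover have "compact ?S" "?S \<noteq> {}"
  proof -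
    show "compact ?S" by (intro compact_Times C compact_sphere)
    have "((1::complex), (0::real)) \<in> sphere 0 1" by (simp add: norm_Pair)
    then show "?S \<noteq> {}" using False by blast
  qed
  ultimately obtain q where q: "q \<in> ?S" "\<And>p. p \<in> ?S \<Longrightarrow> L (fst q) (snd q) \<le> L (fst p) (snd p)"
    using continuous_attains_inf[of ?S "\<lambda>p. L (fst p) (snd p)"] by blast
  define m where "m = L (fst q) (snd q)"
  have "m \<noteq> 0"
  proof
    assume "m = 0"
    then have 0: "form ?\<kappa> (snd q) (Ku (fst q)) = 0" "form ?\<kappa> (snd q) (Kv (fst q)) = 0" "radial ?\<kappa> (K (fst q)) (snd q) = 0"
      unfolding m_def L_def by linarith+
    have "fst q \<in> C" using q(1) by auto
    from F[OF this] have "snd q = 0"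
      unfolding frame_def using tangent_nondegenerate 0 by blast
    then show False using q(1) by auto
  qed
  moreover have "0 \<le> m" by (simp add: m_def L_def)
  ultimately have "m > 0" by simp
  moreover have "m * norm w \<le> L y w" if y: "y \<in> C" for y w
  proof (cases "w = 0")
    case True
    then show ?thesis by (simp add: L_def)
  next
    case False
    have "L y ((1 / norm w) *\<^sub>R w) = L y w / norm w"
      using False by (simp add: L_def form_simps radial_simps abs_mult add_divide_distrib)
    moreover have "m \<le> L y ((1 / norm w) *\<^sub>R w)"
      using q(2)[of "(y, (1 / norm w) *\<^sub>R w)"] y False by (simp add: m_def)
    ultimately show ?thesis using False by (simp add: pos_le_divide_eq)
  qed
  ultimately show ?thesis using that unfolding L_def by blast
qed

lemma isometry_compose:
  assumes A: "model_isometry M A" and S: "open S" and H: "smooth_on H S" "\<forall>y\<in>S. H y \<in> model M"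
  shows "smooth_on (\<lambda>y. A (H y)) S"
    and "x \<in> S \<Longrightarrow> A (H x) \<in> model M"
    and "x \<in> S \<Longrightarrow> dd a (\<lambda>y. A (H y)) x = A (dd a H x)"
    and "x \<in> S \<Longrightarrow> dd a (dd b (\<lambda>y. A (H y))) x = A (dd a (dd b H) x)"
    and "x \<in> S \<Longrightarrow> form (curv M) (A (dd a H x)) (A (dd b H x)) = form (curv M) (dd a H x) (dd b H x)"
proof -
  have bl: "bounded_linear A" using A by (simp add: model_isometry_def linear_imp_bounded_linear)
  show "smooth_on (\<lambda>y. A (H y)) S" by (rule smooth_on_linear_compose[OF S bl H(1)])
  have d: "dd a (\<lambda>y. A (H y)) x = A (dd a H x)" if "x \<in> S" for a x
    by (rule dd_linear_compose[OF bl H(1) that])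
  show "x \<in> S \<Longrightarrow> dd a (\<lambda>y. A (H y)) x = A (dd a H x)" by (rule d)
  show "x \<in> S \<Longrightarrow> A (H x) \<in> model M" using A H(2) by (simp add: model_isometry_def)
  show "dd a (dd b (\<lambda>y. A (H y))) x = A (dd a (dd b H) x)" if "x \<in> S"
  proof -
    have "dd a (dd b (\<lambda>y. A (H y))) x = dd a (\<lambda>y. A (dd b H y)) x" by (rule dd_cong[OF S that d])
    also have "\<dots> = A (dd a (dd b H) x)" by (rule dd_linear_compose[OF bl smooth_on_dd[OF H(1)] that])
    finally show ?thesis .
  qed
  show "form (curv M) (A (dd a H x)) (A (dd b H x)) = form (curv M) (dd a H x) (dd b H x)" if "x \<in> S"
  proof -
    have "H y \<in> model M" if "y \<in> S" for y using H(2) that by blast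
    from radial_dd[OF S H(1) this that] show ?thesis
      using A H(2) that unfolding model_isometry_def by blast
  qed
qed

text \<open>
Let \<open>u = K - H\<close>. As the products \<open>\<langle>K\<^sub>a\<^sub>b, K\<^sub>c\<rangle> = \<langle>H\<^sub>a\<^sub>b, H\<^sub>c\<rangle>\<close> and the radial parts of \<open>K\<^sub>a\<^sub>b\<close> and \<open>H\<^sub>a\<^sub>b\<close> agree, all products of
\<open>u\<^sub>a\<^sub>b\<close> with the frame of \<open>K\<close> are linear in \<open>(u, u\<^sub>u, u\<^sub>v)\<close>. So \<open>|u\<^sub>a\<^sub>b| \<le> D |(u, u\<^sub>u, u\<^sub>v)|\<close>, and Gronwall applies.
\<close>

lemma first_order_agreement_imp_local_agreement:
  fixes K H :: "complex \<Rightarrow> point"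
  assumes S: "open S" and K: "smooth_on K S" "\<And>y. y \<in> S \<Longrightarrow> K y \<in> model M"
    and H: "smooth_on H S" "\<And>y. y \<in> S \<Longrightarrow> H y \<in> model M"
    and G: "\<And>y a b. y \<in> S \<Longrightarrow> a \<in> {1, \<i>} \<Longrightarrow> b \<in> {1, \<i>} \<Longrightarrow>
      form (curv M) (dd a H y) (dd b H y) = form (curv M) (dd a K y) (dd b K y)"
    and r: "cball p r \<subseteq> S" "\<And>y. y \<in> cball p r \<Longrightarrow> frame M (K y) (dd 1 K y) (dd \<i> K y)"
    and p: "K p = H p" "dd 1 K p = dd 1 H p" "dd \<i> K p = dd \<i> H p"
    and y: "y \<in> ball p r"
  shows "K y = H y"
proof -
  let ?\<kappa> = "curv M"
  have cont: "continuous_on (cball p r) g" if "smooth_on g S" for g :: "complex \<Rightarrow> point"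
    by (rule continuous_on_subset[OF smooth_on_continuous[OF that] r(1)])
  note K' = smooth_on_dd[OF K(1)] and H' = smooth_on_dd[OF H(1)]
  obtain m where m: "m > 0" "\<And>y w. y \<in> cball p r \<Longrightarrow>
    m * norm w \<le> \<bar>form ?\<kappa> w (dd 1 K y)\<bar> + \<bar>form ?\<kappa> w (dd \<i> K y)\<bar> + \<bar>radial ?\<kappa> (K y) w\<bar>"
    by (rule uniform_nondegeneracy[OF compact_cball cont[OF K(1)] cont[OF K'] cont[OF K'] r(2)]) (assumption, rule that)
  obtain B where B: "B > 0" "\<And>x y. norm (form ?\<kappa> x y) \<le> norm x * norm y * B"
    using bounded_bilinear.pos_bounded[OF bounded_bilinear_form] by blast
  define h where "h y = norm (dd 1 (dd 1 H) y) + norm (dd 1 (dd \<i> H) y) + (norm (dd \<i> (dd 1 H) y) + norm (dd \<i> (dd \<i> H) y))" for y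
  have "continuous_on (cball p r) h"
    unfolding h_def by (intro continuous_on_add continuous_on_norm cont smooth_on_dd H)
  then have "bounded (h ` cball p r)" by (intro compact_imp_bounded compact_continuous_image compact_cball)
  then obtain C where "\<forall>t\<in>h ` cball p r. norm t \<le> C" unfolding bounded_iff by blast
  then have C: "h y \<le> C" if "y \<in> cball p r" for y
    using that by (metis abs_le_D1 imageI real_norm_def)
  have C': "norm (dd a (dd b H) y) \<le> C" if "y \<in> cball p r" "a \<in> {1, \<i>}" "b \<in> {1, \<i>}" for a b y
  proof -
    have "norm (dd a (dd b H) y) \<le> h y" using that(2,3) by (auto simp: h_def)
    then show ?thesis using C[OF that(1)] by simp
  qed
  define u where "u = (\<lambda>y. K y + (- H y))"
  have mH: "smooth_on (\<lambda>y. - H y) S"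
    by (rule smooth_on_linear_compose[OF S bounded_linear_minus[OF bounded_linear_ident] H(1)])
  have mH': "dd a (\<lambda>y. - H y) y = - dd a H y" if "y \<in> S" for a y
    by (rule dd_linear_compose[OF bounded_linear_minus[OF bounded_linear_ident] H(1) that])
  have u: "smooth_on u S" unfolding u_def by (intro smooth_on_add S K mH)
  have ua: "dd a u y = dd a K y - dd a H y" if "y \<in> S" for a y
    unfolding u_def dd_add[OF K(1) mH that] mH'[OF that] by simp
  have uab: "dd a (dd b u) y = dd a (dd b K) y - dd a (dd b H) y" if y: "y \<in> S" for a b y
  proof -
    have "dd a (dd b u) y = dd a (\<lambda>y. dd b K y - dd b H y) y" by (rule dd_cong[OF S y ua])
    also have "\<dots> = dd a (dd b K) y - dd a (dd b H) y"
      by (rule dd_eqI[OF has_derivative_diff[OF smooth_on_has_derivative[OF K' y] smooth_on_has_derivative[OF H' y]]])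
    finally show ?thesis .
  qed
  define V where "V y = (u y, dd 1 u y, dd \<i> u y)" for y
  have Vn: "norm (u y) \<le> norm (V y)" "norm (dd 1 u y) \<le> norm (V y)" "norm (dd \<i> u y) \<le> norm (V y)" for y
    unfolding V_def
    by (metis norm_fst_le, metis norm_fst_le norm_snd_le order_trans, metis norm_snd_le order_trans)
  \<comment> \<open>three products, each bounded by \<open>C B |V|\<close>, control \<open>m |u\<^sub>a\<^sub>b|\<close>\<close>
  define D where "D = (3 * (C * B)) / m"
  have second: "norm (dd a (dd b u) y) \<le> D * norm (V y)" if y: "y \<in> cball p r" and ab: "a \<in> {1, \<i>}" "b \<in> {1, \<i>}" for a b y
  proof -
    have yS: "y \<in> S" using y r(1) by blast
    have n: "\<bar>form ?\<kappa> w (dd a (dd b H) y)\<bar> \<le> C * B * norm (V y)" if "norm w \<le> norm (V y)" for w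
    proof -
      have "\<bar>form ?\<kappa> w (dd a (dd b H) y)\<bar> \<le> norm w * norm (dd a (dd b H) y) * B" using B(2) by simp
      also have "\<dots> \<le> norm (V y) * C * B"
        using B(1) C'[OF y ab] that by (intro mult_right_mono mult_mono) auto
      finally show ?thesis by (simp add: mult_ac)
    qed
    have c: "form ?\<kappa> (dd a (dd b u) y) (dd c K y) = - form ?\<kappa> (dd c u y) (dd a (dd b H) y)" if c: "c \<in> {1, \<i>}" for c
      using christoffel_determined[OF S K(1) H(1) yS ab c G]
      by (simp add: uab[OF yS] ua[OF yS] form_simps form_commute[of _ _ "dd a (dd b H) y"] del: insert_iff)
    have t: "radial ?\<kappa> (K y) (dd a (dd b u) y) = - ?\<kappa> * form ?\<kappa> (u y) (dd a (dd b H) y)"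
    proof -
      have "radial ?\<kappa> (K y) (dd a (dd b K) y) = radial ?\<kappa> (H y) (dd a (dd b H) y)"
        using radial_dd_dd[OF S K(1) K(2) yS, of a b] radial_dd_dd[OF S H(1) H(2) yS, of a b] G[OF yS ab] by simp
      moreover have "form ?\<kappa> (u y) w = form ?\<kappa> (K y) w - form ?\<kappa> (H y) w" for w
        by (simp add: u_def form_simps)
      ultimately show ?thesis
        unfolding uab[OF yS] radial_simps by (simp add: radial_def right_diff_distrib left_diff_distrib)
    qed
    have "\<bar>?\<kappa>\<bar> \<le> 1" using curv_cases[of M] by auto
    then have "\<bar>radial ?\<kappa> (K y) (dd a (dd b u) y)\<bar> \<le> \<bar>form ?\<kappa> (u y) (dd a (dd b H) y)\<bar>"
      unfolding t by (simp add: abs_mult mult_left_le_one_le)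
    then have "m * norm (dd a (dd b u) y) \<le> 3 * (C * B * norm (V y))"
      using m(2)[OF y, of "dd a (dd b u) y"] n[OF Vn(1)] n[OF Vn(2)] n[OF Vn(3)] c[of 1] c[of \<i>] by simp
    then show ?thesis using m(1) by (simp add: D_def field_simps)
  qed
  have "V y = 0"
  proof (rule gronwall_zero[OF _ _ _ y])
    fix y assume "y \<in> ball p r"
    then have yc: "y \<in> cball p r" and yS: "y \<in> S" using r(1) by auto
    show "(V has_derivative (\<lambda>v. (dd v u y, dd v (dd 1 u) y, dd v (dd \<i> u) y))) (at y)"
      unfolding V_def[abs_def]
      by (intro has_derivative_Pair smooth_on_has_derivative[OF _ yS] smooth_on_dd u)
    fix v :: complex
    have 1: "norm (dd v u y) \<le> norm v * (2 * norm (V y))"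
      by (rule order_trans[OF norm_dd_le[OF u yS]]) (use Vn[of y] in \<open>auto intro!: mult_left_mono\<close>)
    have 2: "norm (dd v (dd a u) y) \<le> norm v * (2 * (D * norm (V y)))" if "a \<in> {1, \<i>}" for a
      by (rule order_trans[OF norm_dd_le[OF smooth_on_dd[OF u] yS]])
        (use second[OF yc _ that, of 1] second[OF yc _ that, of \<i>] in \<open>auto intro!: mult_left_mono\<close>)
    have "norm (dd v u y, dd v (dd 1 u) y, dd v (dd \<i> u) y)
        \<le> norm (dd v u y) + (norm (dd v (dd 1 u) y) + norm (dd v (dd \<i> u) y))"
      by (meson add_left_mono norm_Pair_le order_trans)
    also have "\<dots> \<le> (2 + 4 * D) * norm v * norm (V y)"
      using 1 2[of 1] 2[of \<i>] by (simp add: algebra_simps)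
    finally show "norm (dd v u y, dd v (dd 1 u) y, dd v (dd \<i> u) y) \<le> (2 + 4 * D) * norm v * norm (V y)" .
  next
    have "p \<in> S" using r(1) y by (metis centre_in_cball ball_eq_empty empty_iff less_eq_real_def not_le subsetD)
    then have "dd 1 u p = 0" "dd \<i> u p = 0" "u p = 0" using p by (simp_all only: ua) (simp_all add: u_def)
    then show "V p = 0" by (simp add: V_def zero_prod_def)
  qed
  then have "u y = 0" using Vn(1)[of y] by simp
  then show ?thesis by (simp add: u_def)
qed

text \<open>
The assumptions on \<open>F\<close> say that \<open>G = |\<nabla>f|\<^sup>2 I - \<nabla>f \<nabla>f\<^sup>T\<close>, which has rank one with kernel \<open>\<nabla>f\<close>. So \<open>dF\<close> is
determined by its value \<open>\<xi>\<close> on the unit vector orthogonal to \<open>\<nabla>f\<close>, divided by \<open>|\<nabla>f|\<close>. The equation for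
\<open>\<Delta>F\<close> and the symmetry of \<open>F\<^sub>u\<^sub>v\<close> are two linear equations for \<open>\<xi>\<^sub>u\<close> and \<open>\<xi>\<^sub>v\<close> with determinant \<open>- |\<nabla>f|\<^sup>2\<close>.
\<close>

lemma cylinder_frame:
  fixes F :: "complex \<Rightarrow> point" and f :: "complex \<Rightarrow> real"
  assumes S: "open S" and F: "smooth_on F S" "\<And>y. y \<in> S \<Longrightarrow> F y \<in> model M" and f: "smooth_on f S"
    and pos: "\<And>y. y \<in> S \<Longrightarrow> 0 < (dd 1 f y)\<^sup>2 + (dd \<i> f y)\<^sup>2"
    and G: "\<And>y. y \<in> S \<Longrightarrow> form (curv M) (dd 1 F y) (dd 1 F y) = (dd \<i> f y)\<^sup>2"
      "\<And>y. y \<in> S \<Longrightarrow> form (curv M) (dd \<i> F y) (dd \<i> F y) = (dd 1 f y)\<^sup>2"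
      "\<And>y. y \<in> S \<Longrightarrow> form (curv M) (dd 1 F y) (dd \<i> F y) = - dd 1 f y * dd \<i> f y"
    and harm: "\<And>y. y \<in> S \<Longrightarrow> dd 1 (dd 1 f) y + dd \<i> (dd \<i> f) y = 0"
    and tension: "\<And>y. y \<in> S \<Longrightarrow> dd 1 (dd 1 F) y + dd \<i> (dd \<i> F) y
      = (- curv M * ((dd 1 f y)\<^sup>2 + (dd \<i> f y)\<^sup>2)) *\<^sub>R F y"
  obtains \<xi> where "smooth_on \<xi> S" "\<And>y. y \<in> S \<Longrightarrow> radial (curv M) (F y) (\<xi> y) = 0"
    "\<And>y. y \<in> S \<Longrightarrow> form (curv M) (\<xi> y) (\<xi> y) = 1"
    "\<And>y. y \<in> S \<Longrightarrow> dd 1 F y = - dd \<i> f y *\<^sub>R \<xi> y"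
    "\<And>y. y \<in> S \<Longrightarrow> dd \<i> F y = dd 1 f y *\<^sub>R \<xi> y"
    "\<And>y. y \<in> S \<Longrightarrow> dd 1 \<xi> y = (curv M * dd \<i> f y) *\<^sub>R F y"
    "\<And>y. y \<in> S \<Longrightarrow> dd \<i> \<xi> y = - (curv M * dd 1 f y) *\<^sub>R F y"
proof -
  let ?\<kappa> = "curv M"
  define p where "p = dd 1 f"
  define q where "q = dd \<i> f"
  define c where "c y = p y * p y + q y * q y" for y
  define \<xi> where "\<xi> y = inverse (c y) *\<^sub>R ((- q y) *\<^sub>R dd 1 F y + p y *\<^sub>R dd \<i> F y)" for y
  have sm: "smooth_on p S" "smooth_on q S" unfolding p_def q_def by (intro smooth_on_dd f)+
  have mq: "smooth_on (\<lambda>y. - q y) S"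
    by (rule smooth_on_linear_compose[OF S bounded_linear_minus[OF bounded_linear_ident] sm(2)])
  have c0: "c y > 0" if "y \<in> S" for y
    using pos[OF that] by (simp add: c_def p_def q_def power2_eq_square)
  have \<xi>s: "smooth_on \<xi> S"
    unfolding \<xi>_def[abs_def] c_def[abs_def]
    by (intro smooth_on_scaleR smooth_on_add smooth_on_inverse smooth_on_mult smooth_on_dd S sm mq F)
      (use c0 in \<open>force simp: c_def\<close>)
  have G': "form ?\<kappa> (dd 1 F y) (dd 1 F y) = q y * q y" "form ?\<kappa> (dd \<i> F y) (dd \<i> F y) = p y * p y"
    "form ?\<kappa> (dd 1 F y) (dd \<i> F y) = - (p y * q y)" "form ?\<kappa> (dd \<i> F y) (dd 1 F y) = - (p y * q y)" if "y \<in> S" for y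
    using G[OF that] by (simp_all add: p_def q_def power2_eq_square form_commute[of _ "dd \<i> F y" "dd 1 F y"])
  have rad: "radial ?\<kappa> (F y) (dd v F y) = 0" if "y \<in> S" for v y by (rule radial_dd[OF S F that])
  \<comment> \<open>\<open>\<nabla>f\<close> is in the kernel of \<open>dF\<close>, because \<open>dF(\<nabla>f)\<close> is a tangent vector of length zero\<close>
  have ker: "p y *\<^sub>R dd 1 F y + q y *\<^sub>R dd \<i> F y = 0" if y: "y \<in> S" for y
  proof (rule ccontr)
    assume n: "p y *\<^sub>R dd 1 F y + q y *\<^sub>R dd \<i> F y \<noteq> 0"
    have "radial ?\<kappa> (F y) (p y *\<^sub>R dd 1 F y + q y *\<^sub>R dd \<i> F y) = 0"
      by (simp add: radial_simps rad[OF y])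
    from tangent_form_pos[OF F(2)[OF y] this n] show False
      by (simp add: form_simps G'[OF y])
  qed
  have F1: "dd 1 F y = (- q y) *\<^sub>R \<xi> y" and Fi: "dd \<i> F y = p y *\<^sub>R \<xi> y" if y: "y \<in> S" for y
  proof -
    have k: "c y *\<^sub>R \<xi> y = (- q y) *\<^sub>R dd 1 F y + p y *\<^sub>R dd \<i> F y" using c0[OF y] by (simp add: \<xi>_def)
    have "c y *\<^sub>R dd 1 F y - (- q y) *\<^sub>R (c y *\<^sub>R \<xi> y) = p y *\<^sub>R (p y *\<^sub>R dd 1 F y + q y *\<^sub>R dd \<i> F y)"
      unfolding k unfolding c_def by (simp add: algebra_simps)
    then have "c y *\<^sub>R dd 1 F y = c y *\<^sub>R ((- q y) *\<^sub>R \<xi> y)" unfolding ker[OF y] by (simp add: mult.commute add_eq_0_iff2)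
    then show "dd 1 F y = (- q y) *\<^sub>R \<xi> y" using c0[OF y] by (metis less_irrefl scaleR_cancel_left)
    have "c y *\<^sub>R dd \<i> F y - p y *\<^sub>R (c y *\<^sub>R \<xi> y) = q y *\<^sub>R (p y *\<^sub>R dd 1 F y + q y *\<^sub>R dd \<i> F y)"
      unfolding k unfolding c_def by (simp add: algebra_simps)
    then have "c y *\<^sub>R dd \<i> F y = c y *\<^sub>R (p y *\<^sub>R \<xi> y)" unfolding ker[OF y] by (simp add: mult.commute)
    then show "dd \<i> F y = p y *\<^sub>R \<xi> y" using c0[OF y] by (metis less_irrefl scaleR_cancel_left)
  qed
  have \<xi>r: "radial ?\<kappa> (F y) (\<xi> y) = 0" if "y \<in> S" for y
    by (simp add: \<xi>_def radial_simps rad[OF that])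
  have \<xi>1: "form ?\<kappa> (\<xi> y) (\<xi> y) = 1" if y: "y \<in> S" for y
  proof -
    have "c y * form ?\<kappa> (\<xi> y) (\<xi> y) = form ?\<kappa> (dd 1 F y) (dd 1 F y) + form ?\<kappa> (dd \<i> F y) (dd \<i> F y)"
      unfolding F1[OF y] Fi[OF y] by (simp add: form_simps c_def algebra_simps)
    then have "c y * form ?\<kappa> (\<xi> y) (\<xi> y) = c y * 1" using G'[OF y] by (simp add: c_def)
    then show ?thesis using c0[OF y] by (metis less_irrefl mult_cancel_left)
  qed
  have D: "dd 1 \<xi> y = (?\<kappa> * q y) *\<^sub>R F y" "dd \<i> \<xi> y = - (?\<kappa> * p y) *\<^sub>R F y" if y: "y \<in> S" for y
  proof -
    have ds: "dd v (\<lambda>y. g y *\<^sub>R \<xi> y) y = g y *\<^sub>R dd v \<xi> y + dd v g y *\<^sub>R \<xi> y" if "smooth_on g S" for v g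
      by (rule dd_eqI[OF has_derivative_scaleR[OF smooth_on_has_derivative[OF that y] smooth_on_has_derivative[OF \<xi>s y]]])
    have mq': "dd v (\<lambda>y. - q y) y = - dd v q y" for v
      by (rule dd_linear_compose[OF bounded_linear_minus[OF bounded_linear_ident] sm(2) y])
    have d1: "dd v (dd 1 F) y = (- q y) *\<^sub>R dd v \<xi> y + (- dd v q y) *\<^sub>R \<xi> y" for v
      using dd_cong[OF S y, where F = "dd 1 F" and G = "\<lambda>y. (- q y) *\<^sub>R \<xi> y" and v = v, OF F1] unfolding ds[OF mq] mq' .
    have di: "dd v (dd \<i> F) y = p y *\<^sub>R dd v \<xi> y + dd v p y *\<^sub>R \<xi> y" for v
      using dd_cong[OF S y, where F = "dd \<i> F" and G = "\<lambda>y. p y *\<^sub>R \<xi> y" and v = v, OF Fi] unfolding ds[OF sm(1)] .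
    have pq: "dd \<i> p y = dd 1 q y" unfolding p_def q_def by (rule smooth_on_dd_commute[OF S f y])
    have h: "dd 1 p y + dd \<i> q y = 0" using harm[OF y] by (simp add: p_def q_def)
    have a: "(- q y) *\<^sub>R dd 1 \<xi> y + p y *\<^sub>R dd \<i> \<xi> y = (- ?\<kappa> * c y) *\<^sub>R F y"
      using tension[OF y] unfolding d1 di pq by (simp add: c_def p_def q_def power2_eq_square)
    have b: "p y *\<^sub>R dd 1 \<xi> y + q y *\<^sub>R dd \<i> \<xi> y = 0"
    proof -
      have "p y *\<^sub>R dd 1 \<xi> y + q y *\<^sub>R dd \<i> \<xi> y + (dd 1 p y + dd \<i> q y) *\<^sub>R \<xi> y = dd 1 (dd \<i> F) y - dd \<i> (dd 1 F) y"
        unfolding d1 di by (simp add: algebra_simps)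
      then show ?thesis unfolding h using smooth_on_dd_commute[OF S F(1) y, of \<i> 1] by simp
    qed
    have "c y *\<^sub>R dd 1 \<xi> y = p y *\<^sub>R (p y *\<^sub>R dd 1 \<xi> y + q y *\<^sub>R dd \<i> \<xi> y)
        - q y *\<^sub>R ((- q y) *\<^sub>R dd 1 \<xi> y + p y *\<^sub>R dd \<i> \<xi> y)"
      by (simp add: c_def algebra_simps)
    also have "\<dots> = c y *\<^sub>R ((?\<kappa> * q y) *\<^sub>R F y)" unfolding a b by (simp add: algebra_simps)
    finally show "dd 1 \<xi> y = (?\<kappa> * q y) *\<^sub>R F y" using c0[OF y] by (metis less_irrefl scaleR_cancel_left)
    have "c y *\<^sub>R dd \<i> \<xi> y = q y *\<^sub>R (p y *\<^sub>R dd 1 \<xi> y + q y *\<^sub>R dd \<i> \<xi> y)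
        + p y *\<^sub>R ((- q y) *\<^sub>R dd 1 \<xi> y + p y *\<^sub>R dd \<i> \<xi> y)"
      by (simp add: c_def algebra_simps)
    also have "\<dots> = c y *\<^sub>R (- (?\<kappa> * p y) *\<^sub>R F y)" unfolding a b by (simp add: algebra_simps)
    finally show "dd \<i> \<xi> y = - (?\<kappa> * p y) *\<^sub>R F y" using c0[OF y] by (metis less_irrefl scaleR_cancel_left)
  qed
  show ?thesis
    by (rule that[OF \<xi>s \<xi>r \<xi>1 F1[unfolded q_def] Fi[unfolded p_def] D(1)[unfolded q_def] D(2)[unfolded p_def]])
qed

lemma orthonormal_completion:
  assumes "P \<in> model M" "radial (curv M) P v = 0" "form (curv M) v v = 1"
  obtains w where "radial (curv M) P w = 0" "form (curv M) v w = 0" "form (curv M) w w = 1" "frame M P v w"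
proof -
  obtain \<epsilon> z where e: "admissible (curv M) \<epsilon>" "z \<in> chart_range (curv M)" "P = chart_emb (curv M) \<epsilon> z"
    by (rule model_chart_emb[OF assms(1)])
  obtain \<xi> where \<xi>: "v = d_chart_emb (curv M) \<epsilon> z \<xi>" using tangent_is_d_chart_emb[OF e(1,2)] assms(2) e(3) by blast
  define w where "w = d_chart_emb (curv M) \<epsilon> z (\<i> * \<xi>)"
  have w: "radial (curv M) P w = 0" "form (curv M) v w = 0" "form (curv M) w w = 1"
    using assms(3) unfolding w_def \<xi> e(3) radial_d_chart_emb[OF e(1,2)] form_d_chart_emb[OF e(1,2)]
    by (simp_all add: inner_complex_def algebra_simps)
  show ?thesis by (rule that[OF w]) (use w assms in \<open>simp add: frame_def\<close>)
qed

text \<open>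
First an isometry \<open>A\<close> with \<open>A H = H'\<close> on some disc is found, with the two cases according to whether \<open>G\<close> is
somewhere nondegenerate; then unique continuation is applied to the components of \<open>A H - H'\<close>.
\<close>

theorem harmonic_congruence:
  fixes H H' :: "complex \<Rightarrow> point" and f :: "complex \<Rightarrow> real"
  assumes \<Omega>: "open \<Omega>" "connected \<Omega>" "\<Omega> \<noteq> {}"
    and H: "smooth_on H \<Omega>" "\<And>y. y \<in> \<Omega> \<Longrightarrow> H y \<in> model M"
    and H': "smooth_on H' \<Omega>" "\<And>y. y \<in> \<Omega> \<Longrightarrow> H' y \<in> model M"
    and f: "smooth_on f \<Omega>"
    and conf: "\<And>y. y \<in> \<Omega> \<Longrightarrow> 0 < form (curv M) (dd 1 H y) (dd 1 H y) + (dd 1 f y)\<^sup>2"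
      "\<And>y. y \<in> \<Omega> \<Longrightarrow> form (curv M) (dd 1 H y) (dd 1 H y) + (dd 1 f y)\<^sup>2
        = form (curv M) (dd \<i> H y) (dd \<i> H y) + (dd \<i> f y)\<^sup>2"
      "\<And>y. y \<in> \<Omega> \<Longrightarrow> form (curv M) (dd 1 H y) (dd \<i> H y) + dd 1 f y * dd \<i> f y = 0"
    and harm: "\<And>y. y \<in> \<Omega> \<Longrightarrow> dd 1 (dd 1 f) y + dd \<i> (dd \<i> f) y = 0"
    and same: "\<And>y a b. y \<in> \<Omega> \<Longrightarrow> a \<in> {1, \<i>} \<Longrightarrow> b \<in> {1, \<i>} \<Longrightarrow>
      form (curv M) (dd a H' y) (dd b H' y) = form (curv M) (dd a H y) (dd b H y)"
    and tension: "\<And>y. y \<in> \<Omega> \<Longrightarrow> dd 1 (dd 1 H) y + dd \<i> (dd \<i> H) y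
      = (- curv M * (form (curv M) (dd 1 H y) (dd 1 H y) + form (curv M) (dd \<i> H y) (dd \<i> H y))) *\<^sub>R H y"
    and tension': "\<And>y. y \<in> \<Omega> \<Longrightarrow> dd 1 (dd 1 H') y + dd \<i> (dd \<i> H') y
      = (- curv M * (form (curv M) (dd 1 H' y) (dd 1 H' y) + form (curv M) (dd \<i> H' y) (dd \<i> H' y))) *\<^sub>R H' y"
  obtains A B where "model_isometry M A" "model_isometry M B" "\<And>x. B (A x) = x" "\<And>x. A (B x) = x"
    "\<And>y. y \<in> \<Omega> \<Longrightarrow> H' y = A (H y)"
proof -
  let ?\<kappa> = "curv M"
  let ?E = "\<lambda>y. form ?\<kappa> (dd 1 H y) (dd 1 H y)"
  let ?F = "\<lambda>y. form ?\<kappa> (dd 1 H y) (dd \<i> H y)"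
  let ?G = "\<lambda>y. form ?\<kappa> (dd \<i> H y) (dd \<i> H y)"
  have HM: "\<forall>y\<in>\<Omega>. H y \<in> model M" using H(2) by blast
  define J where "J y = ?E y * ?G y - ?F y * ?F y" for y
  have cJ: "continuous_on \<Omega> J"
    unfolding J_def by (intro continuous_on_diff continuous_on_mult smooth_on_continuous[OF smooth_on_form] smooth_on_dd H \<Omega>)
  have local: "\<exists>A B p r. model_isometry M A \<and> model_isometry M B \<and> (\<forall>x. B (A x) = x) \<and> (\<forall>x. A (B x) = x)
      \<and> 0 < r \<and> ball p r \<subseteq> \<Omega> \<and> (\<forall>y\<in>ball p r. A (H y) = H' y)"
  proof (cases "\<exists>p\<in>\<Omega>. J p \<noteq> 0")
    case True
    then obtain p where p: "p \<in> \<Omega>" "J p \<noteq> 0" by blast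
    have "open {y\<in>\<Omega>. J y \<in> - {0}}"
      by (rule continuous_open_preimage[OF cJ \<Omega>(1), unfolded vimage_def Int_def, simplified]) auto
    then obtain r where r: "r > 0" "cball p r \<subseteq> {y\<in>\<Omega>. J y \<in> - {0}}"
      using p open_contains_cball by blast
    have fr: "frame M (H y) (dd 1 H y) (dd \<i> H y)" if "y \<in> cball p r" for y
      using r(2) that H(2) radial_dd[OF \<Omega>(1) H] by (auto simp: frame_def J_def power2_eq_square)
    have pc: "p \<in> cball p r" using r by simp
    have fr': "frame M (H' p) (dd 1 H' p) (dd \<i> H' p)"
      using fr[OF pc] H'(2)[OF p(1)] radial_dd[OF \<Omega>(1) H' p(1)] same[OF p(1)] by (auto simp: frame_def)
    have gram: "?E p = form ?\<kappa> (dd 1 H' p) (dd 1 H' p)" "?F p = form ?\<kappa> (dd 1 H' p) (dd \<i> H' p)"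
      "?G p = form ?\<kappa> (dd \<i> H' p) (dd \<i> H' p)"
      using same[OF p(1)] by simp_all
    obtain A B where AB: "model_isometry M A" "model_isometry M B" "\<And>x. B (A x) = x" "\<And>x. A (B x) = x"
      and Ap: "A (H p) = H' p" "A (dd 1 H p) = dd 1 H' p" "A (dd \<i> H p) = dd \<i> H' p"
      by (rule exists_model_isometry_inverse[OF fr[OF pc] fr' gram]) (rule that)
    note AH = isometry_compose[OF AB(1) \<Omega>(1) H(1) HM]
    have "A (H y) = H' y" if y: "y \<in> ball p r" for y
    proof (rule first_order_agreement_imp_local_agreement[OF \<Omega>(1) AH(1,2) H' _ _ _ _ _ _ y])
      show "form ?\<kappa> (dd a H' y) (dd b H' y) = form ?\<kappa> (dd a (\<lambda>y. A (H y)) y) (dd b (\<lambda>y. A (H y)) y)"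
        if "y \<in> \<Omega>" "a \<in> {1, \<i>}" "b \<in> {1, \<i>}" for y a b
        unfolding AH(3)[OF that(1)] AH(5)[OF that(1)] by (rule same[OF that])
      show "cball p r \<subseteq> \<Omega>" using r(2) by blast
      show "frame M (A (H y)) (dd 1 (\<lambda>y. A (H y)) y) (dd \<i> (\<lambda>y. A (H y)) y)" if y: "y \<in> cball p r" for y
      proof -
        have yO: "y \<in> \<Omega>" using r(2) y by blast
        show ?thesis
          using fr[OF y] AH(2)[OF yO] radial_dd[OF \<Omega>(1) AH(1) AH(2) yO] AH(5)[OF yO]
          unfolding frame_def AH(3)[OF yO] by simp
      qed
      show "A (H p) = H' p" "dd 1 (\<lambda>y. A (H y)) p = dd 1 H' p" "dd \<i> (\<lambda>y. A (H y)) p = dd \<i> H' p"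
        unfolding AH(3)[OF p(1)] by (fact Ap)+
    qed
    moreover have "ball p r \<subseteq> \<Omega>" using r(2) ball_subset_cball by blast
    ultimately show ?thesis using AB r(1) by blast
  next
    case False
    then have J0: "J y = 0" if "y \<in> \<Omega>" for y using that by blast
    obtain p where p: "p \<in> \<Omega>" using \<Omega>(3) by blast
    obtain r where r: "r > 0" "cball p r \<subseteq> \<Omega>" using \<Omega>(1) p open_contains_cball by blast
    \<comment> \<open>\<open>G = c I - \<nabla>f \<nabla>f\<^sup>T\<close> has determinant \<open>c (c - |\<nabla>f|\<^sup>2)\<close>, so here \<open>c = |\<nabla>f|\<^sup>2\<close>\<close>
    have c: "?E y + (dd 1 f y)\<^sup>2 = (dd 1 f y)\<^sup>2 + (dd \<i> f y)\<^sup>2" if y: "y \<in> \<Omega>" for y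
    proof -
      define c where "c = ?E y + (dd 1 f y)\<^sup>2"
      have e: "?E y = c - (dd 1 f y)\<^sup>2" "?G y = c - (dd \<i> f y)\<^sup>2" "?F y = - (dd 1 f y * dd \<i> f y)"
        using conf(2,3)[OF y] by (simp_all add: c_def)
      have "c * (c - ((dd 1 f y)\<^sup>2 + (dd \<i> f y)\<^sup>2)) = J y"
        unfolding J_def e by (simp add: power2_eq_square algebra_simps)
      then show ?thesis using J0[OF y] conf(1)[OF y] by (simp add: c_def)
    qed
    have g: "?E y = (dd \<i> f y)\<^sup>2" "?G y = (dd 1 f y)\<^sup>2" "?F y = - dd 1 f y * dd \<i> f y"
      and pos: "0 < (dd 1 f y)\<^sup>2 + (dd \<i> f y)\<^sup>2" if "y \<in> \<Omega>" for y
      using c[OF that] conf[OF that] by auto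
    have t: "dd 1 (dd 1 H) y + dd \<i> (dd \<i> H) y = (- ?\<kappa> * ((dd 1 f y)\<^sup>2 + (dd \<i> f y)\<^sup>2)) *\<^sub>R H y"
      "dd 1 (dd 1 H') y + dd \<i> (dd \<i> H') y = (- ?\<kappa> * ((dd 1 f y)\<^sup>2 + (dd \<i> f y)\<^sup>2)) *\<^sub>R H' y"
      if "y \<in> \<Omega>" for y
      using tension[OF that] tension'[OF that] same[OF that] g[OF that] by (simp_all add: add.commute)
    have g': "form ?\<kappa> (dd 1 H' y) (dd 1 H' y) = (dd \<i> f y)\<^sup>2" "form ?\<kappa> (dd \<i> H' y) (dd \<i> H' y) = (dd 1 f y)\<^sup>2"
      "form ?\<kappa> (dd 1 H' y) (dd \<i> H' y) = - dd 1 f y * dd \<i> f y" if "y \<in> \<Omega>" for y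
      using same[OF that] g[OF that] by simp_all
    obtain \<xi> where \<xi>: "smooth_on \<xi> \<Omega>" "\<And>y. y \<in> \<Omega> \<Longrightarrow> radial ?\<kappa> (H y) (\<xi> y) = 0"
      "\<And>y. y \<in> \<Omega> \<Longrightarrow> form ?\<kappa> (\<xi> y) (\<xi> y) = 1"
      "\<And>y. y \<in> \<Omega> \<Longrightarrow> dd 1 H y = - dd \<i> f y *\<^sub>R \<xi> y"
      "\<And>y. y \<in> \<Omega> \<Longrightarrow> dd \<i> H y = dd 1 f y *\<^sub>R \<xi> y"
      "\<And>y. y \<in> \<Omega> \<Longrightarrow> dd 1 \<xi> y = (?\<kappa> * dd \<i> f y) *\<^sub>R H y"
      "\<And>y. y \<in> \<Omega> \<Longrightarrow> dd \<i> \<xi> y = - (?\<kappa> * dd 1 f y) *\<^sub>R H y"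
      by (rule cylinder_frame[OF \<Omega>(1) H f pos g harm t(1)]) (assumption+, rule that)
    obtain \<xi>' where \<xi>': "smooth_on \<xi>' \<Omega>" "\<And>y. y \<in> \<Omega> \<Longrightarrow> radial ?\<kappa> (H' y) (\<xi>' y) = 0"
      "\<And>y. y \<in> \<Omega> \<Longrightarrow> form ?\<kappa> (\<xi>' y) (\<xi>' y) = 1"
      "\<And>y. y \<in> \<Omega> \<Longrightarrow> dd 1 H' y = - dd \<i> f y *\<^sub>R \<xi>' y"
      "\<And>y. y \<in> \<Omega> \<Longrightarrow> dd \<i> H' y = dd 1 f y *\<^sub>R \<xi>' y"
      "\<And>y. y \<in> \<Omega> \<Longrightarrow> dd 1 \<xi>' y = (?\<kappa> * dd \<i> f y) *\<^sub>R H' y"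
      "\<And>y. y \<in> \<Omega> \<Longrightarrow> dd \<i> \<xi>' y = - (?\<kappa> * dd 1 f y) *\<^sub>R H' y"
      by (rule cylinder_frame[OF \<Omega>(1) H' f pos g' harm t(2)]) (assumption+, rule that)
    obtain w where w: "form ?\<kappa> (\<xi> p) w = 0" "form ?\<kappa> w w = 1" "frame M (H p) (\<xi> p) w"
      by (rule orthonormal_completion[OF H(2)[OF p] \<xi>(2,3)[OF p]]) (rule that)
    obtain w' where w': "form ?\<kappa> (\<xi>' p) w' = 0" "form ?\<kappa> w' w' = 1" "frame M (H' p) (\<xi>' p) w'"
      by (rule orthonormal_completion[OF H'(2)[OF p] \<xi>'(2,3)[OF p]]) (rule that)
    have gram: "form ?\<kappa> (\<xi> p) (\<xi> p) = form ?\<kappa> (\<xi>' p) (\<xi>' p)" "form ?\<kappa> (\<xi> p) w = form ?\<kappa> (\<xi>' p) w'"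
      "form ?\<kappa> w w = form ?\<kappa> w' w'"
      using w w' \<xi>(3)[OF p] \<xi>'(3)[OF p] by simp_all
    obtain A B where AB: "model_isometry M A" "model_isometry M B" "\<And>x. B (A x) = x" "\<And>x. A (B x) = x"
      and Ap: "A (H p) = H' p" "A (\<xi> p) = \<xi>' p" "A w = w'"
      by (rule exists_model_isometry_inverse[OF w(3) w'(3) gram]) (rule that)
    have lA: "linear A" and blA: "bounded_linear A" using AB(1) by (simp_all add: model_isometry_def linear_imp_bounded_linear)
    define h where "h y = \<bar>dd 1 f y\<bar> + \<bar>dd \<i> f y\<bar>" for y
    have "continuous_on (cball p r) h" unfolding h_def
      by (intro continuous_on_add continuous_on_rabs continuous_on_subset[OF smooth_on_continuous[OF smooth_on_dd[OF f]] r(2)])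
    then have "bounded (h ` cball p r)" by (intro compact_imp_bounded compact_continuous_image compact_cball)
    then obtain C where "\<forall>t\<in>h ` cball p r. norm t \<le> C" unfolding bounded_iff by blast
    then have C: "h y \<le> C" if "y \<in> cball p r" for y
      using that by (metis abs_le_D1 imageI real_norm_def)
    \<comment> \<open>\<open>(A H, A \<xi>)\<close> and \<open>(H', \<xi>')\<close> solve the same linear system\<close>
    define V where "V y = (A (H y) - H' y, A (\<xi> y) - \<xi>' y)" for y
    have "V y = 0" if y: "y \<in> ball p r" for y
    proof (rule gronwall_zero[OF _ _ _ y])
      show "V p = 0" by (simp add: V_def Ap zero_prod_def)
      fix y assume "y \<in> ball p r"
      then have yc: "y \<in> cball p r" and yS: "y \<in> \<Omega>" using r(2) by auto
      show "(V has_derivative (\<lambda>v. (A (dd v H y) - dd v H' y, A (dd v \<xi> y) - dd v \<xi>' y))) (at y)"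
        unfolding V_def[abs_def]
        by (intro has_derivative_Pair has_derivative_diff bounded_linear.has_derivative[OF blA]
            smooth_on_has_derivative[OF _ yS] H H' \<xi> \<xi>')
      fix v :: complex
      have d: "A (dd v H y) - dd v H' y = (Im v * dd 1 f y - Re v * dd \<i> f y) *\<^sub>R (A (\<xi> y) - \<xi>' y)"
        unfolding dd_complex_expand[OF H(1) yS, of v] dd_complex_expand[OF H'(1) yS, of v]
          \<xi>(4,5)[OF yS] \<xi>'(4,5)[OF yS]
        by (simp add: linear_add[OF lA] linear_scale[OF lA] linear_diff[OF lA] linear_neg[OF lA] algebra_simps)
      have d\<xi>: "A (dd v \<xi> y) - dd v \<xi>' y = (?\<kappa> * (Re v * dd \<i> f y - Im v * dd 1 f y)) *\<^sub>R (A (H y) - H' y)"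
        unfolding dd_complex_expand[OF \<xi>(1) yS, of v] dd_complex_expand[OF \<xi>'(1) yS, of v]
          \<xi>(6,7)[OF yS] \<xi>'(6,7)[OF yS]
        by (simp add: linear_add[OF lA] linear_scale[OF lA] linear_diff[OF lA] linear_neg[OF lA] algebra_simps)
      have k: "\<bar>?\<kappa>\<bar> \<le> 1" using curv_cases[of M] by auto
      have b: "\<bar>Im v * dd 1 f y - Re v * dd \<i> f y\<bar> \<le> norm v * C"
      proof -
        have "\<bar>Im v * dd 1 f y - Re v * dd \<i> f y\<bar> \<le> \<bar>Im v\<bar> * \<bar>dd 1 f y\<bar> + \<bar>Re v\<bar> * \<bar>dd \<i> f y\<bar>"
          by (metis abs_mult abs_triangle_ineq4)
        also have "\<dots> \<le> norm v * \<bar>dd 1 f y\<bar> + norm v * \<bar>dd \<i> f y\<bar>"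
          by (intro add_mono mult_right_mono abs_Re_le_cmod abs_Im_le_cmod) auto
        also have "\<dots> = norm v * h y" by (simp add: h_def distrib_left)
        also have "\<dots> \<le> norm v * C" by (intro mult_left_mono C yc) auto
        finally show ?thesis .
      qed
      have n1: "norm (A (dd v H y) - dd v H' y) \<le> norm v * C * norm (V y)"
        unfolding d norm_scaleR using b norm_snd_le[of "A (\<xi> y) - \<xi>' y" "A (H y) - H' y"]
        by (intro mult_mono) (auto simp: V_def intro: order_trans[OF abs_ge_zero])
      have "\<bar>?\<kappa> * (Re v * dd \<i> f y - Im v * dd 1 f y)\<bar> \<le> 1 * \<bar>Im v * dd 1 f y - Re v * dd \<i> f y\<bar>"
        unfolding abs_mult abs_minus_commute[of "Re v * dd \<i> f y"] using k by (intro mult_right_mono) auto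
      then have b2: "\<bar>?\<kappa> * (Re v * dd \<i> f y - Im v * dd 1 f y)\<bar> \<le> norm v * C" using b by simp
      have n2: "norm (A (dd v \<xi> y) - dd v \<xi>' y) \<le> norm v * C * norm (V y)"
        unfolding d\<xi> norm_scaleR using b2 norm_fst_le[of "A (H y) - H' y" "A (\<xi> y) - \<xi>' y"]
        by (intro mult_mono) (auto simp: V_def intro: order_trans[OF abs_ge_zero])
      have "norm (A (dd v H y) - dd v H' y, A (dd v \<xi> y) - dd v \<xi>' y)
          \<le> norm (A (dd v H y) - dd v H' y) + norm (A (dd v \<xi> y) - dd v \<xi>' y)" by (rule norm_Pair_le)
      also have "\<dots> \<le> 2 * C * norm v * norm (V y)" using n1 n2 by (simp add: mult_ac)
      finally show "norm (A (dd v H y) - dd v H' y, A (dd v \<xi> y) - dd v \<xi>' y) \<le> 2 * C * norm v * norm (V y)" .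
    qed
    then have "fst (V y) = 0" if "y \<in> ball p r" for y using that by simp
    then have "A (H y) = H' y" if "y \<in> ball p r" for y using that unfolding V_def by simp
    moreover have "ball p r \<subseteq> \<Omega>" using r(2) ball_subset_cball by blast
    ultimately show ?thesis using AB r(1) by blast
  qed
  then obtain A B p r where AB: "model_isometry M A" "model_isometry M B" "\<And>x. B (A x) = x" "\<And>x. A (B x) = x"
    and r: "0 < r" "ball p r \<subseteq> \<Omega>" "\<And>y. y \<in> ball p r \<Longrightarrow> A (H y) = H' y" by blast
  note AH = isometry_compose[OF AB(1) \<Omega>(1) H(1) HM]
  have "H' y = A (H y)" if y: "y \<in> \<Omega>" for y
  proof (rule euclidean_eqI)
    fix e :: point assume "e \<in> Basis"
    define u where "u y = A (H y) \<bullet> e + H' y \<bullet> (- e)" for y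
    have s1: "smooth_on (\<lambda>y. A (H y) \<bullet> e) \<Omega>" "smooth_on (\<lambda>y. H' y \<bullet> (- e)) \<Omega>"
      by (rule smooth_on_linear_compose[OF \<Omega>(1) bounded_linear_inner_left] AH(1) H'(1))+
    have us: "smooth_on u \<Omega>" unfolding u_def[abs_def] by (rule smooth_on_add[OF \<Omega>(1) s1])
    define q where "q y = - ?\<kappa> * (?E y + ?G y)" for y
    have q: "continuous_on \<Omega> q"
      unfolding q_def by (intro continuous_on_add continuous_on_mult continuous_on_const
          smooth_on_continuous[OF smooth_on_form] smooth_on_dd H \<Omega>)
    have lap: "dd 1 (dd 1 u) z + dd \<i> (dd \<i> u) z = q z * u z" if z: "z \<in> \<Omega>" for z
    proof -
      have d: "dd a u z = dd a (\<lambda>y. A (H y)) z \<bullet> e + dd a H' z \<bullet> (- e)" if "z \<in> \<Omega>" for a z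
        unfolding u_def[abs_def] dd_add[OF s1 that]
        by (simp add: dd_linear_compose[OF bounded_linear_inner_left AH(1) that]
            dd_linear_compose[OF bounded_linear_inner_left H'(1) that] del: inner_minus_right)
      have s2: "smooth_on (\<lambda>z. dd a (\<lambda>y. A (H y)) z \<bullet> e) \<Omega>" "smooth_on (\<lambda>z. dd a H' z \<bullet> (- e)) \<Omega>" for a
        by (rule smooth_on_linear_compose[OF \<Omega>(1) bounded_linear_inner_left] smooth_on_dd AH(1) H'(1))+
      have dd: "dd a (dd a u) z = A (dd a (dd a H) z) \<bullet> e + dd a (dd a H') z \<bullet> (- e)" for a
      proof -
        have "dd a (dd a u) z = dd a (\<lambda>z. dd a (\<lambda>y. A (H y)) z \<bullet> e + dd a H' z \<bullet> (- e)) z"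
          by (rule dd_cong[OF \<Omega>(1) z d])
        also have "\<dots> = dd a (dd a (\<lambda>y. A (H y))) z \<bullet> e + dd a (dd a H') z \<bullet> (- e)"
          unfolding dd_add[OF s2 z]
          by (simp add: dd_linear_compose[OF bounded_linear_inner_left smooth_on_dd[OF AH(1)] z]
              dd_linear_compose[OF bounded_linear_inner_left smooth_on_dd[OF H'(1)] z] del: inner_minus_right)
        finally show ?thesis unfolding AH(4)[OF z] .
      qed
      have lA: "linear A" using AB(1) by (simp add: model_isometry_def)
      have "dd 1 (dd 1 u) z + dd \<i> (dd \<i> u) z
        = A (dd 1 (dd 1 H) z + dd \<i> (dd \<i> H) z) \<bullet> e + (dd 1 (dd 1 H') z + dd \<i> (dd \<i> H') z) \<bullet> (- e)"
        unfolding dd linear_add[OF lA] by (simp add: inner_add_left)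
      also have "\<dots> = q z * u z"
        unfolding tension[OF z] tension'[OF z] same[OF z insertI1 insertI1] same[OF z insertI2[OF insertI1] insertI2[OF insertI1]]
          linear_scale[OF lA] by (simp add: q_def u_def algebra_simps)
      finally show ?thesis .
    qed
    have "u y = 0"
    proof (rule unique_continuation[OF \<Omega>(1,2) us q lap open_ball _ r(2) _ y])
      show "ball p r \<noteq> {}" using r(1) by simp
      show "u z = 0" if "z \<in> ball p r" for z using r(3)[OF that] by (simp add: u_def)
    qed
    then show "H' y \<bullet> e = A (H y) \<bullet> e" by (simp add: u_def)
  qed
  then show ?thesis using that AB by blast
qed

section \<open>Isometries of the product with the line\<close>

definition product_map :: "surface \<Rightarrow> (point \<Rightarrow> point) \<Rightarrow> real \<Rightarrow> real \<Rightarrow> point \<times> real \<Rightarrow> point \<times> real" where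
  "product_map M A s d Q = (emb_inv M (A (emb M (fst Q))), s * snd Q + d)"

lemma prod_chart_image:
  assumes "P \<in> prod_points M"
  shows "prod_chart M P ` prod_chart_domain M P = chart_range (curv M) \<times> UNIV"
proof -
  have p: "fst P \<in> points M" using assms by (auto simp: prod_points_def)
  show ?thesis
  proof (intro equalityI subsetI)
    fix x assume "x \<in> prod_chart M P ` prod_chart_domain M P"
    then show "x \<in> chart_range (curv M) \<times> UNIV"
      using emb_chart(1)[OF p] by (auto simp: prod_chart_def prod_chart_domain_def)
  next
    fix x assume "x \<in> chart_range (curv M) \<times> (UNIV :: real set)"
    then have z: "fst x \<in> chart_range (curv M)" by auto
    note c = chart_chart_emb[OF z, of "fst P"]
    have "x = prod_chart M P (emb_inv M (chart_emb (curv M) (pole M (fst P)) (fst x)), snd x)"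
      using c(2) by (simp add: prod_chart_def)
    then show "x \<in> prod_chart M P ` prod_chart_domain M P"
      by (rule image_eqI) (use c(1) in \<open>simp add: prod_chart_domain_def\<close>)
  qed
qed

lemma prod_chart_inv_formula:
  assumes "P \<in> prod_points M" "fst x \<in> chart_range (curv M)"
  shows "prod_chart_inv M P x = (emb_inv M (chart_emb (curv M) (pole M (fst P)) (fst x)), snd x)"
  unfolding prod_chart_inv_def
proof (rule inv_into_f_eq)
  have p: "fst P \<in> points M" using assms by (auto simp: prod_points_def)
  note c = chart_chart_emb[OF assms(2), of "fst P"]
  show "inj_on (prod_chart M P) (prod_chart_domain M P)"
  proof (rule inj_onI)
    fix Q R assume QR: "Q \<in> prod_chart_domain M P" "R \<in> prod_chart_domain M P" "prod_chart M P Q = prod_chart M P R"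
    then have q: "fst Q \<in> chart_domain M (fst P)" "fst R \<in> chart_domain M (fst P)"
      "chart M (fst P) (fst Q) = chart M (fst P) (fst R)" "snd Q = snd R"
      by (auto simp: prod_chart_domain_def prod_chart_def)
    have "emb M (fst Q) = emb M (fst R)"
      unfolding emb_chart(2)[OF p q(1)] emb_chart(2)[OF p q(2)] q(3) ..
    then have "fst Q = fst R"
      using emb_inv_emb subsetD[OF chart_domain_subset q(1)] subsetD[OF chart_domain_subset q(2)] by metis
    then show "Q = R" using q(4) by (simp add: prod_eq_iff)
  qed
  show "(emb_inv M (chart_emb (curv M) (pole M (fst P)) (fst x)), snd x) \<in> prod_chart_domain M P"
    using c(1) by (simp add: prod_chart_domain_def)
  show "prod_chart M P (emb_inv M (chart_emb (curv M) (pole M (fst P)) (fst x)), snd x) = x"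
    using c(2) by (simp add: prod_chart_def)
qed

text \<open>
In charts the map is \<open>(z, t) \<mapsto> (fst W / (1 + \<epsilon> snd W), s t + d)\<close> with \<open>W = A (E z)\<close>, which is smooth where the
denominator does not vanish, that is, where the image lies in the chart domain. A map \<open>\<Phi>\<close> that
agrees with the product map on the points of the manifold is allowed, since an inverse is only known
there.
\<close>

lemma product_map_charts:
  assumes A: "model_isometry M A" and \<Phi>: "\<And>Q. Q \<in> prod_points M \<Longrightarrow> \<Phi> Q = product_map M A s d Q"
    and P: "P \<in> prod_points M"
  defines "S \<equiv> chart_range (curv M) \<times> (UNIV :: real set)" and "Y \<equiv> \<Phi> \<circ> prod_chart_inv M P"
  shows "smooth_into M Y S"
    and "\<And>y. y \<in> S \<Longrightarrow> horizontal M Y y = A (chart_emb (curv M) (pole M (fst P)) (fst y))"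
    and "\<And>y. y \<in> S \<Longrightarrow> height Y y = s * snd y + d"
proof -
  let ?\<kappa> = "curv M"
  let ?\<epsilon> = "pole M (fst P)"
  define W where "W y = A (chart_emb ?\<kappa> ?\<epsilon> (fst y))" for y :: "complex \<times> real"
  have oS: "open S" unfolding S_def by (intro open_Times open_chart_range open_UNIV)
  have Wm: "W y \<in> model M" if "y \<in> S" for y
    using A chart_emb_in_model[of "fst y" M "fst P"] that by (auto simp: model_isometry_def W_def S_def)
  have Y: "Y y = (emb_inv M (W y), s * snd y + d)" if y: "y \<in> S" for y
  proof -
    have z: "fst y \<in> chart_range ?\<kappa>" using y by (auto simp: S_def)
    note c = chart_chart_emb[OF z, of "fst P"]
    have "prod_chart_inv M P y \<in> prod_points M"
      unfolding prod_chart_inv_formula[OF P z]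
      using subsetD[OF chart_domain_subset c(1)] by (simp add: prod_points_def)
    from \<Phi>[OF this] show ?thesis
      unfolding Y_def prod_chart_inv_formula[OF P z] using prod_chart_inv_formula[OF P z] c(3)
      by (simp add: product_map_def W_def)
  qed
  show "horizontal M Y y = A (chart_emb ?\<kappa> ?\<epsilon> (fst y))" if "y \<in> S" for y
    using Y[OF that] model_emb(2)[OF Wm[OF that]] by (simp add: horizontal_def W_def)
  show "height Y y = s * snd y + d" if "y \<in> S" for y
    using Y[OF that] by (simp add: height_def)
  have blA: "bounded_linear A" using A by (simp add: model_isometry_def linear_imp_bounded_linear)
  have smW: "smooth_on W S"
    unfolding W_def[abs_def]
    by (intro smooth_on_linear_compose[OF oS blA] smooth_on_compose[OF oS open_chart_range _ smooth_on_chart_emb]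
        smooth_on_fst smooth_on_id oS) (auto simp: S_def)
  have pts: "fst (Y y) \<in> points M" "emb M (fst (Y y)) = W y" if "y \<in> S" for y
    using Y[OF that] model_emb[OF Wm[OF that]] by simp_all
  show "smooth_into M Y S"
    unfolding smooth_into_def
  proof (intro conjI ballI)
    show "Y ` S \<subseteq> prod_points M"
      unfolding prod_points_def using pts(1) by (simp add: image_subset_iff mem_Times_iff del: split_paired_All)
    fix x assume x: "x \<in> S"
    define e where "e = pole M (fst (Y x))"
    define D where "D y = 1 + e * snd (W y)" for y
    define U where "U = {y \<in> S. D y \<noteq> 0}"
    have smD: "smooth_on D S"
      unfolding D_def by (intro smooth_on_add smooth_on_mult smooth_on_const smooth_on_snd smW oS)
    have "open (S \<inter> D -` (- {0}))"
      by (rule continuous_open_preimage[OF smooth_on_continuous[OF smD] oS]) auto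
    moreover have "S \<inter> D -` (- {0}) = U" by (auto simp: U_def)
    ultimately have oU: "open U" by simp
    have US: "U \<subseteq> S" by (auto simp: U_def)
    have dom: "fst (Y y) \<in> chart_domain M (fst (Y x)) \<longleftrightarrow> D y \<noteq> 0" if "y \<in> S" for y
      using pts[OF that] by (simp add: chart_domain_iff D_def e_def)
    have xU: "x \<in> U" using x dom[OF x] points_in_own_chart[OF pts(1)[OF x]] by (simp add: U_def)
    have YU: "Y ` U \<subseteq> prod_chart_domain M (Y x)"
      unfolding prod_chart_domain_def using dom US
      by (simp add: image_subset_iff mem_Times_iff U_def del: split_paired_All)
    have "smooth_on (\<lambda>y. (inverse (D y) *\<^sub>R fst (W y), s * snd y + d)) U"
      by (intro smooth_on_Pair smooth_on_scaleR smooth_on_inverse smooth_on_add smooth_on_mult smooth_on_const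
          smooth_on_fst smooth_on_snd smooth_on_id smooth_on_subset[OF smD US] smooth_on_subset[OF smW US] oU)
        (simp add: U_def)
    then have "smooth_on (local_rep M Y x) U"
    proof (rule smooth_on_cong[OF oU])
      fix y assume y: "y \<in> U"
      then have yS: "y \<in> S" using US by blast
      show "(inverse (D y) *\<^sub>R fst (W y), s * snd y + d) = local_rep M Y x y"
        unfolding local_rep_def prod_chart_def
        using chart_formula[OF pts(1)[OF yS], of "fst (Y x)"] pts(2)[OF yS] Y[OF yS]
        by (simp add: D_def e_def)
    qed
    then show "\<exists>U. open U \<and> x \<in> U \<and> U \<subseteq> S \<and> Y ` U \<subseteq> prod_chart_domain M (Y x) \<and> smooth_on (local_rep M Y x) U"
      using oU xU US YU by blast
  qed
qed

lemma product_map_isometry: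
  assumes A: "model_isometry M A" and B: "model_isometry M B"
    and inv: "\<And>x. B (A x) = x" "\<And>x. A (B x) = x" and s: "s * s = 1"
  shows "prod_isometry M (product_map M A s d)"
proof -
  let ?\<Phi> = "product_map M A s d"
  \<comment> \<open>\<open>t = s t' - s d\<close> solves \<open>t' = s t + d\<close>, as \<open>s\<^sup>2 = 1\<close>\<close>
  let ?\<Psi> = "product_map M B s (- s * d)"
  let ?N = "prod_points M"
  have emb: "emb M (emb_inv M (C (emb M p))) = C (emb M p)" "emb_inv M (C (emb M p)) \<in> points M"
    if "model_isometry M C" "p \<in> points M" for C p
    using model_emb[of "C (emb M p)" M] emb_in_model[OF that(2)] that(1) by (simp_all add: model_isometry_def)
  have ss: "s * (s * t) = t" for t using s by (metis mult.assoc mult_1)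
  have 1: "?\<Psi> (?\<Phi> Q) = Q" "?\<Phi> Q \<in> ?N" "?\<Phi> (?\<Psi> Q) = Q" "?\<Psi> Q \<in> ?N" if "Q \<in> ?N" for Q
  proof -
    have p: "fst Q \<in> points M" using that by (auto simp: prod_points_def)
    note e = emb[OF A p] emb[OF B p]
    show "?\<Psi> (?\<Phi> Q) = Q" "?\<Phi> (?\<Psi> Q) = Q" "?\<Phi> Q \<in> ?N" "?\<Psi> Q \<in> ?N"
      using e p by (cases Q, simp add: product_map_def inv emb_inv_emb prod_points_def algebra_simps ss s)+
  qed
  have bij: "bij_betw ?\<Phi> ?N ?N"
    by (rule bij_betw_byWitness[where f' = ?\<Psi>]) (use 1 in auto)
  have invinto: "inv_into ?N ?\<Phi> Q = ?\<Psi> Q" if "Q \<in> ?N" for Q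
    by (rule inv_into_f_eq) (use bij 1[OF that] in \<open>auto simp: bij_betw_def\<close>)
  have sm: "smooth_self_map M ?\<Phi>" "smooth_self_map M (inv_into ?N ?\<Phi>)"
    unfolding smooth_self_map_def
  proof (safe)
    fix p t assume P: "(p, t) \<in> ?N"
    show "smooth_into M (?\<Phi> \<circ> prod_chart_inv M (p, t)) (prod_chart M (p, t) ` prod_chart_domain M (p, t))"
      unfolding prod_chart_image[OF P] by (rule product_map_charts(1)[OF A refl P])
    show "smooth_into M (inv_into ?N ?\<Phi> \<circ> prod_chart_inv M (p, t)) (prod_chart M (p, t) ` prod_chart_domain M (p, t))"
      unfolding prod_chart_image[OF P] by (rule product_map_charts(1)[OF B invinto P])
  qed
  have "induced_metric M (?\<Phi> \<circ> prod_chart_inv M P) (prod_chart M P P) \<xi> \<eta> = prod_metric M (prod_chart M P P) \<xi> \<eta>"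
    if P: "P \<in> ?N" for P \<xi> \<eta>
  proof -
    let ?S = "chart_range (curv M) \<times> (UNIV :: real set)"
    let ?\<epsilon> = "pole M (fst P)"
    define Y where "Y = ?\<Phi> \<circ> prod_chart_inv M P"
    define x where "x = prod_chart M P P"
    note Y = product_map_charts[OF A refl P, where s = s and d = d, folded Y_def]
    have oS: "open ?S" by (intro open_Times open_chart_range open_UNIV)
    have p: "fst P \<in> points M" using P by (auto simp: prod_points_def)
    have "P \<in> prod_chart_domain M P"
      using points_in_own_chart[OF p] by (simp add: prod_chart_domain_def mem_Times_iff)
    then have x: "x \<in> ?S" unfolding x_def prod_chart_image[OF P, symmetric] by blast
    then have z: "fst x \<in> chart_range (curv M)" by auto
    have lA: "bounded_linear A" using A by (simp add: model_isometry_def linear_imp_bounded_linear)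
    have L: "dd v (horizontal M Y) x = A (d_chart_emb (curv M) ?\<epsilon> (fst x) (fst v))" for v
    proof -
      have "dd v (horizontal M Y) x = dd v (\<lambda>y. A (chart_emb (curv M) ?\<epsilon> (fst y))) x" by (rule dd_cong[OF oS x Y(2)])
      also have "\<dots> = A (d_chart_emb (curv M) ?\<epsilon> (fst x) (fst v))"
        by (rule dd_eqI[OF bounded_linear.has_derivative[OF lA has_derivative_compose[OF
                has_derivative_fst[OF has_derivative_ident] chart_emb_has_derivative[OF admissible_pole z]]]])
      finally show ?thesis .
    qed
    have h: "dd v (height Y) x = s * snd v" for v
    proof -
      have "dd v (height Y) x = dd v (\<lambda>y. s * snd y + d) x" by (rule dd_cong[OF oS x Y(3)])
      also have "\<dots> = s * snd v" by (rule dd_eqI) (auto intro!: derivative_eq_intros)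
      finally show ?thesis .
    qed
    have "form (curv M) (A (d_chart_emb (curv M) ?\<epsilon> (fst x) a)) (A (d_chart_emb (curv M) ?\<epsilon> (fst x) b))
      = form (curv M) (d_chart_emb (curv M) ?\<epsilon> (fst x) a) (d_chart_emb (curv M) ?\<epsilon> (fst x) b)" for a b
      using A chart_emb_in_model[OF z, of "fst P"] radial_d_chart_emb[OF admissible_pole z] unfolding model_isometry_def by blast
    then have "induced_metric M Y x \<xi> \<eta> = (conf_factor (curv M) (fst x))\<^sup>2 * (fst \<xi> \<bullet> fst \<eta>) + s * snd \<xi> * (s * snd \<eta>)"
      unfolding induced_metric_horizontal[OF Y(1) x] L h by (simp add: form_d_chart_emb[OF admissible_pole z])
    also have "\<dots> = prod_metric M x \<xi> \<eta>"
      using ss[of "snd \<xi> * snd \<eta>"] by (simp add: prod_metric_def conf_eq_conf_factor mult_ac)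
    finally show ?thesis unfolding Y_def x_def .
  qed
  then show ?thesis unfolding prod_isometry_def using bij sm by blast
qed

section \<open>Congruence of isometric surfaces with the same Hopf differential\<close>

lemma complex_equal_squares:
  fixes a b a' b' :: real
  assumes "a\<^sup>2 - b\<^sup>2 = a'\<^sup>2 - b'\<^sup>2" "a * b = a' * b'"
  shows "(a' = a \<and> b' = b) \<or> (a' = - a \<and> b' = - b)"
proof -
  have "(Complex a b)\<^sup>2 = (Complex a' b')\<^sup>2"
    using assms by (simp add: complex_eq_iff power2_eq_square mult.commute[of b a] mult.commute[of b' a'])
  then have "Complex a b = Complex a' b' \<or> Complex a b = - Complex a' b'" by (simp add: power2_eq_iff)
  then show ?thesis by (auto simp: complex_eq_iff)
qed

theorem theorem4:
  fixes M :: surface and \<Omega> :: "complex set"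
    and h h' :: "complex \<Rightarrow> point" and f f' :: "complex \<Rightarrow> real"
    and X X' :: "complex \<Rightarrow> point \<times> real"
  assumes "open \<Omega>" and "simply_connected \<Omega>"
    and "X = (\<lambda>w. (h w, f w))" and "X' = (\<lambda>w. (h' w, f' w))"
    and "conformal_minimal_immersion M \<Omega> X" and "conformal_minimal_immersion M \<Omega> X'"
    and "isometric_on M \<Omega> X X'"
    and "\<forall>w\<in>\<Omega>. hopf M h w = hopf M h' w"
  shows "\<exists>\<Phi>. prod_isometry M \<Phi> \<and> (\<forall>w\<in>\<Omega>. X' w = \<Phi> (X w))"
proof (cases "\<Omega> = {}")
  case True
  have "model_isometry M (\<lambda>x. x)" by (simp add: model_isometry_def linear_ident)
  then have "prod_isometry M (product_map M (\<lambda>x. x) 1 0)"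
    by (rule product_map_isometry[OF _ \<open>model_isometry M (\<lambda>x. x)\<close>]) auto
  then show ?thesis using True by blast
next
  case False
  let ?\<kappa> = "curv M"
  define H where "H = horizontal M X"
  define H' where "H' = horizontal M X'"
  have con: "connected \<Omega>" using assms(2) by (simp add: simply_connected_imp_connected)
  have sm: "smooth_into M X \<Omega>" "smooth_into M X' \<Omega>"
    using assms(5,6) by (auto simp: conformal_minimal_immersion_def immersion_on_def)
  have height: "height X = f" "height X' = f'" by (simp_all add: fun_eq_iff height_def assms(3,4))
  note s = smooth_on_horizontal[OF sm(1), folded H_def] smooth_on_horizontal[OF sm(2), folded H'_def]
    smooth_on_height[OF sm(1), unfolded height] smooth_on_height[OF sm(2), unfolded height]
  note mo = horizontal_in_model[OF sm(1), folded H_def] horizontal_in_model[OF sm(2), folded H'_def]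
  note eq = conformal_minimal_equations[OF assms(1,5), unfolded height, folded H_def]
  note eq' = conformal_minimal_equations[OF assms(1,6), unfolded height, folded H'_def]
  have iso: "form ?\<kappa> (dd a H w) (dd b H w) + dd a f w * dd b f w = form ?\<kappa> (dd a H' w) (dd b H' w) + dd a f' w * dd b f' w"
    if "w \<in> \<Omega>" for a b w
    using assms(7) that induced_metric_horizontal[OF sm(1) that, of a b] induced_metric_horizontal[OF sm(2) that, of a b]
    unfolding isometric_on_def height H_def H'_def by simp
  have hopf: "form ?\<kappa> (dd 1 H w) (dd 1 H w) - form ?\<kappa> (dd \<i> H w) (dd \<i> H w) = form ?\<kappa> (dd 1 H' w) (dd 1 H' w) - form ?\<kappa> (dd \<i> H' w) (dd \<i> H' w)"
    "form ?\<kappa> (dd 1 H w) (dd \<i> H w) = form ?\<kappa> (dd 1 H' w) (dd \<i> H' w)" if "w \<in> \<Omega>" for w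
    using assms(8) that hopf_horizontal[OF sm(1) that assms(3)] hopf_horizontal[OF sm(2) that assms(4)]
    unfolding H_def H'_def by simp_all
  have sq: "(dd 1 f' w = dd 1 f w \<and> dd \<i> f' w = dd \<i> f w) \<or> (dd 1 f' w = - dd 1 f w \<and> dd \<i> f' w = - dd \<i> f w)"
    if w: "w \<in> \<Omega>" for w
  proof (rule complex_equal_squares)
    show "(dd 1 f w)\<^sup>2 - (dd \<i> f w)\<^sup>2 = (dd 1 f' w)\<^sup>2 - (dd \<i> f' w)\<^sup>2"
      using iso[OF w, of 1 1] iso[OF w, of \<i> \<i>] hopf(1)[OF w] by (simp add: power2_eq_square)
    show "dd 1 f w * dd \<i> f w = dd 1 f' w * dd \<i> f' w" using iso[OF w, of 1 \<i>] hopf(2)[OF w] by simp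
  qed
  have same: "form ?\<kappa> (dd a H' w) (dd b H' w) = form ?\<kappa> (dd a H w) (dd b H w)"
    if "w \<in> \<Omega>" "a \<in> {1, \<i>}" "b \<in> {1, \<i>}" for w a b
  proof -
    have "dd a f' w * dd b f' w = dd a f w * dd b f w" using sq[OF that(1)] that(2,3) by auto
    then show ?thesis using iso[OF that(1), of a b] by simp
  qed
  obtain \<sigma> d where \<sigma>: "\<sigma> * \<sigma> = 1" "\<And>w. w \<in> \<Omega> \<Longrightarrow> f' w = \<sigma> * f w + d"
    by (rule harmonic_equal_squares[OF assms(1) con False s(3,4) eq(4) eq'(4) sq]) (assumption+, rule that)
  obtain A B where AB: "model_isometry M A" "model_isometry M B" "\<And>x. B (A x) = x" "\<And>x. A (B x) = x"
    and A: "\<And>w. w \<in> \<Omega> \<Longrightarrow> H' w = A (H w)"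
    by (rule harmonic_congruence[OF assms(1) con False s(1) mo(1) s(2) mo(2) s(3) eq(1-4) same eq(5) eq'(5)])
      (assumption+, rule that)
  have "X' w = product_map M A \<sigma> d (X w)" if w: "w \<in> \<Omega>" for w
  proof -
    have "X' w \<in> prod_points M" using sm(2) w by (auto simp: smooth_into_def)
    then have p: "h' w \<in> points M" by (simp add: assms(4) prod_points_def)
    have "h' w = emb_inv M (emb M (h' w))" using emb_inv_emb[OF p] by simp
    also have "emb M (h' w) = A (emb M (h w))" using A[OF w] by (simp add: H_def H'_def horizontal_def assms(3,4))
    finally show ?thesis using \<sigma>(2)[OF w] by (simp add: assms(3,4) product_map_def)
  qed
  then show ?thesis using product_map_isometry[OF AB \<sigma>(1)] by blast
qed

end
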